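(* Let $H_1,H_2$ be two discrete one-dimensional Schrödinger operators of the form $[H_j\psi](n)=\psi(n+1)+\psi(n-1)+V_j(n)\psi(n)$, on $\ell^2(\mathbb{Z})$ or on $\ell^2(\mathbb{Z}_+)$, with bounded real-valued potentials $V_1,V_2$, and let $K\ge4$ be such that $\sigma(H_j)\subseteq[-K+1,K-1]$ for $j=1,2$. Denote the corresponding transfer matrices by $\Phi_1,\Phi_2$ and the corresponding transport exponents by $\alpha^\pm_{1,u},\alpha^\pm_{2,u}$. Assume there exists $A>0$ such that for all $E\in[-K,K]$, $0<\varepsilon\le1$, $|n|\le1/\varepsilon$, $$\varepsilon^A\|\Phi_1(n,E+i\varepsilon)\|\lesssim\|\Phi_2(n,E+i\varepsilon)\|\lesssim\varepsilon^{-A}\|\Phi_1(n,E+i\varepsilon)\|.$$ Then $\alpha_{1,u}^\pm=\alpha_{2,u}^\pm$ (that is, $\alpha_{1,u}^+=\alpha_{2,u}^+$ and $\alpha_{1,u}^-=\alpha_{2,u}^-$).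
   Context: $\mathbb{Z}_+=\{1,2,\ldots\}$. In the case of $\ell^2(\mathbb{Z}_+)$ the operators are taken with the Dirichlet boundary condition $\psi(0)=0$, and the indices $n$ in the hypothesis are the integers $n\ge0$ with $n\le1/\varepsilon$; in the case of $\ell^2(\mathbb{Z})$ they are all integers $n$ with $|n|\le1/\varepsilon$. $f\lesssim g$ means $f\le Cg$ with a constant $C>0$ independent of $E,\varepsilon,n$. Transfer matrices of the operator with potential $V$: for $z\in\mathbb{C}$ put $T(m,z)=\begin{pmatrix} z-V(m)&-1\\1&0\end{pmatrix}$, and $\Phi(n,z)=T(n,z)\cdots T(1,z)$ for $n\ge1$, $\Phi(0,z)=\mathrm{Id}$, and (whole-line case) $\Phi(n,z)=[T(n+1,z)]^{-1}\cdots[T(0,z)]^{-1}$ for $n\le-1$. $\|\cdot\|$ is the operator norm. Transport exponents of an operator $H$: let $(\delta_n)$ be the canonical basis of $\ell^2(\mathbb{Z})$ (resp. $\ell^2(\mathbb{Z}_+)$). For $T>0$ let $a(n,T)=\frac{2}{T}\int_0^\infty e^{-2t/T}|\langle e^{-itH}\delta_1,\delta_n\rangle|^2\,dt$, and for real $N$ let $P(N,T)=\sum_{|n|>N}a(n,T)$, the sum being over $n$ in $\mathbb{Z}$ (resp. $\mathbb{Z}_+$). For $\alpha\in[0,+\infty]$ let $S^-(\alpha)=-\liminf_{T\to\infty}\frac{\log P(T^\alpha-2,T)}{\log T}$ and $S^+(\alpha)=-\limsup_{T\to\infty}\frac{\log P(T^\alpha-2,T)}{\log T}$ (values in $[0,\infty]$),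 and $\alpha_u^\pm=\sup\{\alpha\ge0: S^\pm(\alpha)<\infty\}$. *)

theory Defs
  imports "HOL-Analysis.Analysis"
begin

section \<open>The Hilbert space of square-summable families\<close>

typedef 'a ell2 = "{f :: 'a \<Rightarrow> complex. (\<lambda>x. (cmod (f x))\<^sup>2) summable_on UNIV}"
  morphisms coord Abs_ell2
  by (rule exI[of _ "\<lambda>_. 0"]) simp

setup_lifting type_definition_ell2

lemma coord_summable: "(\<lambda>x. (cmod (coord f x))\<^sup>2) summable_on UNIV"
  using coord[of f] by simp

lemma ell2_eqI: "(\<And>x. coord f x = coord g x) \<Longrightarrow> f = g"
  by (metis coord_inject ext)

lemma sq_summable_add:
  assumes "(\<lambda>x. (cmod (f x))\<^sup>2) summable_on UNIV" "(\<lambda>x. (cmod (g x))\<^sup>2) summable_on UNIV"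
  shows "(\<lambda>x. (cmod (f x + g x))\<^sup>2) summable_on UNIV"
proof (rule summable_on_comparison_test)
  show "(\<lambda>x. 2 * (cmod (f x))\<^sup>2 + 2 * (cmod (g x))\<^sup>2) summable_on UNIV"
    by (intro summable_on_add summable_on_cmult_right assms)
  fix x
  have "(cmod (f x + g x))\<^sup>2 \<le> (cmod (f x) + cmod (g x))\<^sup>2"
    by (simp add: norm_triangle_ineq power_mono)
  also have "\<dots> \<le> 2 * (cmod (f x))\<^sup>2 + 2 * (cmod (g x))\<^sup>2"
    using zero_le_power2[of "cmod (f x) - cmod (g x)"] by (simp add: power2_eq_square algebra_simps)
  finally show "(cmod (f x + g x))\<^sup>2 \<le> 2 * (cmod (f x))\<^sup>2 + 2 * (cmod (g x))\<^sup>2" .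
qed auto

lemma sq_summable_cmult:
  assumes "(\<lambda>x. (cmod (f x))\<^sup>2) summable_on UNIV"
  shows "(\<lambda>x. (cmod (c * f x))\<^sup>2) summable_on UNIV"
  using summable_on_cmult_right[OF assms, of "(cmod c)\<^sup>2"]
  by (simp add: norm_mult power_mult_distrib)

instantiation ell2 :: (type) real_vector
begin

lift_definition zero_ell2 :: "'a ell2" is "\<lambda>_. 0" by simp

lift_definition plus_ell2 :: "'a ell2 \<Rightarrow> 'a ell2 \<Rightarrow> 'a ell2" is "\<lambda>f g x. f x + g x"
  by (rule sq_summable_add)

lift_definition uminus_ell2 :: "'a ell2 \<Rightarrow> 'a ell2" is "\<lambda>f x. - f x" by simp

lift_definition minus_ell2 :: "'a ell2 \<Rightarrow> 'a ell2 \<Rightarrow> 'a ell2" is "\<lambda>f g x. f x - g x"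
  using sq_summable_add[of _ "\<lambda>x. - _ x"] by simp

lift_definition scaleR_ell2 :: "real \<Rightarrow> 'a ell2 \<Rightarrow> 'a ell2" is "\<lambda>r f x. r *\<^sub>R f x"
  using sq_summable_cmult[of _ "of_real _"] by (simp add: scaleR_conv_of_real)

instance
  by standard (transfer; auto simp: algebra_simps)+

end

lift_definition cscale :: "complex \<Rightarrow> 'a ell2 \<Rightarrow> 'a ell2" (infixr \<open>*\<^sub>C\<close> 75)
  is "\<lambda>c f x. c * f x"
  by (rule sq_summable_cmult)

lemma coord_simps [simp]:
  "coord 0 x = 0"
  "coord (f + g) x = coord f x + coord g x"
  "coord (f - g) x = coord f x - coord g x"
  "coord (- f) x = - coord f x"
  "coord (r *\<^sub>R f) x = r *\<^sub>R coord f x"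
  "coord (c *\<^sub>C f) x = c * coord f x"
  by (transfer; simp)+

lemma coord_mult_summable:
  "(\<lambda>x. norm (coord f x * cnj (coord g x))) summable_on UNIV"
proof (rule summable_on_comparison_test)
  show "(\<lambda>x. (cmod (coord f x))\<^sup>2 + (cmod (coord g x))\<^sup>2) summable_on UNIV"
    by (intro summable_on_add coord_summable)
  fix x
  have "2 * (cmod (coord f x) * cmod (coord g x)) \<le> (cmod (coord f x))\<^sup>2 + (cmod (coord g x))\<^sup>2"
    using zero_le_power2[of "cmod (coord f x) - cmod (coord g x)"]
    by (simp add: power2_eq_square algebra_simps)
  moreover have "0 \<le> cmod (coord f x) * cmod (coord g x)" by simp
  ultimately have "cmod (coord f x) * cmod (coord g x) \<le> (cmod (coord f x))\<^sup>2 + (cmod (coord g x))\<^sup>2"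
    by linarith
  then show "norm (coord f x * cnj (coord g x)) \<le> (cmod (coord f x))\<^sup>2 + (cmod (coord g x))\<^sup>2"
    by (simp add: norm_mult)
qed auto

lemma coord_inner_summable:
  "(\<lambda>x. inner (coord f x) (coord g x)) summable_on UNIV"
proof -
  have "(\<lambda>x. Re (coord f x * cnj (coord g x))) summable_on UNIV"
    using abs_summable_summable[OF coord_mult_summable] by (rule summable_on_Re)
  then show ?thesis by (simp add: inner_complex_def)
qed

definition cinner :: "'a ell2 \<Rightarrow> 'a ell2 \<Rightarrow> complex" where
  "cinner f g = (\<Sum>\<^sub>\<infinity>x. coord f x * cnj (coord g x))"

instantiation ell2 :: (type) real_inner
begin

definition inner_ell2 :: "'a ell2 \<Rightarrow> 'a ell2 \<Rightarrow> real" where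
  "inner_ell2 f g = (\<Sum>\<^sub>\<infinity>x. inner (coord f x) (coord g x))"

definition norm_ell2 :: "'a ell2 \<Rightarrow> real" where
  "norm_ell2 f = sqrt (inner f f)"

definition dist_ell2 :: "'a ell2 \<Rightarrow> 'a ell2 \<Rightarrow> real" where
  "dist_ell2 f g = norm (f - g)"

definition sgn_ell2 :: "'a ell2 \<Rightarrow> 'a ell2" where
  "sgn_ell2 f = f /\<^sub>R norm f"

definition uniformity_ell2 :: "('a ell2 \<times> 'a ell2) filter" where
  "uniformity_ell2 = (INF e\<in>{0<..}. principal {(x, y). dist x y < e})"

definition open_ell2 :: "'a ell2 set \<Rightarrow> bool" where
  "open_ell2 U \<longleftrightarrow> (\<forall>x\<in>U. eventually (\<lambda>(x', y). x' = x \<longrightarrow> y \<in> U) uniformity)"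

instance
proof
  fix f g h :: "'a ell2" and r :: real
  show "dist f g = norm (f - g)" by (rule dist_ell2_def)
  show "sgn f = f /\<^sub>R norm f" by (rule sgn_ell2_def)
  show "inner f g = inner g f" by (simp add: inner_ell2_def inner_commute)
  show "inner (f + g) h = inner f h + inner g h"
    by (simp add: inner_ell2_def inner_add_left infsum_add coord_inner_summable)
  show "inner (r *\<^sub>R f) g = r * inner f g"
    by (simp add: inner_ell2_def infsum_cmult_right')
  show "0 \<le> inner f f" by (simp add: inner_ell2_def infsum_nonneg)
  show "inner f f = 0 \<longleftrightarrow> f = 0"
  proof
    assume "inner f f = 0"
    then have "inner (coord f x) (coord f x) = 0" for x
      unfolding inner_ell2_def
      by (intro nonneg_infsum_le_0D[of "\<lambda>x. inner (coord f x) (coord f x)" UNIV])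
        (auto simp: coord_inner_summable)
    then show "f = 0" by (intro ell2_eqI) simp
  qed (simp add: inner_ell2_def)
  show "norm f = sqrt (inner f f)" by (rule norm_ell2_def)
qed (rule uniformity_ell2_def open_ell2_def)+

end

lemma norm_ell2_eq: "norm f = sqrt (\<Sum>\<^sub>\<infinity>x. (cmod (coord f x))\<^sup>2)"
  by (simp add: norm_ell2_def inner_ell2_def dot_square_norm)

lemma norm_ell2_power2: "(norm f)\<^sup>2 = (\<Sum>\<^sub>\<infinity>x. (cmod (coord f x))\<^sup>2)"
  by (simp add: norm_ell2_eq infsum_nonneg)

lemma norm_ell2_finite_sum:
  assumes "finite F"
  shows "(\<Sum>x\<in>F. (cmod (coord f x))\<^sup>2) \<le> (norm f)\<^sup>2"
  unfolding norm_ell2_power2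
  by (rule finite_sum_le_infsum) (auto simp: coord_summable assms)

lemma cmod_coord_le: "cmod (coord f x) \<le> norm f"
  using norm_ell2_finite_sum[of "{x}" f] by (simp add: power2_le_iff_abs_le)

lemma norm_cscale [simp]: "norm (c *\<^sub>C f) = cmod c * norm f"
  by (simp add: norm_ell2_eq norm_mult power_mult_distrib infsum_cmult_right' real_sqrt_mult)

lemma sq_bounded_ell2:
  assumes "\<And>F. finite F \<Longrightarrow> (\<Sum>x\<in>F. (cmod (g x))\<^sup>2) \<le> B"
  shows "(\<lambda>x. (cmod (g x))\<^sup>2) summable_on UNIV"
    and "(\<Sum>\<^sub>\<infinity>x. (cmod (g x))\<^sup>2) \<le> B"
proof -
  show *: "(\<lambda>x. (cmod (g x))\<^sup>2) summable_on UNIV"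
    by (rule nonneg_bdd_above_summable_on) (auto intro!: bdd_aboveI[of _ B] assms)
  show "(\<Sum>\<^sub>\<infinity>x. (cmod (g x))\<^sup>2) \<le> B"
    by (rule infsum_le_finite_sums[OF *]) (auto intro: assms)
qed

instance ell2 :: (type) banach
proof
  fix X :: "nat \<Rightarrow> 'a ell2"
  assume X: "Cauchy X"
  have "Cauchy (\<lambda>n. coord (X n) x)" for x
  proof (rule CauchyI)
    fix e :: real assume "0 < e"
    then obtain N where N: "\<And>m n. m \<ge> N \<Longrightarrow> n \<ge> N \<Longrightarrow> norm (X m - X n) < e"
      using CauchyD[OF X] by blast
    have "cmod (coord (X m) x - coord (X n) x) \<le> norm (X m - X n)" for m n
      using cmod_coord_le[of "X m - X n" x] by simp
    then show "\<exists>N. \<forall>m\<ge>N. \<forall>n\<ge>N. norm (coord (X m) x - coord (X n) x) < e"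
      using N by (meson le_less_trans)
  qed
  then obtain g where g: "\<And>x. (\<lambda>n. coord (X n) x) \<longlonglongrightarrow> g x"
    unfolding Cauchy_convergent_iff convergent_def by metis
  have ev: "\<exists>N. \<forall>m\<ge>N. \<forall>F. finite F \<longrightarrow> (\<Sum>x\<in>F. (cmod (coord (X m) x - g x))\<^sup>2) \<le> e\<^sup>2"
    if "0 < e" for e :: real
  proof -
    obtain N where N: "\<And>m n. m \<ge> N \<Longrightarrow> n \<ge> N \<Longrightarrow> norm (X m - X n) < e"
      using CauchyD[OF X \<open>0 < e\<close>] by blast
    have "(\<Sum>x\<in>F. (cmod (coord (X m) x - g x))\<^sup>2) \<le> e\<^sup>2" if "m \<ge> N" "finite F" for m F
    proof (rule LIMSEQ_le_const2)
      show "(\<lambda>n. \<Sum>x\<in>F. (cmod (coord (X m) x - coord (X n) x))\<^sup>2)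
              \<longlonglongrightarrow> (\<Sum>x\<in>F. (cmod (coord (X m) x - g x))\<^sup>2)"
        by (intro tendsto_intros g)
      have "(\<Sum>x\<in>F. (cmod (coord (X m) x - coord (X n) x))\<^sup>2) \<le> e\<^sup>2" if "n \<ge> N" for n
      proof -
        have "(\<Sum>x\<in>F. (cmod (coord (X m) x - coord (X n) x))\<^sup>2) \<le> (norm (X m - X n))\<^sup>2"
          using norm_ell2_finite_sum[OF \<open>finite F\<close>, of "X m - X n"] by simp
        also have "\<dots> \<le> e\<^sup>2"
          using N[OF \<open>m \<ge> N\<close> \<open>n \<ge> N\<close>] by (intro power_mono) auto
        finally show ?thesis .
      qed
      then show "\<exists>N. \<forall>n\<ge>N. (\<Sum>x\<in>F. (cmod (coord (X m) x - coord (X n) x))\<^sup>2) \<le> e\<^sup>2" by blast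
    qed
    then show ?thesis by blast
  qed
  obtain N1 where "\<forall>F. finite F \<longrightarrow> (\<Sum>x\<in>F. (cmod (coord (X N1) x - g x))\<^sup>2) \<le> 1\<^sup>2"
    using ev[of 1] by auto
  then have "(\<lambda>x. (cmod (coord (X N1) x - g x))\<^sup>2) summable_on UNIV"
    by (intro sq_bounded_ell2(1)) auto
  then have "(\<lambda>x. (cmod (coord (X N1) x + (-1) * (coord (X N1) x - g x)))\<^sup>2) summable_on UNIV"
    by (intro sq_summable_add sq_summable_cmult coord_summable)
  then have G: "coord (Abs_ell2 g) = g"
    by (intro Abs_ell2_inverse) simp
  have "X \<longlonglongrightarrow> Abs_ell2 g"
  proof (rule LIMSEQ_I)
    fix r :: real assume "0 < r"
    then obtain N where N: "\<And>m F. m \<ge> N \<Longrightarrow> finite F \<Longrightarrow>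
        (\<Sum>x\<in>F. (cmod (coord (X m) x - g x))\<^sup>2) \<le> (r / 2)\<^sup>2"
      using ev[of "r / 2"] by auto
    have "norm (X m - Abs_ell2 g) < r" if "m \<ge> N" for m
    proof -
      have "(norm (X m - Abs_ell2 g))\<^sup>2 \<le> (r / 2)\<^sup>2"
        using sq_bounded_ell2(2)[OF N[OF that]] by (simp add: norm_ell2_power2 G)
      then have "norm (X m - Abs_ell2 g) \<le> r / 2"
        using \<open>0 < r\<close> by (simp add: power2_le_iff_abs_le)
      then show ?thesis using \<open>0 < r\<close> by simp
    qed
    then show "\<exists>N. \<forall>m\<ge>N. norm (X m - Abs_ell2 g) < r" by blast
  qed
  then show "convergent X" by (rule convergentI)
qed

lift_definition delta :: "'a \<Rightarrow> 'a ell2" is "\<lambda>a x. if x = a then 1 else 0"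
proof -
  fix a :: 'a
  have "(\<lambda>x. (cmod (if x = a then 1 else 0))\<^sup>2) summable_on {a}" by simp
  then show "(\<lambda>x. (cmod (if x = a then 1 else 0))\<^sup>2) summable_on UNIV"
    by (rule summable_on_cong_neutral[THEN iffD1, rotated -1]) auto
qed

section \<open>Schroedinger operators\<close>

text \<open>
  \<open>Whole_line\<close> stands for the integers and \<open>Half_line\<close> for the positive integers. The space
  of square-summable sequences on the sites is the closed subspace of \<open>int ell2\<close> of the
  sequences that vanish off the sites; on the half-line, these have the value 0 at 0, which is the
  Dirichlet boundary condition.
\<close>

datatype line = Whole_line | Half_line

fun sites :: "line \<Rightarrow> int set" where
  "sites Whole_line = UNIV"
| "sites Half_line = {1..}"

definition ell2_on :: "int set \<Rightarrow> int ell2 set" where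
  "ell2_on X = {\<psi>. \<forall>n. n \<notin> X \<longrightarrow> coord \<psi> n = 0}"

text \<open>
  Only meaningful for \<open>V\<close> bounded on the sites, where \<open>coord_schroedinger\<close> below applies. The
  values of \<open>V\<close> off the sites are irrelevant.
\<close>

definition schroedinger :: "line \<Rightarrow> (int \<Rightarrow> real) \<Rightarrow> int ell2 \<Rightarrow> int ell2" where
  "schroedinger L V \<psi> = Abs_ell2 (\<lambda>n. if n \<in> sites L
     then coord \<psi> (n + 1) + coord \<psi> (n - 1) + complex_of_real (V n) * coord \<psi> n else 0)"

lemma shift_sq_summable: "(\<lambda>n. (cmod (coord \<psi> (n + k)))\<^sup>2) summable_on (UNIV :: int set)"
proof -
  have "bij_betw (\<lambda>n::int. n + k) UNIV UNIV"
    by (rule bij_betwI[where g = "\<lambda>n. n - k"]) auto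
  then show ?thesis
    using summable_on_reindex_bij_betw[of "\<lambda>n::int. n + k" UNIV UNIV "\<lambda>n. (cmod (coord \<psi> n))\<^sup>2"]
    by (simp add: coord_summable)
qed

lemma shift_sq_infsum: "(\<Sum>\<^sub>\<infinity>n::int. (cmod (coord \<psi> (n + k)))\<^sup>2) = (norm \<psi>)\<^sup>2"
proof -
  have "bij_betw (\<lambda>n::int. n + k) UNIV UNIV"
    by (rule bij_betwI[where g = "\<lambda>n. n - k"]) auto
  then show ?thesis
    using infsum_reindex_bij_betw[of "\<lambda>n::int. n + k" UNIV UNIV "\<lambda>n. (cmod (coord \<psi> n))\<^sup>2"]
    by (simp add: norm_ell2_power2)
qed

lemma schroedinger_pointwise_bound:
  assumes "\<And>n. n \<in> sites L \<Longrightarrow> \<bar>V n\<bar> \<le> B" "0 \<le> B"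
  shows "(cmod (if n \<in> sites L
     then coord \<psi> (n + 1) + coord \<psi> (n - 1) + complex_of_real (V n) * coord \<psi> n else 0))\<^sup>2
   \<le> 3 * ((cmod (coord \<psi> (n + 1)))\<^sup>2 + (cmod (coord \<psi> (n + -1)))\<^sup>2 + B\<^sup>2 * (cmod (coord \<psi> (n + 0)))\<^sup>2)"
proof (cases "n \<in> sites L")
  case True
  define a b c where "a = cmod (coord \<psi> (n + 1))" and "b = cmod (coord \<psi> (n - 1))"
    and "c = cmod (coord \<psi> n)"
  have "cmod (coord \<psi> (n + 1) + coord \<psi> (n - 1) + complex_of_real (V n) * coord \<psi> n)
      \<le> a + b + \<bar>V n\<bar> * c"
    unfolding a_def b_def c_def
    by (intro order_trans[OF norm_triangle_ineq] add_mono order_refl) (auto simp: norm_mult)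
  also have "\<dots> \<le> a + b + B * c"
    using assms(1)[OF True] by (simp add: c_def mult_right_mono)
  finally have "(cmod (coord \<psi> (n + 1) + coord \<psi> (n - 1) + complex_of_real (V n) * coord \<psi> n))\<^sup>2
      \<le> (a + b + B * c)\<^sup>2"
    by (intro power_mono) auto
  also have "\<dots> \<le> 3 * (a\<^sup>2 + b\<^sup>2 + (B * c)\<^sup>2)"
    using zero_le_power2[of "a - b"] zero_le_power2[of "a - B * c"] zero_le_power2[of "b - B * c"]
    unfolding power2_eq_square by (simp add: algebra_simps)
  finally show ?thesis
    using True by (simp add: a_def b_def c_def power_mult_distrib)
qed simp

lemma schroedinger_bound_summable:
  "(\<lambda>n::int. 3 * ((cmod (coord \<psi> (n + 1)))\<^sup>2 + (cmod (coord \<psi> (n + -1)))\<^sup>2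
     + B\<^sup>2 * (cmod (coord \<psi> (n + 0)))\<^sup>2)) summable_on UNIV"
  by (intro summable_on_cmult_right summable_on_add shift_sq_summable)

lemma bounded_potential:
  assumes "bounded (V ` sites L)"
  obtains B where "0 \<le> B" "\<And>n. n \<in> sites L \<Longrightarrow> \<bar>V n\<bar> \<le> (B::real)"
  using assms unfolding bounded_pos by (metis imageI less_le real_norm_def)

lemma coord_schroedinger:
  assumes "bounded (V ` sites L)"
  shows "coord (schroedinger L V \<psi>) n = (if n \<in> sites L
     then coord \<psi> (n + 1) + coord \<psi> (n - 1) + complex_of_real (V n) * coord \<psi> n else 0)"
proof -
  obtain B where B: "0 \<le> B" "\<And>n. n \<in> sites L \<Longrightarrow> \<bar>V n\<bar> \<le> B"
    using bounded_potential[OF assms] by blast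
  have "(\<lambda>n. (cmod (if n \<in> sites L
     then coord \<psi> (n + 1) + coord \<psi> (n - 1) + complex_of_real (V n) * coord \<psi> n else 0))\<^sup>2)
     summable_on UNIV"
    by (rule summable_on_comparison_test[OF schroedinger_bound_summable[of \<psi> B]
          schroedinger_pointwise_bound[OF B(2) B(1)]]) auto
  then show ?thesis
    unfolding schroedinger_def by (subst Abs_ell2_inverse) auto
qed

lemma schroedinger_in_ell2_on:
  "bounded (V ` sites L) \<Longrightarrow> schroedinger L V \<psi> \<in> ell2_on (sites L)"
  by (simp add: ell2_on_def coord_schroedinger)

lemma bounded_linear_schroedinger:
  assumes "bounded (V ` sites L)"
  shows "bounded_linear (schroedinger L V)"
proof -
  obtain B where B: "0 \<le> B" "\<And>n. n \<in> sites L \<Longrightarrow> \<bar>V n\<bar> \<le> B"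
    using bounded_potential[OF assms] by blast
  have bound: "norm (schroedinger L V \<psi>) \<le> norm \<psi> * sqrt (3 * (2 + B\<^sup>2))" for \<psi>
  proof -
    have "(norm (schroedinger L V \<psi>))\<^sup>2 \<le> (\<Sum>\<^sub>\<infinity>n. 3 * ((cmod (coord \<psi> (n + 1)))\<^sup>2
        + (cmod (coord \<psi> (n + -1)))\<^sup>2 + B\<^sup>2 * (cmod (coord \<psi> (n + 0)))\<^sup>2))"
      unfolding norm_ell2_power2
      by (intro infsum_mono coord_summable schroedinger_bound_summable)
        (simp only: coord_schroedinger[OF assms], rule schroedinger_pointwise_bound[OF B(2) B(1)])
    also have "\<dots> = 3 * ((norm \<psi>)\<^sup>2 + (norm \<psi>)\<^sup>2 + B\<^sup>2 * (norm \<psi>)\<^sup>2)"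
      by (simp only: infsum_cmult_right' infsum_add summable_on_add summable_on_cmult_right
          shift_sq_summable shift_sq_infsum)
    also have "\<dots> = (norm \<psi> * sqrt (3 * (2 + B\<^sup>2)))\<^sup>2"
      by (simp add: power_mult_distrib algebra_simps)
    finally show ?thesis
      by (rule power2_le_imp_le) simp
  qed
  show ?thesis
    by (rule bounded_linear_intro[OF _ _ bound])
      (auto intro!: ell2_eqI simp: coord_schroedinger[OF assms] algebra_simps scaleR_conv_of_real)
qed

text \<open>
  The spectrum of an operator on the closed subspace \<open>S\<close>: the complement of the points at
  which the resolvent exists as a bounded operator on \<open>S\<close>.
\<close>

definition spectrum_on :: "'a ell2 set \<Rightarrow> ('a ell2 \<Rightarrow> 'a ell2) \<Rightarrow> complex set" where
  "spectrum_on S H = {z. \<not> (\<exists>R C.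
     (\<forall>\<phi>\<in>S. R \<phi> \<in> S \<and> H (R \<phi>) - z *\<^sub>C R \<phi> = \<phi> \<and> norm (R \<phi>) \<le> C * norm \<phi>) \<and>
     (\<forall>\<psi>\<in>S. R (H \<psi> - z *\<^sub>C \<psi>) = \<psi>))}"

section \<open>Transfer matrices\<close>

definition transfer_step :: "(int \<Rightarrow> real) \<Rightarrow> int \<Rightarrow> complex \<Rightarrow> complex^2^2" where
  "transfer_step V m z = vector [vector [z - complex_of_real (V m), -1], vector [1, 0]]"

primrec transfer_fwd :: "(int \<Rightarrow> real) \<Rightarrow> nat \<Rightarrow> complex \<Rightarrow> complex^2^2" where
  "transfer_fwd V 0 z = mat 1"
| "transfer_fwd V (Suc k) z = transfer_step V (int (Suc k)) z ** transfer_fwd V k z"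

text \<open>\<open>transfer_bwd V k\<close> is the transfer matrix to the site \<open>-k\<close>.\<close>

primrec transfer_bwd :: "(int \<Rightarrow> real) \<Rightarrow> nat \<Rightarrow> complex \<Rightarrow> complex^2^2" where
  "transfer_bwd V 0 z = mat 1"
| "transfer_bwd V (Suc k) z = matrix_inv (transfer_step V (- int k) z) ** transfer_bwd V k z"

definition transfer :: "(int \<Rightarrow> real) \<Rightarrow> int \<Rightarrow> complex \<Rightarrow> complex^2^2" where
  "transfer V n z = (if 0 \<le> n then transfer_fwd V (nat n) z else transfer_bwd V (nat (- n)) z)"

definition opnorm :: "complex^2^2 \<Rightarrow> real" where
  "opnorm M = onorm (\<lambda>v. M *v v)"

section \<open>Quantum dynamics and transport exponents\<close>

text \<open>
  \<open>exp (- i t H) \<psi>\<close> for the bounded operator \<open>H\<close>, by the exponential series, which converges in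
  norm by \<open>evolution_summable\<close>.
\<close>

definition evolution :: "line \<Rightarrow> (int \<Rightarrow> real) \<Rightarrow> real \<Rightarrow> int ell2 \<Rightarrow> int ell2" where
  "evolution L V t \<psi> =
     (\<Sum>k. ((- \<i> * complex_of_real t) ^ k / fact k) *\<^sub>C (schroedinger L V ^^ k) \<psi>)"

lemma evolution_summable:
  assumes "bounded (V ` sites L)"
  shows "summable (\<lambda>k. ((- \<i> * complex_of_real t) ^ k / fact k) *\<^sub>C (schroedinger L V ^^ k) \<psi>)"
proof -
  obtain M where M: "0 \<le> M" "\<And>\<psi>. norm (schroedinger L V \<psi>) \<le> norm \<psi> * M"
    using bounded_linear.nonneg_bounded[OF bounded_linear_schroedinger[OF assms]] by blast
  have pow: "norm ((schroedinger L V ^^ k) \<psi>) \<le> M ^ k * norm \<psi>" for k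
  proof (induction k)
    case (Suc k)
    have "norm ((schroedinger L V ^^ Suc k) \<psi>) \<le> norm ((schroedinger L V ^^ k) \<psi>) * M"
      using M(2) by simp
    also have "\<dots> \<le> (M ^ k * norm \<psi>) * M"
      using Suc M(1) by (rule mult_right_mono)
    finally show ?case by (simp add: mult_ac)
  qed simp
  show ?thesis
  proof (rule summable_comparison_test')
    show "summable (\<lambda>k. ((\<bar>t\<bar> * M) ^ k /\<^sub>R fact k) * norm \<psi>)"
      by (intro summable_mult2 summable_exp_generic)
    fix k
    have "norm (((- \<i> * complex_of_real t) ^ k / fact k) *\<^sub>C (schroedinger L V ^^ k) \<psi>)
        = \<bar>t\<bar> ^ k / fact k * norm ((schroedinger L V ^^ k) \<psi>)"
      by (simp add: norm_divide norm_power norm_mult)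
    also have "\<dots> \<le> \<bar>t\<bar> ^ k / fact k * (M ^ k * norm \<psi>)"
      by (intro mult_left_mono pow) auto
    finally show "norm (((- \<i> * complex_of_real t) ^ k / fact k) *\<^sub>C (schroedinger L V ^^ k) \<psi>)
        \<le> ((\<bar>t\<bar> * M) ^ k /\<^sub>R fact k) * norm \<psi>"
      by (simp add: power_mult_distrib field_simps)
  qed
qed

definition avg_prob :: "line \<Rightarrow> (int \<Rightarrow> real) \<Rightarrow> int \<Rightarrow> real \<Rightarrow> real" where
  "avg_prob L V n T = 2 / T *
     (LINT t:{0..}|lborel. exp (- 2 * t / T) * (cmod (cinner (evolution L V t (delta 1)) (delta n)))\<^sup>2)"

definition outside_prob :: "line \<Rightarrow> (int \<Rightarrow> real) \<Rightarrow> ereal \<Rightarrow> real \<Rightarrow> real" where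
  "outside_prob L V N T = (\<Sum>\<^sub>\<infinity>n\<in>{n \<in> sites L. N < ereal \<bar>real_of_int n\<bar>}. avg_prob L V n T)"

text \<open>The radius \<open>T\<^sup>\<alpha> - 2\<close>, infinite for \<open>\<alpha> = \<infinity>\<close>; only used for \<open>0 \<le> \<alpha>\<close> and \<open>T > 1\<close>.\<close>

definition cutoff :: "ereal \<Rightarrow> real \<Rightarrow> ereal" where
  "cutoff \<alpha> T = (if \<alpha> = \<infinity> then \<infinity> else ereal (T powr real_of_ereal \<alpha> - 2))"

text \<open>The logarithm with \<open>log 0 = -\<infinity>\<close>, whereas \<open>ln 0 = 0\<close>.\<close>

definition elog :: "real \<Rightarrow> ereal" where
  "elog p = (if p = 0 then -\<infinity> else ereal (ln p))"

definition S_minus :: "line \<Rightarrow> (int \<Rightarrow> real) \<Rightarrow> ereal \<Rightarrow> ereal" where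
  "S_minus L V \<alpha> = - Liminf at_top (\<lambda>T. elog (outside_prob L V (cutoff \<alpha> T) T) / ereal (ln T))"

definition S_plus :: "line \<Rightarrow> (int \<Rightarrow> real) \<Rightarrow> ereal \<Rightarrow> ereal" where
  "S_plus L V \<alpha> = - Limsup at_top (\<lambda>T. elog (outside_prob L V (cutoff \<alpha> T) T) / ereal (ln T))"

definition alpha_u_minus :: "line \<Rightarrow> (int \<Rightarrow> real) \<Rightarrow> ereal" where
  "alpha_u_minus L V = Sup {\<alpha>. 0 \<le> \<alpha> \<and> S_minus L V \<alpha> < \<infinity>}"

definition alpha_u_plus :: "line \<Rightarrow> (int \<Rightarrow> real) \<Rightarrow> ereal" where
  "alpha_u_plus L V = Sup {\<alpha>. 0 \<le> \<alpha> \<and> S_plus L V \<alpha> < \<infinity>}"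

end

theory Submission
  imports Defs "HOL-Probability.Probability" "HOL-Real_Asymp.Real_Asymp"
begin

text \<open>
  With \<open>\<epsilon> = 1 / T\<close>, Plancherel turns the averaged probabilities into
  \<open>a(n, T) = (\<epsilon> / \<pi>) \<integral> |\<psi>\<^sub>n(E + i\<epsilon>)|\<^sup>2 dE\<close>, where \<open>\<psi>(z) = (H - z)\<^sup>-\<^sup>1 \<delta>\<^sub>1\<close>. Up to powers of
  \<open>\<epsilon>\<close>, both \<open>|\<psi>\<^sub>n|\<^sup>2 + |\<psi>\<^sub>n\<^sub>+\<^sub>1|\<^sup>2\<close> and the whole tail of \<open>|\<psi>|\<^sup>2\<close> beyond \<open>n\<close> are comparable with
  \<open>\<parallel>\<Phi>(n, z)\<parallel>\<^sup>-\<^sup>2\<close>. The lower bound holds because \<open>\<Phi>\<close> has determinant 1 and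
  \<open>|\<psi>\<^sub>1| \<ge> Im \<psi>\<^sub>1 = \<epsilon> \<parallel>\<psi>\<parallel>\<^sup>2\<close>. For the upper bound, \<open>\<psi>\<close> to the right and to the left of 1 extends to two
  solutions with Wronskian \<open>\<psi>\<^sub>1\<close>. The Green function is a product of the two and has norm at most
  \<open>1 / \<epsilon>\<close>, so that both are small against the tail of \<open>\<psi>\<close>, and together they determine \<open>\<Phi>\<close>.
  Comparable transfer matrices thus give \<open>P\<^sub>1(N, T) \<le> C T\<^sup>B P\<^sub>2(N, T) + C e\<^sup>-\<^sup>N\<^sup>/\<^sup>4\<close> for \<open>N + 2 \<le> T\<close>, the
  exponential term being a Combes--Thomas bound for the energies outside \<open>[-K, K]\<close>. The same bound
  shows that \<open>P(T\<^sup>\<alpha> - 2, T)\<close> decays faster than any power when \<open>\<alpha> > 1\<close>.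
\<close>

text \<open>The exponents only ask whether P(T^\<alpha> - 2, T) is bounded below by some power of T.
  Any loss of a fixed power of T is therefore harmless, and crude constants and crude powers of
  \<epsilon> suffice everywhere. The hypothesis on the transfer matrices reaches only |n| <=
  1/\<epsilon> = T, which limits the comparison to \<alpha> <= 1. The exponential error is
  negligible against powers of T only for \<alpha> > 0; at \<alpha> = 0 the radius is -1, every site
  counts, and a direct lower bound takes over. The spectrum is a set of points without bounded
  resolvent. It is converted into operator inequalities through the numerical range, and the margin
  1 between K - 1 and K keeps the decay rate for |E| > K independent of T. The function fed to
  Plancherel jumps at time 0, so the theorem is proved in a version that tolerates a discontinuity
  there and takes the square integrability of the transform as a hypothesis, which the resolvent
  bounds supply.\<close>

section \<open>Multiplication and shift operators\<close>

text \<open>The junk value 0 for unbounded \<open>c\<close> makes the operator total.\<close>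

lift_definition mult_op :: "('a \<Rightarrow> complex) \<Rightarrow> 'a ell2 \<Rightarrow> 'a ell2"
  is "\<lambda>c f. if bounded (range c) then (\<lambda>x. c x * f x) else (\<lambda>_. 0)"
proof -
  fix c f :: "'a \<Rightarrow> complex"
  assume f: "(\<lambda>x. (cmod (f x))\<^sup>2) summable_on UNIV"
  show "(\<lambda>x. (cmod ((if bounded (range c) then (\<lambda>x. c x * f x) else (\<lambda>_. 0)) x))\<^sup>2) summable_on UNIV"
  proof (cases "bounded (range c)")
    case True
    then obtain B where B: "\<And>x. cmod (c x) \<le> B"
      unfolding bounded_iff by auto
    show ?thesis
    proof (rule summable_on_comparison_test)
      show "(\<lambda>x. B\<^sup>2 * (cmod (f x))\<^sup>2) summable_on UNIV"
        by (intro summable_on_cmult_right f)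
      fix x
      show "(cmod ((if bounded (range c) then (\<lambda>x. c x * f x) else (\<lambda>_. 0)) x))\<^sup>2 \<le> B\<^sup>2 * (cmod (f x))\<^sup>2"
        using True B[of x] by (auto simp: norm_mult power_mult_distrib intro!: mult_right_mono power_mono)
    qed auto
  qed simp
qed

lemma coord_mult_op: "bounded (range c) \<Longrightarrow> coord (mult_op c f) x = c x * coord f x"
  by transfer simp

lemma norm_le_coordwise:
  assumes "\<And>x. cmod (coord f x) \<le> B * cmod (coord g x)" "0 \<le> B"
  shows "norm f \<le> B * norm g"
proof -
  have "(norm f)\<^sup>2 \<le> (\<Sum>\<^sub>\<infinity>x. B\<^sup>2 * (cmod (coord g x))\<^sup>2)"
    unfolding norm_ell2_power2
    by (intro infsum_mono coord_summable summable_on_cmult_right)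
       (metis assms(1) norm_ge_zero power_mono power_mult_distrib)
  also have "\<dots> = (B * norm g)\<^sup>2"
    by (simp add: infsum_cmult_right' norm_ell2_power2 power_mult_distrib)
  finally show ?thesis
    by (rule power2_le_imp_le) (simp add: assms(2))
qed

lemma norm_mult_op_le:
  assumes "\<And>x. cmod (c x) \<le> B" "0 \<le> B"
  shows "norm (mult_op c f) \<le> B * norm f"
proof -
  have b: "bounded (range c)" using assms(1) by (auto simp: bounded_iff)
  show ?thesis
    by (rule norm_le_coordwise) (auto simp: coord_mult_op[OF b] norm_mult assms intro!: mult_right_mono)
qed

lift_definition shift_op :: "int \<Rightarrow> int ell2 \<Rightarrow> int ell2" is "\<lambda>k f n. f (n + k)"
proof -
  fix k and f :: "int \<Rightarrow> complex"
  assume f: "(\<lambda>x. (cmod (f x))\<^sup>2) summable_on UNIV"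
  show "(\<lambda>n. (cmod (f (n + k)))\<^sup>2) summable_on UNIV"
    using shift_sq_summable[of "Abs_ell2 f" k] f by (simp add: Abs_ell2_inverse)
qed

lemma coord_shift_op [simp]: "coord (shift_op k f) n = coord f (n + k)"
  by transfer simp

lemma norm_shift_op [simp]: "norm (shift_op k f) = norm f"
  by (simp add: norm_ell2_eq[of "shift_op k f"] shift_sq_infsum)

lemma inner_ell2_cmult: "inner (mult_op c f) g = inner f (mult_op (\<lambda>x. cnj (c x)) g)"
  if "bounded (range c)"
proof -
  have b: "bounded (range (\<lambda>x. cnj (c x)))" using that by (auto simp: bounded_iff)
  show ?thesis
    by (simp add: inner_ell2_def coord_mult_op that b inner_complex_def algebra_simps)
qed

lemma inner_shift_op: "inner (shift_op k f) g = inner f (shift_op (- k) g)"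
proof -
  have bij: "bij_betw (\<lambda>n::int. n + k) UNIV UNIV"
    by (rule bij_betwI[where g = "\<lambda>n. n - k"]) auto
  show ?thesis
    using infsum_reindex_bij_betw[OF bij, of "\<lambda>n. inner (coord f n) (coord g (n - k))"]
    by (simp add: inner_ell2_def)
qed

section \<open>The canonical basis and the complex inner product\<close>

lemma coord_delta: "coord (delta a) x = (if x = a then 1 else 0)"
  by transfer simp

lemma infsum_single: "(\<Sum>\<^sub>\<infinity>x. if x = a then h x else (0::'b::{comm_monoid_add,t2_space})) = h a"
proof -
  have "(\<Sum>\<^sub>\<infinity>x. if x = a then h x else 0) = (\<Sum>\<^sub>\<infinity>x\<in>{a}. h x)"
    by (rule infsum_cong_neutral) auto
  then show ?thesis by simp
qed

lemma norm_delta [simp]: "norm (delta a) = 1"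
proof -
  have "(\<lambda>x. (cmod (coord (delta a) x))\<^sup>2) = (\<lambda>x. if x = a then 1 else 0)"
    by (auto simp: coord_delta)
  then show ?thesis unfolding norm_ell2_eq by (simp only: infsum_single) simp
qed

lemma cinner_delta: "cinner f (delta a) = coord f a"
proof -
  have "(\<lambda>x. coord f x * cnj (coord (delta a) x)) = (\<lambda>x. if x = a then coord f x else 0)"
    by (auto simp: coord_delta)
  then show ?thesis unfolding cinner_def by (simp only: infsum_single)
qed

lemma cinner_summable: "(\<lambda>x. coord f x * cnj (coord g x)) summable_on UNIV"
  using abs_summable_summable[OF coord_mult_summable] .

text \<open>Since Im w = Re (- i w), the imaginary part of the complex pairing is the real pairing
  with \<open>\<i> *\<^sub>C g\<close>. Facts about the real inner product of the type class thus
  carry over.\<close>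

lemma cinner_eq: "cinner f g = Complex (inner f g) (inner f (\<i> *\<^sub>C g))"
proof (rule complex_eqI)
  show "Re (cinner f g) = Re (Complex (inner f g) (inner f (\<i> *\<^sub>C g)))"
    unfolding cinner_def inner_ell2_def
    by (simp add: infsum_Re[OF cinner_summable, symmetric] inner_complex_def)
  show "Im (cinner f g) = Im (Complex (inner f g) (inner f (\<i> *\<^sub>C g)))"
    unfolding cinner_def inner_ell2_def
    by (simp add: infsum_Im[OF cinner_summable, symmetric] inner_complex_def algebra_simps)
qed

lemma cinner_cscale_left: "cinner (c *\<^sub>C f) g = c * cinner f g"
  by (simp add: cinner_def infsum_cmult_right' mult.assoc)

lemma cinner_cscale_right: "cinner f (c *\<^sub>C g) = cnj c * cinner f g"
proof -
  have "(\<lambda>x. coord f x * cnj (coord (c *\<^sub>C g) x)) = (\<lambda>x. cnj c * (coord f x * cnj (coord g x)))"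
    by (auto simp: algebra_simps)
  then show ?thesis by (simp add: cinner_def infsum_cmult_right')
qed

lemma cinner_diff_left: "cinner (f - h) g = cinner f g - cinner h g"
  by (simp add: cinner_eq inner_diff_left complex_eq_iff)

lemma cinner_diff_right: "cinner f (g - h) = cinner f g - cinner f h"
proof -
  have "\<i> *\<^sub>C (g - h) = \<i> *\<^sub>C g - \<i> *\<^sub>C h" by (rule ell2_eqI) (simp add: algebra_simps)
  then show ?thesis by (simp add: cinner_eq inner_diff_right complex_eq_iff)
qed

text \<open>The factor 2 comes from estimating real and imaginary part separately; only boundedness
  of the pairing is used later.\<close>

lemma norm_cinner_le: "cmod (cinner f g) \<le> 2 * (norm f * norm g)"
proof -
  have "cmod (cinner f g) \<le> \<bar>inner f g\<bar> + \<bar>inner f (\<i> *\<^sub>C g)\<bar>"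
    using cmod_le[of "cinner f g"] by (simp add: cinner_eq)
  also have "\<dots> \<le> norm f * norm g + norm f * norm (\<i> *\<^sub>C g)"
    by (intro add_mono Cauchy_Schwarz_ineq2)
  finally show ?thesis by simp
qed

lemma bounded_linear_cinner_left: "bounded_linear (\<lambda>f. cinner f g)"
  by (rule bounded_linear_intro[where K = "2 * norm g"])
    (use norm_cinner_le in \<open>auto simp: cinner_eq inner_add_left complex_eq_iff mult_ac\<close>)

lemma bounded_linear_cscale: "bounded_linear ((*\<^sub>C) c)"
  by (rule bounded_linear_intro[where K = "cmod c"])
    (auto intro!: ell2_eqI simp: algebra_simps scaleR_conv_of_real)

lemma inner_cscale_self: "inner (c *\<^sub>C f) f = Re c * (norm f)\<^sup>2"
proof -
  have "inner (c *\<^sub>C f) f = Re (c * cinner f f)"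
    using arg_cong[OF cinner_cscale_left, of Re c f f] by (simp add: cinner_eq)
  moreover have "Im (cinner f f) = 0"
    unfolding cinner_def by (simp add: infsum_Im[OF cinner_summable, symmetric])
  ultimately show ?thesis by (simp add: cinner_eq power2_norm_eq_inner)
qed

lemma inner_cscale_left_right: "inner (\<i> *\<^sub>C f) (\<i> *\<^sub>C g) = inner f g"
  by (simp add: inner_ell2_def inner_complex_def add.commute)

section \<open>Resolvent and numerical range\<close>

locale schroedinger_op =
  fixes L :: line and V :: "int \<Rightarrow> real" and K :: real
  assumes bounded_V: "bounded (V ` sites L)"
    and K_ge: "K \<ge> 4"
    and spectrum_subset: "spectrum_on (ell2_on (sites L)) (schroedinger L V)
      \<subseteq> complex_of_real ` {-K + 1..K - 1}"
begin

abbreviation S :: "int ell2 set" where "S \<equiv> ell2_on (sites L)"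

abbreviation H :: "int ell2 \<Rightarrow> int ell2" where "H \<equiv> schroedinger L V"

text \<open>The resolvent; an arbitrary value at the points of the spectrum.\<close>

definition resolve :: "complex \<Rightarrow> int ell2 \<Rightarrow> int ell2"
  where "resolve z \<phi> = (SOME \<psi>. \<psi> \<in> S \<and> H \<psi> - z *\<^sub>C \<psi> = \<phi>)"

lemma coord_H: "coord (H \<psi>) n = (if n \<in> sites L
     then coord \<psi> (n + 1) + coord \<psi> (n - 1) + complex_of_real (V n) * coord \<psi> n else 0)"
  by (rule coord_schroedinger[OF bounded_V])

sublocale H: bounded_linear H
  by (rule bounded_linear_schroedinger[OF bounded_V])

lemma H_cscale: "H (c *\<^sub>C f) = c *\<^sub>C H f"
  by (rule ell2_eqI) (simp add: coord_H algebra_simps)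

lemma S_diff: "f \<in> S \<Longrightarrow> g \<in> S \<Longrightarrow> f - g \<in> S"
  and S_cscale: "f \<in> S \<Longrightarrow> c *\<^sub>C f \<in> S"
  and S_scaleR: "f \<in> S \<Longrightarrow> r *\<^sub>R f \<in> S"
  and S_H: "H f \<in> S"
  by (auto simp: ell2_on_def coord_H)

lemma S_coord: "f \<in> S \<Longrightarrow> n \<notin> sites L \<Longrightarrow> coord f n = 0"
  by (simp add: ell2_on_def)

text \<open>\<open>V\<close> may be unbounded off the sites. Cutting it off there gives a multiplier
  that is bounded on all integers, as \<open>mult_op\<close> requires.\<close>

definition site_V :: "int \<Rightarrow> complex" where "site_V n = (if n \<in> sites L then of_real (V n) else 0)"

lemma bounded_site_V: "bounded (range site_V)"
proof -
  obtain B where "0 \<le> B" "\<And>n. n \<in> sites L \<Longrightarrow> \<bar>V n\<bar> \<le> B"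
    using bounded_potential[OF bounded_V] by blast
  then show ?thesis by (auto simp: bounded_iff site_V_def intro!: exI[of _ B])
qed

definition on_sites :: "int \<Rightarrow> complex" where "on_sites n = (if n \<in> sites L then 1 else 0)"

lemma bounded_on_sites: "bounded (range on_sites)"
  by (auto simp: bounded_iff on_sites_def intro!: exI[of _ 1])

text \<open>Hopping followed by the projection onto the sites, plus multiplication by a real
  function. On \<open>S\<close> the projection can be inserted freely, which reduces the symmetry of
  \<open>H\<close> to the adjoints of shifts and multiplications.\<close>

lemma H_eq: "H f = mult_op on_sites (shift_op 1 f + shift_op (-1) f) + mult_op site_V f"
  by (rule ell2_eqI)
    (simp add: coord_H coord_mult_op bounded_on_sites bounded_site_V, simp add: on_sites_def site_V_def)

lemma mult_op_on_sites: "f \<in> S \<Longrightarrow> mult_op on_sites f = f"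
  by (rule ell2_eqI) (simp add: coord_mult_op bounded_on_sites, auto simp: on_sites_def S_coord)

lemma H_symmetric:
  assumes "f \<in> S" "g \<in> S"
  shows "inner (H f) g = inner f (H g)"
proof -
  have r: "(\<lambda>x. cnj (on_sites x)) = on_sites" "(\<lambda>x. cnj (site_V x)) = site_V"
    by (auto simp: on_sites_def site_V_def)
  have 1: "inner (H f) g = inner f (shift_op (-1) g + shift_op 1 g) + inner f (mult_op site_V g)"
    by (simp add: H_eq[of f] inner_add_left inner_add_right inner_ell2_cmult bounded_on_sites
      bounded_site_V r mult_op_on_sites[OF assms(2)] inner_shift_op)
  have "inner f (shift_op (-1) g + shift_op 1 g)
      = inner (mult_op on_sites f) (shift_op (-1) g + shift_op 1 g)"
    by (simp add: mult_op_on_sites assms)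
  also have "\<dots> = inner f (mult_op on_sites (shift_op 1 g + shift_op (-1) g))"
    by (subst inner_ell2_cmult[OF bounded_on_sites]) (simp add: r add.commute)
  finally show ?thesis unfolding 1 by (simp add: H_eq[of g] inner_add_right)
qed

lemma H_cinner_symmetric:
  assumes "f \<in> S" "g \<in> S"
  shows "cinner (H f) g = cinner f (H g)"
  using assms by (simp add: cinner_eq H_symmetric S_cscale H_cscale)

section \<open>Lower bounds for H - z and existence of the resolvent\<close>

lemma inner_shifted_self:
  assumes "f \<in> S"
  shows "inner (H f - z *\<^sub>C f) f = inner (H f) f - Re z * (norm f)\<^sup>2"
  by (simp add: inner_diff_left inner_cscale_self)

lemma inner_H_i:
  assumes "f \<in> S"
  shows "inner (H f) (\<i> *\<^sub>C f) = 0"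
proof -
  have "inner (H f) (\<i> *\<^sub>C f) = inner f (\<i> *\<^sub>C H f)"
    using assms by (simp add: H_symmetric S_cscale H_cscale)
  also have "\<dots> = inner (\<i> *\<^sub>C f) (\<i> *\<^sub>C (\<i> *\<^sub>C H f))"
    by (simp add: inner_cscale_left_right)
  also have "\<i> *\<^sub>C (\<i> *\<^sub>C H f) = - H f"
    by (rule ell2_eqI) simp
  finally show ?thesis
    by (simp add: inner_commute)
qed

lemma inner_shifted_i:
  assumes "f \<in> S"
  shows "inner (H f - z *\<^sub>C f) (\<i> *\<^sub>C f) = - Im z * (norm f)\<^sup>2"
proof -
  have "z *\<^sub>C f = \<i> *\<^sub>C ((- \<i> * z) *\<^sub>C f)" by (rule ell2_eqI) (simp flip: mult.assoc)
  then have "inner (z *\<^sub>C f) (\<i> *\<^sub>C f) = inner ((- \<i> * z) *\<^sub>C f) f"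
    by (metis inner_cscale_left_right)
  also have "\<dots> = Im z * (norm f)\<^sup>2" by (simp add: inner_cscale_self)
  finally show ?thesis
    using inner_H_i[OF assms] by (simp add: inner_diff_left)
qed

text \<open>The form of a symmetric operator is real, so pairing with
  \<open>\<i> *\<^sub>C f\<close> isolates the contribution of Im z; Cauchy--Schwarz does the rest.
  This is the resolvent bound 1 / |Im z|.\<close>

lemma norm_shifted_ge_Im:
  assumes "f \<in> S"
  shows "\<bar>Im z\<bar> * norm f \<le> norm (H f - z *\<^sub>C f)"
proof -
  have "\<bar>Im z\<bar> * (norm f)\<^sup>2 = \<bar>inner (H f - z *\<^sub>C f) (\<i> *\<^sub>C f)\<bar>"
    by (simp add: abs_mult inner_shifted_i[OF assms])
  also have "\<dots> \<le> norm (H f - z *\<^sub>C f) * norm (\<i> *\<^sub>C f)"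
    by (rule Cauchy_Schwarz_ineq2)
  finally have "(\<bar>Im z\<bar> * norm f) * norm f \<le> norm (H f - z *\<^sub>C f) * norm f"
    by (simp add: power2_eq_square)
  then show ?thesis
    by (cases "norm f = 0") (auto simp: mult_le_cancel_right)
qed

lemma resolve:
  assumes "Im z \<noteq> 0" "\<phi> \<in> S"
  shows "resolve z \<phi> \<in> S" "H (resolve z \<phi>) - z *\<^sub>C resolve z \<phi> = \<phi>"
proof -
  have "z \<notin> spectrum_on S H" using spectrum_subset assms(1) by auto
  then have "\<exists>\<psi>. \<psi> \<in> S \<and> H \<psi> - z *\<^sub>C \<psi> = \<phi>"
    using assms(2) unfolding spectrum_on_def by blast
  then have "resolve z \<phi> \<in> S \<and> H (resolve z \<phi>) - z *\<^sub>C resolve z \<phi> = \<phi>"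
    unfolding resolve_def by (rule someI_ex)
  then show "resolve z \<phi> \<in> S" "H (resolve z \<phi>) - z *\<^sub>C resolve z \<phi> = \<phi>" by auto
qed

text \<open>Weyl's criterion in the easy direction: a resolvent bounded by \<open>C\<close> forbids
  approximate eigenvectors.\<close>

lemma spectrum_approx:
  assumes "\<And>e. e > 0 \<Longrightarrow> \<exists>f\<in>S. f \<noteq> 0 \<and> norm (H f - z *\<^sub>C f) \<le> e * norm f"
  shows "z \<in> spectrum_on S H"
proof (rule ccontr)
  assume "z \<notin> spectrum_on S H"
  then obtain R C where R: "\<And>\<phi>. \<phi> \<in> S \<Longrightarrow> norm (R \<phi>) \<le> C * norm \<phi>"
      "\<And>\<psi>. \<psi> \<in> S \<Longrightarrow> R (H \<psi> - z *\<^sub>C \<psi>) = \<psi>"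
    unfolding spectrum_on_def by blast
  \<comment> \<open>With this accuracy the resolvent would map to at most half the norm of
    \<open>f\<close>. The absolute value and the summand 1 make the denominator positive, since the
    sign of \<open>C\<close> is unknown.\<close>
  obtain f where f: "f \<in> S" "f \<noteq> 0" "norm (H f - z *\<^sub>C f) \<le> 1 / (2 * (\<bar>C\<bar> + 1)) * norm f"
    using assms[of "1 / (2 * (\<bar>C\<bar> + 1))"]
    by (metis abs_ge_zero add_nonneg_pos mult_pos_pos zero_less_divide_1_iff zero_less_numeral zero_less_one)
  have "norm f \<le> C * norm (H f - z *\<^sub>C f)"
    using R(1)[of "H f - z *\<^sub>C f"] R(2)[OF f(1)] f(1) by (simp add: S_diff S_H S_cscale)
  also have "\<dots> \<le> (\<bar>C\<bar> + 1) * norm (H f - z *\<^sub>C f)" by (intro mult_right_mono) auto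
  also have "\<dots> \<le> (\<bar>C\<bar> + 1) * (1 / (2 * (\<bar>C\<bar> + 1)) * norm f)"
    by (intro mult_left_mono f(3)) auto
  also have "\<dots> = norm f / 2" by (simp add: field_simps)
  finally show False using f(2) by simp
qed

text \<open>Cauchy--Schwarz for the positive semidefinite form of \<open>A\<close>, applied to \<open>f\<close> and \<open>A f\<close>.\<close>

lemma psd_norm_le:
  fixes A :: "int ell2 \<Rightarrow> int ell2"
  assumes lin: "bounded_linear A" and inv: "\<And>f. f \<in> S \<Longrightarrow> A f \<in> S"
    and sym: "\<And>f g. f \<in> S \<Longrightarrow> g \<in> S \<Longrightarrow> inner (A f) g = inner f (A g)"
    and psd: "\<And>f. f \<in> S \<Longrightarrow> 0 \<le> inner (A f) f"
    and M: "\<And>f. norm (A f) \<le> norm f * M" and f: "f \<in> S"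
  shows "(norm (A f))\<^sup>2 \<le> M * inner (A f) f"
proof -
  interpret A: bounded_linear A by fact
  define g where "g = A f"
  have g: "g \<in> S" using inv f by (simp add: g_def)
  define p q where "p = inner (A f) f" and "q = inner (A g) g"
  have pq: "0 \<le> p" "0 \<le> q" using psd f g by (auto simp: p_def q_def)
  have quad: "0 \<le> p - 2 * t * (norm g)\<^sup>2 + t\<^sup>2 * q" for t
  proof -
    have "0 \<le> inner (A (f - t *\<^sub>R g)) (f - t *\<^sub>R g)"
      by (intro psd S_diff S_scaleR f g)
    also have "\<dots> = p - t * inner (A f) g - t * inner (A g) f + t\<^sup>2 * q"
      by (simp add: A.diff A.scaleR inner_diff_left inner_diff_right p_def q_def power2_eq_square algebra_simps)
    also have "inner (A g) f = inner g g" using sym[OF g f] by (simp add: g_def)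
    also have "inner (A f) g = inner g g" by (simp add: g_def)
    finally show ?thesis by (simp add: power2_norm_eq_inner algebra_simps)
  qed
  have qle: "q \<le> M * (norm g)\<^sup>2"
  proof -
    have "q \<le> norm (A g) * norm g" unfolding q_def by (rule norm_cauchy_schwarz)
    also have "\<dots> \<le> (norm g * M) * norm g" by (intro mult_right_mono M) auto
    finally show ?thesis by (simp add: power2_eq_square algebra_simps)
  qed
  show ?thesis
  proof (cases "g = 0")
    case True then show ?thesis
      by (simp add: g_def)
  next
    case False
    then have n: "(norm g)\<^sup>2 > 0" by simp
    have M0: "0 < M"
    proof (rule ccontr)
      assume "\<not> 0 < M"
      then have "norm f * M \<le> 0" by (simp add: mult_nonneg_nonpos)
      then have "norm (A f) \<le> 0" using M[of f] by linarith
      then show False using False by (simp add: g_def)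
    qed
    \<comment> \<open>The choice t = 1/M is optimal for the bound q <= M |g|^2: the last two terms
      then add up to at most - |g|^2 / M.\<close>
    have "0 \<le> p - 2 * (1/M) * (norm g)\<^sup>2 + (1/M)\<^sup>2 * q" by (rule quad)
    also have "\<dots> \<le> p - 2 * (1/M) * (norm g)\<^sup>2 + (1/M)\<^sup>2 * (M * (norm g)\<^sup>2)"
      by (intro add_left_mono mult_left_mono qle) auto
    also have "\<dots> = p - (norm g)\<^sup>2 / M" using M0 by (simp add: power2_eq_square field_simps)
    finally show ?thesis using M0 by (simp add: g_def[symmetric] p_def field_simps)
  qed
qed

text \<open>
  With \<open>l\<close> the supremum of the form \<open>s H\<close>, the form of \<open>l - s H\<close> is positive semidefinite, and its
  approximate minimisers are approximate eigenvectors by \<open>psd_norm_le\<close>.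
\<close>

lemma numerical_range_sup_in_spectrum:
  assumes s: "s = 1 \<or> s = -1"
  obtains l where "complex_of_real (s * l) \<in> spectrum_on S H"
    "\<And>f. f \<in> S \<Longrightarrow> s * inner (H f) f \<le> l * (norm f)\<^sup>2"
proof -
  have s2: "s * s = 1" using s by auto
  obtain M where M: "0 \<le> M" "\<And>f. norm (H f) \<le> norm f * M"
    using H.nonneg_bounded by blast
  define Q where "Q = (\<lambda>f. s * inner (H f) f / (norm f)\<^sup>2) ` (S - {0})"
  define l where "l = Sup Q"
  have bdd: "bdd_above Q"
  proof (rule bdd_aboveI)
    fix y assume "y \<in> Q"
    then obtain f where f: "f \<in> S" "f \<noteq> 0" "y = s * inner (H f) f / (norm f)\<^sup>2" by (auto simp: Q_def)
    have "s * inner (H f) f \<le> \<bar>inner (H f) f\<bar>" using s by auto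
    also have "\<dots> \<le> norm (H f) * norm f" by (rule Cauchy_Schwarz_ineq2)
    also have "\<dots> \<le> (norm f * M) * norm f" by (intro mult_right_mono M) auto
    finally show "y \<le> M" unfolding f(3) using f(2)
      by (simp add: pos_divide_le_eq power2_eq_square mult_ac)
  qed
  have d1: "delta 1 \<in> S"
    by (cases L) (auto simp: ell2_on_def coord_delta)
  have d1n: "delta 1 \<noteq> (0 :: int ell2)" by (metis norm_delta norm_zero zero_neq_one)
  have ne: "Q \<noteq> {}" using d1 d1n by (auto simp: Q_def)
  have up: "s * inner (H f) f \<le> l * (norm f)\<^sup>2" if "f \<in> S" for f
  proof (cases "f = 0")
    case False
    then have "s * inner (H f) f / (norm f)\<^sup>2 \<le> l"
      unfolding l_def using bdd that by (intro cSup_upper) (auto simp: Q_def)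
    then show ?thesis using False by (simp add: field_simps)
  qed (simp add: H.zero)
  define A where "A f = l *\<^sub>R f - s *\<^sub>R H f" for f
  have blA: "bounded_linear A"
    unfolding A_def by (intro bounded_linear_sub bounded_linear_scaleR_right bounded_linear_const_scaleR H.bounded_linear)
  obtain M' where M': "\<And>f. norm (A f) \<le> norm f * M'" "0 \<le> M'"
    using bounded_linear.nonneg_bounded[OF blA] by blast
  have key: "(norm (A f))\<^sup>2 \<le> M' * inner (A f) f" if "f \<in> S" for f
  proof (rule psd_norm_le[OF blA _ _ _ M'(1) that])
    show "0 \<le> inner (A g) g" if "g \<in> S" for g
      using up[OF that] by (simp add: A_def inner_diff_left power2_norm_eq_inner)
  qed (auto simp: A_def S_diff S_scaleR S_H inner_diff_left inner_diff_right H_symmetric)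
  have "complex_of_real (s * l) \<in> spectrum_on S H"
  proof (rule spectrum_approx)
    fix e :: real assume e: "e > 0"
    \<comment> \<open>Chosen so that \<open>key\<close> turns the gap \<open>d\<close> in the
      quotient into the factor e^2; the summand 1 covers M' = 0.\<close>
    define d where "d = e\<^sup>2 / (M' + 1)"
    have d: "d > 0" using e M'(2) by (simp add: d_def)
    obtain y where y: "y \<in> Q" "l - d < y"
      using less_cSupD[OF ne, of "l - d"] d by (auto simp: l_def)
    then obtain f where f: "f \<in> S" "f \<noteq> 0" "l - d < s * inner (H f) f / (norm f)\<^sup>2" by (auto simp: Q_def)
    have "inner (A f) f = l * (norm f)\<^sup>2 - s * inner (H f) f"
      by (simp add: A_def inner_diff_left power2_norm_eq_inner)
    also have "\<dots> \<le> d * (norm f)\<^sup>2" using f(2,3) by (simp add: field_simps)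
    finally have "(norm (A f))\<^sup>2 \<le> M' * (d * (norm f)\<^sup>2)"
      using key[OF f(1)] M'(2) by (meson mult_left_mono order_trans)
    also have "\<dots> \<le> (M' + 1) * (d * (norm f)\<^sup>2)" using d by (intro mult_right_mono) auto
    also have "\<dots> = (e * norm f)\<^sup>2" using M'(2) by (simp add: d_def power_mult_distrib)
    finally have "norm (A f) \<le> e * norm f" by (rule power2_le_imp_le) (use e in auto)
    moreover have "H f - complex_of_real (s * l) *\<^sub>C f = (- s) *\<^sub>R A f"
      by (rule ell2_eqI) (use s in \<open>auto simp: A_def scaleR_conv_of_real algebra_simps\<close>)
    ultimately show "\<exists>f\<in>S. f \<noteq> 0 \<and> norm (H f - complex_of_real (s * l) *\<^sub>C f) \<le> e * norm f"
      using f s by (intro bexI[of _ f]) auto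
  qed
  then show ?thesis using up that by blast
qed

text \<open>The forms of \<open>H\<close> and \<open>- H\<close> are each bounded by a number which,
  with its sign, is a point of the spectrum. The inclusion of the spectrum therefore bounds the form
  from both sides.\<close>

lemma numerical_range:
  assumes "f \<in> S"
  shows "\<bar>inner (H f) f\<bar> \<le> (K - 1) * (norm f)\<^sup>2"
proof -
  have "s * inner (H f) f \<le> (K - 1) * (norm f)\<^sup>2" if s: "s = 1 \<or> s = -1" for s
  proof -
    obtain l where l: "complex_of_real (s * l) \<in> spectrum_on S H"
        "\<And>f. f \<in> S \<Longrightarrow> s * inner (H f) f \<le> l * (norm f)\<^sup>2"
      using numerical_range_sup_in_spectrum[OF s] by blast
    have "complex_of_real (s * l) \<in> complex_of_real ` {-K + 1..K - 1}"
      using l(1) spectrum_subset by blast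
    then have "s * l \<in> {-K + 1..K - 1}" by (metis imageE of_real_eq_iff)
    then have "l \<le> K - 1" using s by auto
    then show ?thesis using l(2)[OF assms] by (meson mult_right_mono order_trans zero_le_power2)
  qed
  from this[of 1] this[of "-1"] show ?thesis by auto
qed

text \<open>The counterpart of \<open>norm_shifted_ge_Im\<close> for the real part of the form. For
  |Re z| >= K the factor is at least 1, whatever Im z is.\<close>

lemma norm_shifted_ge_Re:
  assumes "f \<in> S"
  shows "(\<bar>Re z\<bar> - (K - 1)) * norm f \<le> norm (H f - z *\<^sub>C f)"
proof -
  have "(\<bar>Re z\<bar> - (K - 1)) * (norm f)\<^sup>2 \<le> \<bar>inner (H f) f - Re z * (norm f)\<^sup>2\<bar>"
    using numerical_range[OF assms] abs_triangle_ineq2_sym[of "inner (H f) f" "Re z * (norm f)\<^sup>2"]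
    by (simp add: algebra_simps abs_mult)
  also have "\<dots> \<le> norm (H f - z *\<^sub>C f) * norm f"
    using Cauchy_Schwarz_ineq2[of "H f - z *\<^sub>C f" f] inner_shifted_self[OF assms, of z] by simp
  finally have "((\<bar>Re z\<bar> - (K - 1)) * norm f) * norm f \<le> norm (H f - z *\<^sub>C f) * norm f"
    by (simp add: power2_eq_square)
  then show ?thesis
    by (cases "norm f = 0") (auto simp: mult_le_cancel_right)
qed

end

section \<open>Plancherel's theorem\<close>

text \<open>The positive sign in the phase matches the factor exp (i z t) of the Laplace transform
  at z = E + i\<epsilon>; without normalisation, Plancherel carries the factor 2 pi.\<close>

definition fourier :: "(real \<Rightarrow> complex) \<Rightarrow> real \<Rightarrow> complex"
  where "fourier g E = (LINT t|lborel. g t * cis (E * t))"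

abbreviation gauss :: "real measure" where "gauss \<equiv> std_normal_distribution"

lemma integrable_mult_bounded:
  fixes g h :: "'a \<Rightarrow> complex"
  assumes "integrable M g" "h \<in> borel_measurable M" "\<And>x. cmod (h x) \<le> B"
  shows "integrable M (\<lambda>x. g x * h x)"
proof (rule Bochner_Integration.integrable_bound[where f = "\<lambda>x. B * norm (g x)"])
  show "integrable M (\<lambda>x. B * norm (g x))" using assms(1) by auto
  show "(\<lambda>x. g x * h x) \<in> borel_measurable M" using assms by auto
  have "cmod (g x) * cmod (h x) \<le> cmod (g x) * B" for x by (intro mult_left_mono assms) auto
  moreover have "0 \<le> B" using assms(3) norm_ge_zero order_trans by blast
  ultimately show "AE x in M. norm (g x * h x) \<le> norm (B * norm (g x))"
    by (auto simp: norm_mult mult.commute)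
qed

lemma integrable_pair_mult:
  fixes g h :: "_ \<Rightarrow> complex"
  assumes "sigma_finite_measure M1" "sigma_finite_measure M2" "integrable M1 g" "integrable M2 h"
  shows "integrable (M1 \<Otimes>\<^sub>M M2) (\<lambda>p. g (fst p) * h (snd p))"
proof -
  interpret pair_sigma_finite M1 M2 using assms by (simp add: pair_sigma_finite_def)
  have [measurable]: "g \<in> borel_measurable M1" "h \<in> borel_measurable M2" using assms by auto
  show ?thesis
  proof (rule Fubini_integrable)
    show "integrable M1 (\<lambda>x. \<integral>y. norm (g (fst (x, y)) * h (snd (x, y))) \<partial>M2)"
      using assms(3) by (simp add: norm_mult)
    show "AE x in M1. integrable M2 (\<lambda>y. g (fst (x, y)) * h (snd (x, y)))"
      using assms(4) by auto
  qed measurable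
qed

lemma borel_measurable_cis [measurable]: "cis \<in> borel_measurable borel"
  by (rule borel_measurable_continuous_onI) (intro continuous_intros)

lemma borel_measurable_cnj [measurable]: "cnj \<in> borel_measurable borel"
  by (rule borel_measurable_continuous_onI) (intro continuous_intros)

lemma char_gauss: "(LINT x|gauss. cis (x * t)) = complex_of_real (exp (- (t^2) / 2))"
proof -
  have "char gauss t = (LINT x|gauss. cis (x * t))"
    unfolding char_def by (intro Bochner_Integration.integral_cong)
      (simp_all add: cis_conv_exp mult_ac)
  then show ?thesis by (simp add: char_std_normal_distribution)
qed

lemma integral_gauss:
  fixes f :: "real \<Rightarrow> 'a::{banach, second_countable_topology}"
  assumes "f \<in> borel_measurable borel"
  shows "(LINT x|gauss. f x) = (LINT x|lborel. std_normal_density x *\<^sub>R f x)"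
  using assms by (intro integral_density) auto

text \<open>
  Gaussian regularisation: the right-hand side is the autocorrelation of \<open>g\<close>, averaged over shifts
  of size \<open>\<sigma>\<close>, and tends to the squared norm of \<open>g\<close> as \<open>\<sigma>\<close> tends to 0.
\<close>

lemma fourier_gauss:
  fixes g :: "real \<Rightarrow> complex"
  assumes int: "integrable lborel g" and bd: "bounded (range g)" and \<sigma>: "\<sigma> > 0"
  shows "complex_of_real (LINT E|lborel. (cmod (fourier g E))\<^sup>2 * exp (- (\<sigma> * E)\<^sup>2 / 2))
      = 2 * pi * (LINT p|(lborel \<Otimes>\<^sub>M gauss). g (fst p) * cnj (g (fst p + \<sigma> * snd p)))"
    (is "?lhs = ?rhs")
proof -
  interpret ga: prob_space gauss by (rule prob_space_normal_density) simp
  interpret P: pair_sigma_finite gauss "lborel \<Otimes>\<^sub>M lborel :: (real \<times> real) measure"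
    by (intro pair_sigma_finite.intro ga.sigma_finite_measure_axioms)
       (simp add: lborel_prod lborel.sigma_finite_measure_axioms)
  have sf: "sigma_finite_measure (lborel \<Otimes>\<^sub>M lborel :: (real \<times> real) measure)"
    by (simp add: lborel_prod lborel.sigma_finite_measure_axioms)
  interpret Q: pair_sigma_finite lborel gauss
    by (intro pair_sigma_finite.intro ga.sigma_finite_measure_axioms)
       (simp add: lborel.sigma_finite_measure_axioms)
  have [measurable]: "g \<in> borel_measurable borel" using int by auto
  have gc: "integrable lborel (\<lambda>t. cnj (g t))"
    using int by simp
  have gg: "integrable (lborel \<Otimes>\<^sub>M lborel) (\<lambda>p. g (fst p) * cnj (g (snd p)))"
    by (rule integrable_pair_mult) (auto simp: lborel.sigma_finite_measure_axioms int gc)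
  have F[measurable]: "fourier g \<in> borel_measurable borel"
    unfolding fourier_def by measurable
  have 1: "complex_of_real ((cmod (fourier g y))\<^sup>2)
      = (LINT p|(lborel \<Otimes>\<^sub>M lborel). g (fst p) * cnj (g (snd p)) * cis (y * (fst p - snd p)))" for y
  proof -
    have i: "integrable (lborel \<Otimes>\<^sub>M lborel) (\<lambda>p. g (fst p) * cnj (g (snd p)) * cis (y * (fst p - snd p)))"
      by (rule integrable_mult_bounded[OF gg, where B = 1]) auto
    have "complex_of_real ((cmod (fourier g y))\<^sup>2) = fourier g y * cnj (fourier g y)"
      by (simp add: complex_norm_square[symmetric])
    also have "\<dots> = (LINT t|lborel. g t * cis (y * t)) * (LINT s|lborel. cnj (g s * cis (y * s)))"
      by (simp only: fourier_def Bochner_Integration.integral_cnj)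
    also have "\<dots> = (LINT t|lborel. LINT s|lborel. g t * cis (y * t) * cnj (g s * cis (y * s)))"
      by simp
    also have "\<dots> = (LINT t|lborel. LINT s|lborel. g t * cnj (g s) * cis (y * (t - s)))"
    proof -
      have "cis (y * (t - s)) = cis (y * t) * cnj (cis (y * s))" for t s
        by (simp add: cis_cnj cis_mult algebra_simps)
      then show ?thesis by (simp add: mult_ac)
    qed
    also have "\<dots> = (LINT p|(lborel \<Otimes>\<^sub>M lborel). g (fst p) * cnj (g (snd p)) * cis (y * (fst p - snd p)))"
      using lborel_pair.integral_fst'[OF i] by simp
    finally show ?thesis .
  qed
  \<comment> \<open>Averaging over a standard Gaussian x, with energy x / \<sigma>, replaces the
    phase by the characteristic function at (t - s) / \<sigma>.\<close>
  have 2: "complex_of_real (LINT x|gauss. (cmod (fourier g (x / \<sigma>)))\<^sup>2)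
      = (LINT p|(lborel \<Otimes>\<^sub>M lborel). g (fst p) * cnj (g (snd p)) * exp (- (((fst p - snd p) / \<sigma>)^2) / 2))"
  proof -
    have i: "integrable (gauss \<Otimes>\<^sub>M (lborel \<Otimes>\<^sub>M lborel))
        (\<lambda>q. (1 * (g (fst (snd q)) * cnj (g (snd (snd q))))) * cis (fst q / \<sigma> * (fst (snd q) - snd (snd q))))"
      by (rule integrable_mult_bounded[OF
            integrable_pair_mult[of _ _ "\<lambda>_. 1", OF ga.sigma_finite_measure_axioms _ _ gg], where B = 1])
         (auto simp: sf)
    have "complex_of_real (LINT x|gauss. (cmod (fourier g (x / \<sigma>)))\<^sup>2)
       = (LINT x|gauss. complex_of_real ((cmod (fourier g (x / \<sigma>)))\<^sup>2))"
      by (rule integral_complex_of_real[symmetric])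
    also have "\<dots> = (LINT x|gauss. LINT p|(lborel \<Otimes>\<^sub>M lborel).
         g (fst p) * cnj (g (snd p)) * cis (x / \<sigma> * (fst p - snd p)))"
      by (simp only: 1)
    also have "\<dots> = (LINT p|(lborel \<Otimes>\<^sub>M lborel). LINT x|gauss.
         g (fst p) * cnj (g (snd p)) * cis (x / \<sigma> * (fst p - snd p)))"
      using i by (intro P.Fubini_integral[symmetric]) (simp add: case_prod_beta')
    also have "\<dots> = (LINT p|(lborel \<Otimes>\<^sub>M lborel). g (fst p) * cnj (g (snd p)) *
         (LINT x|gauss. cis (x * ((fst p - snd p) / \<sigma>))))"
      by simp
    finally show ?thesis by (simp only: char_gauss)
  qed
  have i3: "integrable (lborel \<Otimes>\<^sub>M lborel)
      (\<lambda>p. g (fst p) * cnj (g (snd p)) * complex_of_real (exp (- (((fst p - snd p) / \<sigma>)^2) / 2)))"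
    by (rule integrable_mult_bounded[OF gg, where B = 1]) auto
  \<comment> \<open>Substituting s = t + \<sigma> y makes the Gaussian the density of y, up to the
    factor \<sigma> sqrt (2 pi).\<close>
  have 3: "(LINT p|(lborel \<Otimes>\<^sub>M lborel). g (fst p) * cnj (g (snd p)) * exp (- (((fst p - snd p) / \<sigma>)^2) / 2))
     = (\<sigma> * sqrt (2 * pi)) * (LINT t|lborel. LINT y|gauss. g t * cnj (g (t + \<sigma> * y)))"
  proof -
    have "(LINT p|(lborel \<Otimes>\<^sub>M lborel). g (fst p) * cnj (g (snd p)) * exp (- (((fst p - snd p) / \<sigma>)^2) / 2))
      = (LINT t|lborel. LINT s|lborel. g t * cnj (g s) * exp (- (((t - s) / \<sigma>)^2) / 2))"
      using lborel_pair.integral_fst'[OF i3] by simp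
    also have "(\<lambda>t. LINT s|lborel. g t * cnj (g s) * exp (- (((t - s) / \<sigma>)^2) / 2))
      = (\<lambda>t. (\<sigma> * sqrt (2 * pi)) * (LINT y|gauss. g t * cnj (g (t + \<sigma> * y))))"
    proof
      fix t
      have m: "(\<lambda>y. g t * cnj (g (t + \<sigma> * y))) \<in> borel_measurable borel" by measurable
      have "(LINT s|lborel. g t * cnj (g s) * exp (- (((t - s) / \<sigma>)^2) / 2))
        = \<sigma> *\<^sub>R (LINT y|lborel. g t * cnj (g (t + \<sigma> * y)) * complex_of_real (exp (- (((t - (t + \<sigma> * y)) / \<sigma>)^2) / 2)))"
        using \<sigma> by (subst lborel_integral_real_affine[where c = \<sigma> and t = t]) auto
      also have "(\<lambda>y. g t * cnj (g (t + \<sigma> * y)) * complex_of_real (exp (- (((t - (t + \<sigma> * y)) / \<sigma>)^2) / 2)))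
        = (\<lambda>y. sqrt (2 * pi) * (std_normal_density y *\<^sub>R (g t * cnj (g (t + \<sigma> * y)))))"
        using \<sigma> by (auto simp: std_normal_density_def scaleR_conv_of_real)
      finally show "(LINT s|lborel. g t * cnj (g s) * exp (- (((t - s) / \<sigma>)^2) / 2))
        = (\<sigma> * sqrt (2 * pi)) * (LINT y|gauss. g t * cnj (g (t + \<sigma> * y)))"
        unfolding integral_gauss[OF m] unfolding integral_mult_right_zero by (simp add: scaleR_conv_of_real)
    qed
    finally show ?thesis by simp
  qed
  have *: "integrable (lborel \<Otimes>\<^sub>M gauss) (\<lambda>p. g (fst p) * cnj (g (fst p + \<sigma> * snd p)))"
  proof -
    obtain B where B: "\<And>x. cmod (g x) \<le> B" using bd by (auto simp: bounded_iff)
    have "integrable (lborel \<Otimes>\<^sub>M gauss) (\<lambda>p. (g (fst p) * 1) * cnj (g (fst p + \<sigma> * snd p)))"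
      by (rule integrable_mult_bounded[OF integrable_pair_mult[of _ _ _ "\<lambda>_. 1"], where B = B])
        (auto simp: lborel.sigma_finite_measure_axioms ga.sigma_finite_measure_axioms int B)
    then show ?thesis by simp
  qed
  have 4: "(LINT E|lborel. (cmod (fourier g E))\<^sup>2 * exp (- (\<sigma> * E)\<^sup>2 / 2))
     = sqrt (2 * pi) / \<sigma> * (LINT x|gauss. (cmod (fourier g (x / \<sigma>)))\<^sup>2)"
  proof -
    have "(LINT E|lborel. (cmod (fourier g E))\<^sup>2 * exp (- (\<sigma> * E)\<^sup>2 / 2))
      = (1/\<sigma>) *\<^sub>R (LINT x|lborel. (cmod (fourier g (0 + 1 / \<sigma> * x)))\<^sup>2 * exp (- (\<sigma> * (0 + 1 / \<sigma> * x))\<^sup>2 / 2))"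
      using \<sigma> by (subst lborel_integral_real_affine[where c = "1/\<sigma>" and t = 0]) auto
    also have "(\<lambda>x. (cmod (fourier g (0 + 1 / \<sigma> * x)))\<^sup>2 * exp (- (\<sigma> * (0 + 1 / \<sigma> * x))\<^sup>2 / 2))
      = (\<lambda>x. sqrt (2 * pi) * (std_normal_density x *\<^sub>R (cmod (fourier g (x / \<sigma>)))\<^sup>2))"
      using \<sigma> by (auto simp: std_normal_density_def)
    finally show ?thesis
      by (subst integral_gauss) simp_all
  qed
  \<comment> \<open>The two changes of variables contribute sqrt (2 pi) / \<sigma> and \<sigma> sqrt
    (2 pi), so \<sigma> cancels and 2 pi remains.\<close>
  have "?lhs = (sqrt (2 * pi) / \<sigma>) * ((\<sigma> * sqrt (2 * pi)) * (LINT t|lborel. LINT y|gauss. g t * cnj (g (t + \<sigma> * y))))"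
    unfolding 4 of_real_mult 2 3 by simp
  also have "\<dots> = of_real (sqrt (2 * pi) * sqrt (2 * pi)) * (LINT t|lborel. LINT y|gauss. g t * cnj (g (t + \<sigma> * y)))"
    using \<sigma> by (simp del: real_sqrt_mult_self flip: mult.assoc)
  also have "sqrt (2 * pi) * sqrt (2 * pi) = 2 * pi" by simp
  also have "(LINT t|lborel. LINT y|gauss. g t * cnj (g (t + \<sigma> * y)))
      = (LINT p|(lborel \<Otimes>\<^sub>M gauss). g (fst p) * cnj (g (fst p + \<sigma> * snd p)))"
    using Q.integral_fst'[OF *] by simp
  finally show "?lhs = ?rhs" by simp
qed

text \<open>Both sides of \<open>fourier_gauss\<close> converge as \<sigma> tends to 0 by dominated
  convergence, with the squared transform as dominating function on one side and a multiple of |g|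
  on the other. Continuity is only needed almost everywhere; excepting 0 admits functions that are
  switched on at time 0.\<close>

theorem plancherel:
  fixes g :: "real \<Rightarrow> complex"
  assumes int: "integrable lborel g" and bd: "bounded (range g)"
    and cont: "\<And>t. t \<noteq> 0 \<Longrightarrow> isCont g t"
    and sq: "integrable lborel (\<lambda>E. (cmod (fourier g E))\<^sup>2)"
  shows "(LINT E|lborel. (cmod (fourier g E))\<^sup>2) = 2 * pi * (LINT t|lborel. (cmod (g t))\<^sup>2)"
proof -
  interpret ga: prob_space gauss by (rule prob_space_normal_density) simp
  interpret Q: pair_sigma_finite lborel gauss
    by (intro pair_sigma_finite.intro ga.sigma_finite_measure_axioms)
       (simp add: lborel.sigma_finite_measure_axioms)
  have [measurable]: "g \<in> borel_measurable borel" using int by auto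
  have F[measurable]: "fourier g \<in> borel_measurable borel"
    unfolding fourier_def by measurable
  obtain B where B: "\<And>x. cmod (g x) \<le> B" using bd by (auto simp: bounded_iff)
  have B0: "B \<ge> 0" using B[of 0] by (meson norm_ge_zero order_trans)
  define \<sigma> where "\<sigma> n = 1 / real (Suc n)" for n
  have \<sigma>: "\<sigma> n > 0" for n by (simp add: \<sigma>_def)
  have \<sigma>0: "\<sigma> \<longlonglongrightarrow> 0"
    unfolding \<sigma>_def by (rule LIMSEQ_Suc[OF lim_1_over_n])
  have lim1: "(\<lambda>n. LINT E|lborel. (cmod (fourier g E))\<^sup>2 * exp (- (\<sigma> n * E)\<^sup>2 / 2))
      \<longlonglongrightarrow> (LINT E|lborel. (cmod (fourier g E))\<^sup>2)"
  proof (rule integral_dominated_convergence[where w = "\<lambda>E. (cmod (fourier g E))\<^sup>2"])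
    show "AE E in lborel. (\<lambda>n. (cmod (fourier g E))\<^sup>2 * exp (- (\<sigma> n * E)\<^sup>2 / 2))
        \<longlonglongrightarrow> (cmod (fourier g E))\<^sup>2"
    proof (rule AE_I2)
      fix E
      have "(\<lambda>n. (cmod (fourier g E))\<^sup>2 * exp (- (\<sigma> n * E)\<^sup>2 / 2))
        \<longlonglongrightarrow> (cmod (fourier g E))\<^sup>2 * exp (- (0 * E)\<^sup>2 / 2)"
        by (intro tendsto_intros \<sigma>0) auto
      then show "(\<lambda>n. (cmod (fourier g E))\<^sup>2 * exp (- (\<sigma> n * E)\<^sup>2 / 2))
        \<longlonglongrightarrow> (cmod (fourier g E))\<^sup>2" by simp
    qed
    show "AE E in lborel. norm ((cmod (fourier g E))\<^sup>2 * exp (- (\<sigma> n * E)\<^sup>2 / 2)) \<le> (cmod (fourier g E))\<^sup>2" for n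
      by (rule AE_I2) (auto intro!: mult_left_le)
  qed (use sq in auto)
  have lim2: "(\<lambda>n. LINT p|(lborel \<Otimes>\<^sub>M gauss). g (fst p) * cnj (g (fst p + \<sigma> n * snd p)))
      \<longlonglongrightarrow> (LINT p|(lborel \<Otimes>\<^sub>M gauss). g (fst p) * cnj (g (fst p)))"
  proof (rule integral_dominated_convergence[where w = "\<lambda>p. B * cmod (g (fst p))"])
    have "integrable (lborel \<Otimes>\<^sub>M gauss) (\<lambda>p. g (fst p) * 1)"
      by (rule integrable_pair_mult)
        (auto simp: lborel.sigma_finite_measure_axioms ga.sigma_finite_measure_axioms int)
    then show "integrable (lborel \<Otimes>\<^sub>M gauss) (\<lambda>p. B * cmod (g (fst p)))" by auto
    show "AE p in lborel \<Otimes>\<^sub>M gauss. norm (g (fst p) * cnj (g (fst p + \<sigma> n * snd p))) \<le> B * cmod (g (fst p))" for n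
      by (rule AE_I2) (auto simp: norm_mult mult.commute[of B] intro!: mult_left_mono B)
    have "AE t in lborel. t \<noteq> (0::real)" by (rule AE_lborel_singleton)
    then have "AE t in lborel. AE y in gauss. (t::real) \<noteq> 0"
      by (rule AE_mp) auto
    moreover have "{p \<in> space (lborel \<Otimes>\<^sub>M gauss). fst p \<noteq> (0::real)} \<in> sets (lborel \<Otimes>\<^sub>M gauss)"
      by measurable
    ultimately have "AE p in lborel \<Otimes>\<^sub>M gauss. fst p \<noteq> (0::real)"
      by (intro Q.AE_pair_measure) (simp_all only: fst_conv)
    then show "AE p in lborel \<Otimes>\<^sub>M gauss. (\<lambda>n. g (fst p) * cnj (g (fst p + \<sigma> n * snd p)))
        \<longlonglongrightarrow> g (fst p) * cnj (g (fst p))"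
    proof (rule AE_mp, intro AE_I2 impI)
      fix p :: "real \<times> real" assume p: "fst p \<noteq> 0"
      have "(\<lambda>n. fst p + \<sigma> n * snd p) \<longlonglongrightarrow> fst p + 0 * snd p"
        by (intro tendsto_intros \<sigma>0)
      then have "(\<lambda>n. g (fst p + \<sigma> n * snd p)) \<longlonglongrightarrow> g (fst p)"
        by (intro isCont_tendsto_compose[OF cont[OF p]]) simp
      then show "(\<lambda>n. g (fst p) * cnj (g (fst p + \<sigma> n * snd p)))
        \<longlonglongrightarrow> g (fst p) * cnj (g (fst p))"
        by (intro tendsto_intros)
    qed
    show "(\<lambda>p. g (fst p) * cnj (g (fst p))) \<in> borel_measurable (lborel \<Otimes>\<^sub>M gauss)"
      by measurable
    show "(\<lambda>p. g (fst p) * cnj (g (fst p + \<sigma> n * snd p))) \<in> borel_measurable (lborel \<Otimes>\<^sub>M gauss)" for n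
      by measurable
  qed
  have i: "integrable (lborel \<Otimes>\<^sub>M gauss) (\<lambda>p. (g (fst p) * 1) * cnj (g (fst p)))"
    by (rule integrable_mult_bounded[OF integrable_pair_mult[of _ _ _ "\<lambda>_. 1"], where B = B])
      (auto simp: lborel.sigma_finite_measure_axioms ga.sigma_finite_measure_axioms int B)
  have "(LINT p|(lborel \<Otimes>\<^sub>M gauss). g (fst p) * cnj (g (fst p))) = (LINT t|lborel. g t * cnj (g t))"
    using Q.integral_fst'[OF i] by (simp add: ga.prob_space[simplified])
  also have "\<dots> = complex_of_real (LINT t|lborel. (cmod (g t))\<^sup>2)"
    by (simp flip: complex_norm_square integral_complex_of_real)
  finally have eq: "(LINT p|(lborel \<Otimes>\<^sub>M gauss). g (fst p) * cnj (g (fst p))) = complex_of_real (LINT t|lborel. (cmod (g t))\<^sup>2)" .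
  have "(\<lambda>n. complex_of_real (LINT E|lborel. (cmod (fourier g E))\<^sup>2 * exp (- (\<sigma> n * E)\<^sup>2 / 2)))
      \<longlonglongrightarrow> 2 * pi * complex_of_real (LINT t|lborel. (cmod (g t))\<^sup>2)"
    unfolding fourier_gauss[OF int bd \<sigma>] eq[symmetric]
    by (intro tendsto_mult tendsto_const lim2)
  moreover have "(\<lambda>n. complex_of_real (LINT E|lborel. (cmod (fourier g E))\<^sup>2 * exp (- (\<sigma> n * E)\<^sup>2 / 2)))
      \<longlonglongrightarrow> complex_of_real (LINT E|lborel. (cmod (fourier g E))\<^sup>2)"
    by (intro tendsto_of_real lim1)
  ultimately have "complex_of_real (LINT E|lborel. (cmod (fourier g E))\<^sup>2)
      = 2 * pi * complex_of_real (LINT t|lborel. (cmod (g t))\<^sup>2)"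
    using LIMSEQ_unique by blast
  then have "complex_of_real (LINT E|lborel. (cmod (fourier g E))\<^sup>2)
      = complex_of_real (2 * pi * (LINT t|lborel. (cmod (g t))\<^sup>2))" by simp
  then show ?thesis by (simp only: of_real_eq_iff)
qed

section \<open>The unitary evolution and its Laplace transform\<close>

text \<open>Term-by-term differentiation of the exponential series, for a real-linear bounded
  operator on an arbitrary Banach space. The evolution is the case of - i H.\<close>

lemma operator_exp_has_vector_derivative:
  fixes A :: "'a::banach \<Rightarrow> 'a" and x :: 'a
  assumes A: "bounded_linear A"
  defines "e \<equiv> \<lambda>t. \<Sum>k. (t ^ k / fact k) *\<^sub>R (A ^^ k) x"
  shows "(e has_vector_derivative A (e t)) (at t)"
proof -
  interpret A: bounded_linear A by fact
  obtain M where M: "0 < M" "\<And>y. norm (A y) \<le> norm y * M"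
    using A.pos_bounded by blast
  have pow: "norm ((A ^^ k) x) \<le> M ^ k * norm x" for k
  proof (induction k)
    case (Suc k)
    have "norm ((A ^^ Suc k) x) \<le> norm ((A ^^ k) x) * M" using M(2) by simp
    also have "\<dots> \<le> (M ^ k * norm x) * M" using Suc M(1) by (intro mult_right_mono) auto
    finally show ?case by (simp add: mult_ac)
  qed simp
  define f where "f n t = (t ^ n / fact n) *\<^sub>R (A ^^ n) x" for n and t :: real
  \<comment> \<open>The Weierstrass bound is uniform only on bounded sets of times; the ball of this
    radius is open and contains \<open>t\<close>.\<close>
  define R where "R = \<bar>t\<bar> + 1"
  define B :: "real set" where "B = ball 0 R"
  have ul: "uniform_limit B (\<lambda>n t. \<Sum>i<n. f i t) (\<lambda>t. suminf (\<lambda>i. f i t)) sequentially"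
  proof (rule Weierstrass_m_test)
    show "summable (\<lambda>n. ((R * M) ^ n /\<^sub>R fact n) * norm x)"
      by (intro summable_mult2 summable_exp_generic)
    fix n s assume "s \<in> B"
    then have s: "\<bar>s\<bar> \<le> R" by (simp add: B_def dist_norm)
    have "norm (f n s) = \<bar>s\<bar> ^ n / fact n * norm ((A ^^ n) x)"
      by (simp add: f_def power_abs)
    also have "\<dots> \<le> R ^ n / fact n * (M ^ n * norm x)"
      by (intro mult_mono divide_right_mono power_mono s pow) (auto simp: R_def)
    finally show "norm (f n s) \<le> ((R * M) ^ n /\<^sub>R fact n) * norm x"
      by (simp add: power_mult_distrib field_simps)
  qed
  have e: "e = (\<lambda>t. suminf (\<lambda>i. f i t))" by (simp add: e_def f_def)
  define f' where "f' n t h = h *\<^sub>R (case n of 0 \<Rightarrow> 0 | Suc m \<Rightarrow> A (f m t))" for n and t h :: real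
  \<comment> \<open>Differentiation shifts the series by one index, so the derivative of a partial
    sum is \<open>A\<close> applied to the preceding partial sum, and its uniform convergence
    follows from that of the series itself.\<close>
  have sumf': "(\<Sum>i<Suc n. f' i s h) = h *\<^sub>R A (\<Sum>i<n. f i s)" for n s h
    by (simp only: sum.lessThan_Suc_shift) (simp add: f'_def A.sum scaleR_sum_right)
  have tB: "t \<in> B" by (simp add: B_def R_def dist_norm)
  have "\<exists>g. \<forall>s\<in>B. (\<lambda>n. f n s) sums (g s) \<and> (g has_derivative (\<lambda>h. h *\<^sub>R A (e s))) (at s within B)"
  proof (rule has_derivative_series[where x = t and l = "e t"])
    show "convex B" by (simp add: B_def)
    show "(f n has_derivative f' n s) (at s within B)" for n s
    proof (cases n)
      case 0
      then show ?thesis by (simp add: f_def[abs_def] f'_def[abs_def])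
    next
      case (Suc m)
      have "((\<lambda>s. s ^ Suc m / fact (Suc m)) has_real_derivative (s ^ m / fact m)) (at s within B)"
        by (rule derivative_eq_intros refl | simp)+
      then have "(f (Suc m) has_vector_derivative ((s ^ m / fact m) *\<^sub>R (A ^^ Suc m) x)) (at s within B)"
        unfolding f_def[abs_def]
        by (rule has_vector_derivative_scaleR[THEN has_vector_derivative_eq_rhs, OF _ has_vector_derivative_const]) simp
      then show ?thesis
        by (simp add: Suc f'_def[abs_def] f_def has_vector_derivative_def A.scaleR)
    qed
    show "\<forall>\<^sub>F n in sequentially. \<forall>s\<in>B. \<forall>h. norm ((\<Sum>i<n. f' i s h) - h *\<^sub>R A (e s)) \<le> r * norm h"
      if r: "r > 0" for r
    proof -
      have "r / M > 0" using r M by simp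
      then have "\<forall>\<^sub>F n in sequentially. \<forall>s\<in>B. dist (\<Sum>i<n. f i s) (e s) < r / M"
        using ul unfolding uniform_limit_iff e by blast
      then have "\<forall>\<^sub>F n in sequentially. \<forall>s\<in>B. \<forall>h. norm ((\<Sum>i<Suc n. f' i s h) - h *\<^sub>R A (e s)) \<le> r * norm h"
      proof (rule eventually_mono, intro ballI allI)
        fix n s h assume a: "\<forall>s\<in>B. dist (\<Sum>i<n. f i s) (e s) < r / M" "s \<in> B"
        have "norm ((\<Sum>i<Suc n. f' i s h) - h *\<^sub>R A (e s)) = \<bar>h\<bar> * norm (A ((\<Sum>i<n. f i s) - e s))"
          by (simp only: sumf') (simp add: A.diff flip: scaleR_right_diff_distrib)
        also have "\<dots> \<le> \<bar>h\<bar> * (norm ((\<Sum>i<n. f i s) - e s) * M)"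
          by (intro mult_left_mono M) auto
        also have "\<dots> \<le> \<bar>h\<bar> * ((r / M) * M)"
          using a M by (intro mult_left_mono mult_right_mono) (auto simp: dist_norm less_imp_le)
        finally show "norm ((\<Sum>i<Suc n. f' i s h) - h *\<^sub>R A (e s)) \<le> r * norm h"
          using M by (simp add: mult.commute)
      qed
      then show ?thesis by (rule eventually_sequentially_Suc[THEN iffD1])
    qed
    show "(\<lambda>n. f n t) sums e t"
      using tendsto_uniform_limitI[OF ul tB] by (simp add: sums_def e)
  qed (fact tB)
  then obtain g where g: "\<And>s. s \<in> B \<Longrightarrow> (\<lambda>n. f n s) sums (g s)"
      "\<And>s. s \<in> B \<Longrightarrow> (g has_derivative (\<lambda>h. h *\<^sub>R A (e s))) (at s within B)"
    by blast
  have "g s = e s" if "s \<in> B" for s using g(1)[OF that] by (simp add: e sums_iff)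
  then have "(e has_derivative (\<lambda>h. h *\<^sub>R A (e t))) (at t within B)"
    using g(2)[OF tB] tB by (metis has_derivative_transform)
  then show ?thesis
    using at_within_open[OF tB] by (simp add: has_vector_derivative_def B_def)
qed

lemma bounded_linear_coord: "bounded_linear (\<lambda>f. coord f x)"
  by (rule bounded_linear_intro[where K = 1]) (auto simp: cmod_coord_le)

section \<open>Unitarity of the evolution\<close>

context schroedinger_op
begin

abbreviation evol :: "real \<Rightarrow> int ell2" where "evol t \<equiv> evolution L V t (delta 1)"

lemma delta_S: "n \<in> sites L \<Longrightarrow> delta n \<in> S"
  by (auto simp: ell2_on_def coord_delta)

lemma one_site: "1 \<in> sites L"
  by (cases L) auto

lemma evolution_has_vector_derivative:
  "((\<lambda>t. evolution L V t \<psi>) has_vector_derivative (- \<i>) *\<^sub>C H (evolution L V t \<psi>)) (at t)"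
proof -
  define A where "A f = (- \<i>) *\<^sub>C H f" for f
  have blA: "bounded_linear A"
    unfolding A_def by (rule bounded_linear_compose[OF bounded_linear_cscale H.bounded_linear])
  have pow: "(A ^^ k) \<psi> = (- \<i>) ^ k *\<^sub>C (H ^^ k) \<psi>" for k
    by (induction k) (auto intro!: ell2_eqI simp: A_def H_cscale)
  have "(- \<i> * complex_of_real t) ^ k = complex_of_real t ^ k * (- \<i>) ^ k" for t k
    by (simp only: power_mult_distrib mult.commute)
  then have "evolution L V t \<psi> = (\<Sum>k. (t ^ k / fact k) *\<^sub>R (A ^^ k) \<psi>)" for t
    unfolding evolution_def pow
    by (intro suminf_cong ell2_eqI) (simp add: scaleR_conv_of_real)
  then show ?thesis
    using operator_exp_has_vector_derivative[OF blA, of \<psi> t] by (simp add: A_def[symmetric])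
qed

lemma evolution_0: "evolution L V 0 \<psi> = \<psi>"
proof -
  have "evolution L V 0 \<psi> = (\<Sum>k\<in>{0}. ((- \<i> * complex_of_real 0) ^ k / fact k) *\<^sub>C (H ^^ k) \<psi>)"
    unfolding evolution_def by (rule suminf_finite) (auto intro!: ell2_eqI)
  also have "\<dots> = \<psi>" by (auto intro!: ell2_eqI)
  finally show ?thesis .
qed

lemma evolution_S:
  assumes "\<psi> \<in> S"
  shows "evolution L V t \<psi> \<in> S"
proof -
  have "(H ^^ k) \<psi> \<in> S" for k using assms by (cases k) (auto simp: S_H)
  then have "coord (evolution L V t \<psi>) n = 0" if "n \<notin> sites L" for n
    unfolding evolution_def
      bounded_linear.suminf[OF bounded_linear_coord evolution_summable[OF bounded_V]]
    using that by (simp add: S_coord)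
  then show ?thesis by (simp add: ell2_on_def)
qed

text \<open>The derivative of the squared norm is twice the real part of the pairing of - i H u with
  u, which vanishes because the form of \<open>H\<close> on \<open>S\<close> is real.\<close>

lemma norm_evolution:
  assumes "\<psi> \<in> S"
  shows "norm (evolution L V t \<psi>) = norm \<psi>"
proof -
  let ?u = "\<lambda>t. evolution L V t \<psi>"
  have "((\<lambda>t. inner (?u t) (?u t)) has_real_derivative 0) (at s)" for s
  proof -
    have "((\<lambda>t. inner (?u t) (?u t)) has_derivative
        (\<lambda>h. inner (?u s) (h *\<^sub>R ((- \<i>) *\<^sub>C H (?u s))) + inner (h *\<^sub>R ((- \<i>) *\<^sub>C H (?u s))) (?u s))) (at s)"
      using evolution_has_vector_derivative[of \<psi> s] unfolding has_vector_derivative_def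
      by (intro has_derivative_inner)
    moreover have z: "inner ((- \<i>) *\<^sub>C H (?u s)) (?u s) = 0"
    proof -
      have "\<i> *\<^sub>C ((- \<i>) *\<^sub>C H (?u s)) = H (?u s)" by (rule ell2_eqI) simp
      then show ?thesis
        using inner_cscale_left_right[of "(- \<i>) *\<^sub>C H (?u s)" "?u s"] inner_H_i[OF evolution_S[OF assms]]
        by simp
    qed
    ultimately show ?thesis
      using z[unfolded inner_commute[of _ "?u s"]]
      by (simp add: has_field_derivative_def mult_zero_left[abs_def])
  qed
  then have "inner (?u t) (?u t) = inner (?u 0) (?u 0)"
    using DERIV_isconst_all by blast
  then show ?thesis by (simp add: evolution_0 norm_eq_sqrt_inner)
qed

lemma norm_evol: "norm (evol t) = 1"
  by (simp add: norm_evolution delta_S one_site)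

lemma evol_S: "evol t \<in> S"
  by (simp add: evolution_S delta_S one_site)

end

lemma integrable_inverse_1_plus_square':
  "integrable lborel (\<lambda>x::real. inverse (1 + x\<^sup>2))"
  using integrable_inverse_1_plus_square by (simp add: set_integrable_def)

context schroedinger_op
begin

section \<open>The Green function as a Laplace transform, and averaged probabilities as energy
  integrals\<close>

abbreviation green :: "complex \<Rightarrow> int ell2" where "green z \<equiv> resolve z (delta 1)"

lemma green: assumes "Im z \<noteq> 0"
  shows "green z \<in> S" "H (green z) - z *\<^sub>C green z = delta 1"
  using resolve[OF assms] delta_S one_site by auto

lemma isCont_coord_evol: "isCont (\<lambda>t. coord (evol t) n) t"
  by (rule has_vector_derivative_continuous
        [OF bounded_linear.has_vector_derivative[OF bounded_linear_coord evolution_has_vector_derivative]])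

text \<open>Pairing with y = (H - cnj z)^-1 delta_n turns the integrand into an exact derivative:
  the pairing of (H - z) f with y is the n-th coordinate of f, so \<open>F\<close> below is an
  antiderivative. It decays at infinity because Im z > 0, and its value at 0 is i times the Green
  function.\<close>

lemma laplace_evol:
  assumes z: "Im z > 0" and n: "n \<in> sites L"
  shows "(LBINT t=0..\<infinity>. exp (\<i> * z * of_real t) * coord (evol t) n) = - \<i> * coord (green z) n"
    and "set_integrable lborel {0<..} (\<lambda>t. exp (\<i> * z * of_real t) * coord (evol t) n)"
proof -
  have cz: "Im (cnj z) \<noteq> 0" using z by simp
  define y where "y = resolve (cnj z) (delta n)"
  have y: "y \<in> S" "H y - cnj z *\<^sub>C y = delta n"
    using resolve[OF cz delta_S[OF n]] by (auto simp: y_def)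
  have adj: "cinner (H f - z *\<^sub>C f) y = coord f n" if "f \<in> S" for f
  proof -
    have "cinner (H f - z *\<^sub>C f) y = cinner f (H y - cnj z *\<^sub>C y)"
      by (simp add: cinner_diff_left cinner_diff_right cinner_cscale_left cinner_cscale_right
          H_cinner_symmetric that y(1))
    then show ?thesis by (simp add: y(2) cinner_delta)
  qed
  define F where "F t = \<i> * (exp (\<i> * z * of_real t) * cinner (evol t) y)" for t :: real
  define f where "f t = exp (\<i> * z * of_real t) * coord (evol t) n" for t :: real
  have dF: "(F has_vector_derivative f t) (at t)" for t
  proof -
    have 1: "((\<lambda>t. cinner (evol t) y) has_vector_derivative cinner ((- \<i>) *\<^sub>C H (evol t)) y) (at t)"
      using bounded_linear.has_vector_derivative[OF bounded_linear_cinner_left evolution_has_vector_derivative] .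
    have 2: "((\<lambda>t. exp (\<i> * z * of_real t)) has_vector_derivative (\<i> * z * exp (\<i> * z * of_real t))) (at t)"
      by (rule has_vector_derivative_real_field)
        (auto intro!: derivative_eq_intros)
    have "((\<lambda>t. \<i> * (exp (\<i> * z * of_real t) * cinner (evol t) y)) has_vector_derivative
       \<i> * (exp (\<i> * z * of_real t) * cinner ((- \<i>) *\<^sub>C H (evol t)) y + \<i> * z * exp (\<i> * z * of_real t) * cinner (evol t) y)) (at t)"
      by (intro has_vector_derivative_mult_right has_vector_derivative_mult[OF 2 1])
    moreover have "\<i> * (exp (\<i> * z * of_real t) * cinner ((- \<i>) *\<^sub>C H (evol t)) y + \<i> * z * exp (\<i> * z * of_real t) * cinner (evol t) y)
       = exp (\<i> * z * of_real t) * cinner (H (evol t) - z *\<^sub>C evol t) y"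
      unfolding cinner_diff_left cinner_cscale_left by (simp add: algebra_simps)
    ultimately show ?thesis
      by (simp add: F_def[abs_def] f_def adj evol_S)
  qed
  have cu: "continuous_on UNIV (\<lambda>t. coord (evol t) n)"
    by (intro continuous_at_imp_continuous_on ballI isCont_coord_evol)
  have cf: "continuous_on UNIV f"
    unfolding f_def by (intro continuous_intros cu)
  have nf: "cmod (f t) \<le> exp (- (t * Im z))" for t
  proof -
    have "cmod (coord (evol t) n) \<le> 1" using cmod_coord_le[of "evol t" n] by (simp add: norm_evol)
    then show ?thesis by (simp add: f_def norm_mult mult_left_le mult.commute)
  qed
  have ie: "set_integrable lborel {0<..} (\<lambda>t::real. exp (- (t * Im z)))"
    using integrable_I0i_exp_mscale[OF z] by (simp add: exp_minus)
  show int: "set_integrable lborel {0<..} (\<lambda>t. exp (\<i> * z * of_real t) * coord (evol t) n)"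
    unfolding f_def[symmetric, abs_def]
  proof (rule set_integrable_bound[OF ie])
    show "set_borel_measurable lborel {0<..} f"
      unfolding set_borel_measurable_def using borel_measurable_continuous_onI[OF cf] by simp
  qed (use nf in auto)
  have nF: "cmod (F t) \<le> exp (- (t * Im z)) * (2 * norm y)" for t
  proof -
    have "cmod (cinner (evol t) y) \<le> 2 * norm y" using norm_cinner_le[of "evol t" y] by (simp add: norm_evol)
    then show ?thesis by (simp add: F_def norm_mult mult.commute)
  qed
  have "(LBINT t=0..\<infinity>. f t) = 0 - F 0"
  proof (rule interval_integral_FTC_integrable)
    show "isCont f t" for t using cf by (simp add: continuous_on_eq_continuous_at)
    show "set_integrable lborel (einterval 0 \<infinity>) f"
    proof -
      have "einterval 0 \<infinity> = {0::real<..}" by (auto simp: einterval_def)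
      then show ?thesis using int by (simp add: f_def[abs_def])
    qed
    have "isCont F 0" using dF has_vector_derivative_continuous by blast
    then have "(F \<longlongrightarrow> F 0) (at_right 0)" by (simp add: isCont_def filterlim_at_split)
    then show "((F \<circ> real_of_ereal) \<longlongrightarrow> F 0) (at_right 0)"
      by (simp add: zero_ereal_def ereal_tendsto_simps1)
    have "((\<lambda>t. exp (- (t * Im z)) * (2 * norm y)) \<longlongrightarrow> 0 * (2 * norm y)) at_top"
      using z by (intro tendsto_mult tendsto_const) real_asymp
    then have "(F \<longlongrightarrow> 0) at_top"
      by (intro Lim_null_comparison[OF always_eventually[OF allI[OF nF]]]) simp
    then show "((F \<circ> real_of_ereal) \<longlongrightarrow> 0) (at_left \<infinity>)"
      by (simp add: ereal_tendsto_simps1)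
  qed (use dF in auto)
  also have "F 0 = \<i> * cinner (delta 1) y" by (simp add: F_def evolution_0)
  also have "cinner (delta 1) y = coord (green z) n"
    using adj[OF green(1)[of z]] green(2)[of z] z by simp
  finally show "(LBINT t=0..\<infinity>. exp (\<i> * z * of_real t) * coord (evol t) n) = - \<i> * coord (green z) n"
    by (simp add: f_def)
qed

text \<open>The signal to which Plancherel is applied: its transform at E is the Green function at E
  + i\<epsilon> up to the factor - i, and for \<epsilon> = 1/T its squared modulus is the integrand
  of a(n, T) away from time 0.\<close>

definition damped :: "real \<Rightarrow> int \<Rightarrow> real \<Rightarrow> complex"
  where "damped \<epsilon> n t = indicator {0<..} t *\<^sub>R (exp (- \<epsilon> * t) *\<^sub>R coord (evol t) n)"

lemma damped_eq: "damped \<epsilon> n t * cis (E * t) =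
    indicator {0<..} t *\<^sub>R (exp (\<i> * Complex E \<epsilon> * of_real t) * coord (evol t) n)"
proof -
  have "exp (\<i> * Complex E \<epsilon> * of_real t) = of_real (exp (- \<epsilon> * t)) * cis (E * t)"
    by (simp add: exp_eq_polar mult.commute)
  then show ?thesis by (simp add: damped_def scaleR_conv_of_real)
qed

lemma fourier_damped:
  assumes "\<epsilon> > 0" "n \<in> sites L"
  shows "fourier (damped \<epsilon> n) E = - \<i> * coord (green (Complex E \<epsilon>)) n"
  using laplace_evol(1)[of "Complex E \<epsilon>" n] assms
  by (simp add: fourier_def damped_eq interval_lebesgue_integral_0_infty set_lebesgue_integral_def)

lemma coord_green_bounds:
  assumes "\<epsilon> > 0"
  shows "cmod (coord (green (Complex E \<epsilon>)) n) \<le> 1 / \<epsilon>"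
    and "K - 1 < \<bar>E\<bar> \<Longrightarrow> cmod (coord (green (Complex E \<epsilon>)) n) \<le> 1 / (\<bar>E\<bar> - (K - 1))"
proof -
  let ?\<psi> = "green (Complex E \<epsilon>)"
  have g: "?\<psi> \<in> S" "H ?\<psi> - Complex E \<epsilon> *\<^sub>C ?\<psi> = delta 1" using green[of "Complex E \<epsilon>"] assms by auto
  have "\<epsilon> * norm ?\<psi> \<le> 1" using norm_shifted_ge_Im[OF g(1), of "Complex E \<epsilon>"] g(2) assms by simp
  then have "norm ?\<psi> \<le> 1 / \<epsilon>" using assms by (simp add: field_simps)
  then show "cmod (coord ?\<psi> n) \<le> 1 / \<epsilon>" by (rule order_trans[OF cmod_coord_le])
  assume E: "K - 1 < \<bar>E\<bar>"
  have "(\<bar>E\<bar> - (K - 1)) * norm ?\<psi> \<le> 1" using norm_shifted_ge_Re[OF g(1), of "Complex E \<epsilon>"] g(2) by simp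
  then have "norm ?\<psi> \<le> 1 / (\<bar>E\<bar> - (K - 1))" using E by (subst pos_le_divide_eq) (simp_all add: mult.commute)
  then show "cmod (coord ?\<psi> n) \<le> 1 / (\<bar>E\<bar> - (K - 1))" by (rule order_trans[OF cmod_coord_le])
qed

text \<open>Puts the resolvent bound away from the spectrum under an integrable function. With d =
  |E| - (K - 1) >= 1, the summand 4 K^2 pays for |E| <= 2 K; beyond that |E| <= 2 d, and 9 covers 1
  + 4 d^2.\<close>

lemma inverse_square_le:
  assumes "\<bar>E\<bar> \<ge> K"
  shows "(1 / (\<bar>E\<bar> - (K - 1)))\<^sup>2 \<le> (9 + 4 * K\<^sup>2) * inverse (1 + E\<^sup>2)"
proof -
  define d where "d = \<bar>E\<bar> - (K - 1)"
  have d: "d \<ge> 1" using assms by (simp add: d_def)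
  have pos: "0 < 1 + E\<^sup>2" by (simp add: add_pos_nonneg)
  have "1 + E\<^sup>2 \<le> (9 + 4 * K\<^sup>2) * d\<^sup>2"
  proof (cases "\<bar>E\<bar> \<le> 2 * K")
    case True
    then have "E\<^sup>2 \<le> 4 * K\<^sup>2" using power_mono[of "\<bar>E\<bar>" "2 * K" 2] by (simp add: power_mult_distrib)
    moreover have "(9 + 4 * K\<^sup>2) * 1 \<le> (9 + 4 * K\<^sup>2) * d\<^sup>2"
      using d by (intro mult_left_mono one_le_power) auto
    ultimately show ?thesis by simp
  next
    case False
    then have "\<bar>E\<bar> \<le> 2 * d" by (simp add: d_def)
    then have "E\<^sup>2 \<le> 4 * d\<^sup>2" using power_mono[of "\<bar>E\<bar>" "2 * d" 2] by (simp add: power_mult_distrib)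
    moreover have "1 \<le> d\<^sup>2" using d by simp
    ultimately have "1 + E\<^sup>2 \<le> 9 * d\<^sup>2" by simp
    also have "\<dots> \<le> (9 + 4 * K\<^sup>2) * d\<^sup>2" by (intro mult_right_mono) auto
    finally show ?thesis .
  qed
  then have "inverse (d\<^sup>2) \<le> (9 + 4 * K\<^sup>2) * inverse (1 + E\<^sup>2)"
    using pos d by (simp add: field_simps)
  then show ?thesis by (simp add: d_def power_divide inverse_eq_divide)
qed

lemma damped_props:
  assumes \<epsilon>: "\<epsilon> > 0" and n: "n \<in> sites L"
  shows "integrable lborel (damped \<epsilon> n)" "bounded (range (damped \<epsilon> n))"
    "t \<noteq> 0 \<Longrightarrow> isCont (damped \<epsilon> n) t"
proof -
  have "damped \<epsilon> n = (\<lambda>t. indicator {0<..} t *\<^sub>R (exp (\<i> * Complex 0 \<epsilon> * of_real t) * coord (evol t) n))"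
    using damped_eq[of \<epsilon> n _ 0] by (auto simp: cis_zero)
  then show "integrable lborel (damped \<epsilon> n)"
    using laplace_evol(2)[of "Complex 0 \<epsilon>" n] assms
    by (simp add: set_integrable_def)
  have "cmod (damped \<epsilon> n t) \<le> 1" for t
  proof -
    have "cmod (coord (evol t) n) \<le> 1" using cmod_coord_le[of "evol t" n] by (simp add: norm_evol)
    then show ?thesis using \<epsilon> by (auto simp: damped_def indicator_def intro!: mult_le_one)
  qed
  then show "bounded (range (damped \<epsilon> n))" by (auto simp: bounded_iff)
  assume t: "t \<noteq> 0"
  show "isCont (damped \<epsilon> n) t"
  proof (cases "t > 0")
    case True
    have "isCont (\<lambda>t. exp (- \<epsilon> * t) *\<^sub>R coord (evol t) n) t"
      by (intro continuous_intros isCont_coord_evol)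
    moreover have "eventually (\<lambda>s. damped \<epsilon> n s = exp (- \<epsilon> * s) *\<^sub>R coord (evol s) n) (nhds t)"
      using eventually_nhds_in_open[of "{0<..}" t] True
      by (auto elim!: eventually_mono simp: damped_def)
    ultimately show ?thesis using isCont_cong[of "damped \<epsilon> n" "\<lambda>s. exp (- \<epsilon> * s) *\<^sub>R coord (evol s) n" t] by simp
  next
    case False
    then have "eventually (\<lambda>s. damped \<epsilon> n s = 0) (nhds t)"
      using eventually_nhds_in_open[of "{..<0}" t] t
      by (auto elim!: eventually_mono simp: damped_def)
    then show ?thesis using isCont_cong[of "damped \<epsilon> n" "\<lambda>_. 0" t] by simp
  qed
qed

text \<open>Provides the square integrability that \<open>plancherel\<close> assumes: the bound
  1/\<epsilon> is used for |E| < K and the distance bound elsewhere. Measurability in E comes from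
  the identification with a Fourier transform.\<close>

lemma integrable_green:
  assumes \<epsilon>: "\<epsilon> > 0" and n: "n \<in> sites L"
  shows "integrable lborel (\<lambda>E. (cmod (coord (green (Complex E \<epsilon>)) n))\<^sup>2)"
proof -
  define C where "C = (9 + 4 * K\<^sup>2) + (1 + K\<^sup>2) / \<epsilon>\<^sup>2"
  have [measurable]: "damped \<epsilon> n \<in> borel_measurable borel" using damped_props(1)[OF assms] by auto
  have "fourier (damped \<epsilon> n) \<in> borel_measurable borel" unfolding fourier_def by measurable
  then have m: "(\<lambda>E. (cmod (fourier (damped \<epsilon> n) E))\<^sup>2) \<in> borel_measurable borel" by measurable
  have eq: "(\<lambda>E. (cmod (fourier (damped \<epsilon> n) E))\<^sup>2) = (\<lambda>E. (cmod (coord (green (Complex E \<epsilon>)) n))\<^sup>2)"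
    by (auto simp: fourier_damped[OF assms] norm_mult)
  show ?thesis
  proof (rule Bochner_Integration.integrable_bound)
    show "integrable lborel (\<lambda>E. C * inverse (1 + E\<^sup>2))"
      using integrable_inverse_1_plus_square' by auto
    show "(\<lambda>E. (cmod (coord (green (Complex E \<epsilon>)) n))\<^sup>2) \<in> borel_measurable lborel"
      using m eq by simp
    have "(cmod (coord (green (Complex E \<epsilon>)) n))\<^sup>2 \<le> C * inverse (1 + E\<^sup>2)" for E
    proof (cases "\<bar>E\<bar> \<ge> K")
      case True
      have "(cmod (coord (green (Complex E \<epsilon>)) n))\<^sup>2 \<le> (1 / (\<bar>E\<bar> - (K - 1)))\<^sup>2"
        using True by (intro power_mono coord_green_bounds(2)[OF \<epsilon>]) auto
      also note inverse_square_le[OF True]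
      also have "(9 + 4 * K\<^sup>2) * inverse (1 + E\<^sup>2) \<le> C * inverse (1 + E\<^sup>2)"
        by (intro mult_right_mono) (auto simp: C_def)
      finally show ?thesis .
    next
      case False
      then have E2: "E\<^sup>2 \<le> K\<^sup>2" using power_mono[of "\<bar>E\<bar>" K 2] by simp
      have "(cmod (coord (green (Complex E \<epsilon>)) n))\<^sup>2 \<le> (1 / \<epsilon>)\<^sup>2"
        by (intro power_mono coord_green_bounds(1)[OF \<epsilon>]) auto
      also have "\<dots> = 1 / \<epsilon>\<^sup>2 * ((1 + E\<^sup>2) * inverse (1 + E\<^sup>2))"
        using add_pos_nonneg[OF zero_less_one zero_le_power2[of E]] by (simp add: power_divide)
      also have "\<dots> \<le> 1 / \<epsilon>\<^sup>2 * ((1 + K\<^sup>2) * inverse (1 + E\<^sup>2))"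
        using E2 by (intro mult_left_mono mult_right_mono) auto
      also have "\<dots> = (1 + K\<^sup>2) / \<epsilon>\<^sup>2 * inverse (1 + E\<^sup>2)" by simp
      also have "\<dots> \<le> C * inverse (1 + E\<^sup>2)"
        by (intro mult_right_mono) (auto simp: C_def)
      finally show ?thesis .
    qed
    then show "AE E in lborel. norm ((cmod (coord (green (Complex E \<epsilon>)) n))\<^sup>2) \<le> norm (C * inverse (1 + E\<^sup>2))"
      by (intro AE_I2) (simp add: order_trans[OF _ abs_ge_self])
  qed
qed

text \<open>Plancherel for \<open>damped\<close> at \<epsilon> = 1/T. The prefactor is (2 / T) / (2
  pi).\<close>

lemma avg_prob_eq:
  assumes T: "T > 0" and n: "n \<in> sites L"
  shows "avg_prob L V n T = 1 / (pi * T) * (LINT E|lborel. (cmod (coord (green (Complex E (1 / T))) n))\<^sup>2)"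
proof -
  define \<epsilon> where "\<epsilon> = 1 / T"
  have \<epsilon>: "\<epsilon> > 0" using T by (simp add: \<epsilon>_def)
  have eq: "(\<lambda>E. (cmod (fourier (damped \<epsilon> n) E))\<^sup>2) = (\<lambda>E. (cmod (coord (green (Complex E \<epsilon>)) n))\<^sup>2)"
    by (auto simp: fourier_damped[OF \<epsilon> n] norm_mult)
  have "(LINT E|lborel. (cmod (coord (green (Complex E \<epsilon>)) n))\<^sup>2)
      = 2 * pi * (LINT t|lborel. (cmod (damped \<epsilon> n t))\<^sup>2)"
    using plancherel[OF damped_props[OF \<epsilon> n]] integrable_green[OF \<epsilon> n] unfolding eq by simp
  also have "(LINT t|lborel. (cmod (damped \<epsilon> n t))\<^sup>2)
      = (LINT t:{0..}|lborel. exp (- 2 * t / T) * (cmod (cinner (evol t) (delta n)))\<^sup>2)"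
    unfolding set_lebesgue_integral_def
  proof (rule integral_cong_AE)
    have m: "(\<lambda>t. coord (evol t) n) \<in> borel_measurable borel"
      by (intro borel_measurable_continuous_onI continuous_at_imp_continuous_on ballI isCont_coord_evol)
    show "(\<lambda>t. (cmod (damped \<epsilon> n t))\<^sup>2) \<in> borel_measurable lborel"
      using damped_props(1)[OF \<epsilon> n] by auto
    show "(\<lambda>t. indicator {0..} t *\<^sub>R (exp (- 2 * t / T) * (cmod (cinner (evol t) (delta n)))\<^sup>2)) \<in> borel_measurable lborel"
      using m by (simp add: cinner_delta)
    have "AE t in lborel. t \<noteq> (0::real)" by (rule AE_lborel_singleton)
    then show "AE t in lborel. (cmod (damped \<epsilon> n t))\<^sup>2
        = indicator {0..} t *\<^sub>R (exp (- 2 * t / T) * (cmod (cinner (evol t) (delta n)))\<^sup>2)"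
    proof (rule AE_mp, intro AE_I2 impI)
      fix t :: real assume "t \<noteq> 0"
      have "(exp (- \<epsilon> * t))\<^sup>2 = exp (- 2 * t / T)"
        by (simp add: \<epsilon>_def flip: exp_of_nat_mult) 
      then show "(cmod (damped \<epsilon> n t))\<^sup>2
        = indicator {0..} t *\<^sub>R (exp (- 2 * t / T) * (cmod (cinner (evol t) (delta n)))\<^sup>2)"
        using \<open>t \<noteq> 0\<close> by (auto simp: damped_def indicator_def cinner_delta power_mult_distrib)
    qed
  qed
  finally show ?thesis
    using T by (simp add: avg_prob_def \<epsilon>_def field_simps)
qed

end

section \<open>Exponential decay of the Green function\<close>

text \<open>For negative x this is 1 - exp (- g) <= exp g - 1, the inequality between arithmetic and
  geometric mean. It controls the quotients of neighbouring weights in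
  \<open>combes_thomas\<close>.\<close>

lemma abs_one_minus_exp_le:
  fixes x g :: real
  assumes "\<bar>x\<bar> \<le> g"
  shows "\<bar>1 - exp x\<bar> \<le> exp g - 1"
proof (cases "x \<ge> 0")
  case True
  then show ?thesis using assms by simp
next
  case False
  have "2 \<le> exp g + exp (- g)"
  proof -
    have "0 \<le> (exp (g / 2) - exp (- g / 2))\<^sup>2" by simp
    also have "\<dots> = exp g + exp (- g) - 2"
      by (simp add: power2_eq_square algebra_simps flip: exp_add)
    finally show ?thesis by simp
  qed
  moreover have "exp (- g) \<le> exp x" "exp x \<le> 1" using assms False by simp_all
  ultimately show ?thesis by linarith
qed

context schroedinger_op
begin

text \<open>Combes--Thomas: conjugate by a bounded exponential weight and absorb the commutator.\<close>

lemma combes_thomas: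
  assumes \<psi>: "\<psi> \<in> S" "H \<psi> - z *\<^sub>C \<psi> = delta 1" and d: "d > 0"
    and lower: "\<And>f. f \<in> S \<Longrightarrow> d * norm f \<le> norm (H f - z *\<^sub>C f)"
    and g: "0 \<le> g" "exp g - 1 \<le> d / 4"
    and F: "finite F" "\<And>n. n \<in> F \<Longrightarrow> N \<le> \<bar>real_of_int n - 1\<bar>" and N: "0 \<le> N"
  shows "(\<Sum>n\<in>F. (cmod (coord \<psi> n))\<^sup>2) \<le> 4 / d\<^sup>2 * exp (- 2 * g * N)"
proof -
  \<comment> \<open>Truncating at \<open>N\<close> keeps the weight bounded, so that the weighted
    function is in ell2 from the outset. The exponent vanishes at the pole, which leaves
    \<open>delta 1\<close> unchanged, and equals \<open>N\<close> on all of
    \<open>F\<close>.\<close>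
  define m where "m n = min \<bar>real_of_int n - 1\<bar> N" for n
  define w where "w n = exp (g * m n)" for n
  have w: "w n > 0" "w n \<le> exp (g * N)" for n using g by (auto simp: w_def m_def intro!: mult_left_mono)
  have bw: "bounded (range (\<lambda>n. complex_of_real (w n)))"
    unfolding bounded_iff using w by (auto intro!: exI[of _ "exp (g * N)"] simp: less_imp_le)
  define \<phi> where "\<phi> = mult_op (\<lambda>n. complex_of_real (w n)) \<psi>"
  have \<phi>: "coord \<phi> n = w n * coord \<psi> n" for n by (simp add: \<phi>_def coord_mult_op[OF bw])
  have \<phi>S: "\<phi> \<in> S" using \<psi>(1) by (simp add: ell2_on_def \<phi>)
  \<comment> \<open>The commutator coefficients: the relative error of pulling the weight through a
    hop from n + k to n.\<close>
  define r where "r k n = (if n \<in> sites L then 1 - complex_of_real (w n / w (n + k)) else 0)" for k n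
  have r: "cmod (r k n) \<le> exp g - 1" if k: "k = 1 \<or> k = -1" for k n
  proof (cases "n \<in> sites L")
    case True
    have "\<bar>m n - m (n + k)\<bar> \<le> 1" using k by (auto simp: m_def min_def)
    then have "\<bar>g * (m n - m (n + k))\<bar> \<le> g" using g mult_left_mono[of "\<bar>m n - m (n + k)\<bar>" 1 g] by (simp add: abs_mult)
    then have "\<bar>1 - exp (g * (m n - m (n + k)))\<bar> \<le> exp g - 1" by (rule abs_one_minus_exp_le)
    moreover have "exp (g * (m n - m (n + k))) = w n / w (n + k)"
      by (simp add: w_def exp_diff right_diff_distrib)
    moreover have "r k n = complex_of_real (1 - w n / w (n + k))" using True by (simp add: r_def)
    ultimately show ?thesis by (simp only: norm_of_real)
  next
    case False
    then show ?thesis using g by (simp add: r_def)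
  qed
  have br: "bounded (range (r k))" if k: "k = 1 \<or> k = -1" for k
    unfolding bounded_iff using r[OF k] by auto
  have eq: "H \<phi> - z *\<^sub>C \<phi> = delta 1 + (mult_op (r 1) (shift_op 1 \<phi>) + mult_op (r (- 1)) (shift_op (- 1) \<phi>))"
  proof (rule ell2_eqI)
    fix n
    show "coord (H \<phi> - z *\<^sub>C \<phi>) n = coord (delta 1 + (mult_op (r 1) (shift_op 1 \<phi>) + mult_op (r (- 1)) (shift_op (- 1) \<phi>))) n"
    proof (cases "n \<in> sites L")
      case True
      have c: "w n * (coord (H \<psi>) n - z * coord \<psi> n) = coord (delta 1) n"
      proof -
        have "coord (H \<psi>) n - z * coord \<psi> n = coord (delta 1) n"
          using arg_cong[OF \<psi>(2), of "\<lambda>f. coord f n"] by simp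
        moreover have "w 1 = 1" using N by (simp add: w_def m_def)
        ultimately show ?thesis by (auto simp: coord_delta)
      qed
      have s: "r k n * coord \<phi> (n + k) = coord \<phi> (n + k) - w n * coord \<psi> (n + k)" for k
      proof -
        have "w (n + k) \<noteq> 0" using w(1)[of "n + k"] by simp
        then show ?thesis using True by (simp add: r_def \<phi> field_simps)
      qed
      show ?thesis
        unfolding coord_simps coord_mult_op[OF br[of 1, simplified]] coord_mult_op[OF br[of "-1", simplified]]
          coord_shift_op s c[symmetric]
        using True by (simp add: coord_H \<phi> algebra_simps)
    next
      case False
      then show ?thesis using \<phi>S one_site
        by (auto simp: coord_mult_op[OF br[of 1, simplified]] coord_mult_op[OF br[of "-1", simplified]] coord_H S_coord r_def coord_delta)
    qed
  qed
  have "d * norm \<phi> \<le> norm (H \<phi> - z *\<^sub>C \<phi>)" by (rule lower[OF \<phi>S])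
  also have "\<dots> \<le> 1 + (norm (mult_op (r 1) (shift_op 1 \<phi>)) + norm (mult_op (r (- 1)) (shift_op (- 1) \<phi>)))"
    unfolding eq by (intro norm_triangle_le add_mono norm_triangle_ineq) simp
  also have "\<dots> \<le> 1 + ((exp g - 1) * norm (shift_op 1 \<phi>) + (exp g - 1) * norm (shift_op (- 1) \<phi>))"
    using g r by (intro add_left_mono add_mono norm_mult_op_le) auto
  also have "\<dots> = 1 + 2 * ((exp g - 1) * norm \<phi>)" by simp
  \<comment> \<open>The commutator costs at most half of the lower bound d |\<phi>| and is absorbed
    on the left.\<close>
  also have "\<dots> \<le> 1 + 2 * (d / 4 * norm \<phi>)"
    using g by (intro add_left_mono mult_left_mono mult_right_mono) auto
  finally have "d * norm \<phi> \<le> 2" by simp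
  then have n\<phi>: "norm \<phi> \<le> 2 / d" using d by (simp add: field_simps)
  have "exp (2 * g * N) * (\<Sum>n\<in>F. (cmod (coord \<psi> n))\<^sup>2) = (\<Sum>n\<in>F. (cmod (coord \<phi> n))\<^sup>2)"
    unfolding sum_distrib_left
  proof (rule sum.cong[OF refl])
    fix n assume "n \<in> F"
    then have "w n = exp (g * N)" using F(2)[of n] by (simp add: w_def m_def min_def)
    then show "exp (2 * g * N) * (cmod (coord \<psi> n))\<^sup>2 = (cmod (coord \<phi> n))\<^sup>2"
      by (simp add: \<phi> norm_mult power_mult_distrib flip: exp_of_nat_mult)
  qed
  also have "\<dots> \<le> (norm \<phi>)\<^sup>2" by (rule norm_ell2_finite_sum[OF F(1)])
  also have "\<dots> \<le> (2 / d)\<^sup>2" by (intro power_mono n\<phi>) auto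
  finally have "exp (2 * g * N) * (\<Sum>n\<in>F. (cmod (coord \<psi> n))\<^sup>2) \<le> 4 / d\<^sup>2" by (simp add: power_divide)
  then have "exp (- (2 * g * N)) * (exp (2 * g * N) * (\<Sum>n\<in>F. (cmod (coord \<psi> n))\<^sup>2)) \<le> exp (- (2 * g * N)) * (4 / d\<^sup>2)"
    by (rule mult_left_mono) simp
  then show ?thesis
    by (simp add: mult.commute flip: mult.assoc exp_add)
qed

lemma green_decay:
  assumes "Im z \<noteq> 0" and d: "d > 0"
    and lower: "\<And>f. f \<in> S \<Longrightarrow> d * norm f \<le> norm (H f - z *\<^sub>C f)"
    and F: "finite F" "\<And>n. n \<in> F \<Longrightarrow> N \<le> \<bar>real_of_int n - 1\<bar>" and N: "0 \<le> N"
  shows "(\<Sum>n\<in>F. (cmod (coord (green z) n))\<^sup>2) \<le> 4 / d\<^sup>2 * exp (- (min 1 d / 4) * N)"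
proof -
  \<comment> \<open>For g <= 1, exp g - 1 <= g + g^2 <= 2 g, which is at most d / 4 because 8 g <=
    d. Squaring the weight doubles the rate to min 1 d / 4.\<close>
  define g where "g = min 1 d / 8"
  have g: "0 \<le> g" "g \<le> 1" "8 * g \<le> d" using d by (auto simp: g_def)
  have "exp g \<le> 1 + g + g\<^sup>2" using g by (intro exp_bound) auto
  also have "g\<^sup>2 \<le> g" using g by (simp add: power2_eq_square mult_left_le)
  finally have "exp g - 1 \<le> d / 4" using g by simp
  from combes_thomas[OF green[OF assms(1)] d lower g(1) this F N]
  have "(\<Sum>n\<in>F. (cmod (coord (green z) n))\<^sup>2) \<le> 4 / d\<^sup>2 * exp (- 2 * g * N)" .
  moreover have "- 2 * g * N = - (min 1 d / 4) * N" by (simp add: g_def)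
  ultimately show ?thesis by (simp only:)
qed

end

section \<open>Transfer matrices\<close>

lemma transfer_step_nth [simp]:
  "transfer_step V m z $ 1 $ 1 = z - complex_of_real (V m)" "transfer_step V m z $ 1 $ 2 = -1"
  "transfer_step V m z $ 2 $ 1 = 1" "transfer_step V m z $ 2 $ 2 = 0"
  by (simp_all add: transfer_step_def vector_2)

lemma det_transfer_step: "det (transfer_step V m z) = 1"
  by (simp add: det_2)

text \<open>One recursion for all integers: to the left of 0 the new factor cancels the inverse
  introduced last. Beyond this, only the value at n = 0 is taken from the definition.\<close>

lemma transfer_Suc: "transfer V (n + 1) z = transfer_step V (n + 1) z ** transfer V n z"
proof (cases "n \<ge> 0")
  case True
  then obtain k where "n = int k" by (metis nonneg_eq_int)
  then show ?thesis by (simp add: transfer_def nat_add_distrib add.commute)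
next
  case False
  define k where "k = nat (- (n + 1))"
  have n: "n = - int (Suc k)" using False by (simp add: k_def)
  have inv: "transfer_step V (- int k) z ** matrix_inv (transfer_step V (- int k) z) = mat 1"
  proof -
    have "invertible (transfer_step V (- int k) z)"
      by (simp add: invertible_det_nz det_transfer_step)
    then show ?thesis unfolding invertible_def matrix_inv_def by (rule someI2_ex) simp
  qed
  have "transfer V n z = matrix_inv (transfer_step V (- int k) z) ** transfer_bwd V k z"
    by (simp add: n transfer_def nat_add_distrib)
  moreover have "transfer V (n + 1) z = transfer_bwd V k z"
    by (cases k) (simp_all add: n transfer_def nat_add_distrib)
  moreover have "n + 1 = - int k" by (simp add: n)
  ultimately show ?thesis by (simp add: matrix_mul_assoc inv matrix_mul_lid)
qed

lemma det_transfer: "det (transfer V n z) = 1"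
proof (induction n rule: int_induct[where k = 0])
  case base
  then show ?case by (simp add: transfer_def det_I)
next
  case (step1 i)
  then show ?case by (simp add: transfer_Suc det_mul det_transfer_step)
next
  case (step2 i)
  then show ?case using transfer_Suc[of V "i - 1" z] by (simp add: det_mul det_transfer_step)
qed

text \<open>The solution of the eigenvalue equation on all integers with value \<open>x1\<close> at
  site 1 and \<open>x0\<close> at site 0. The propagated vector carries the value at n + 1 in its
  first component and the value at n in its second.\<close>

definition solution :: "(int \<Rightarrow> real) \<Rightarrow> complex \<Rightarrow> complex \<Rightarrow> complex \<Rightarrow> int \<Rightarrow> complex"
  where "solution V z x1 x0 n = (transfer V n z *v vector [x1, x0]) $ 2"

lemma matrix_vector_mult_nth_2:
  fixes M :: "complex^2^2"
  shows "(M *v v) $ i = M $ i $ 1 * v $ 1 + M $ i $ 2 * v $ 2"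
  by (simp add: matrix_vector_mult_def UNIV_2)

lemma transfer_solution:
  shows "(transfer V n z *v vector [x1, x0]) $ 1 = solution V z x1 x0 (n + 1)"
    and "(transfer V n z *v vector [x1, x0]) $ 2 = solution V z x1 x0 n"
  by (simp_all add: solution_def transfer_Suc matrix_vector_mult_nth_2[of "transfer_step _ _ _"]
      flip: matrix_vector_mul_assoc)

lemma solution_init: "solution V z x1 x0 0 = x0" "solution V z x1 x0 1 = x1"
proof -
  show "solution V z x1 x0 0 = x0" by (simp add: solution_def transfer_def vector_2)
  show "solution V z x1 x0 1 = x1"
    using transfer_solution(1)[of V 0 z x1 x0] by (simp add: transfer_def vector_2)
qed

lemma solution_rec:
  "solution V z x1 x0 (n + 1) = (z - complex_of_real (V n)) * solution V z x1 x0 n - solution V z x1 x0 (n - 1)"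
proof -
  have "transfer V n z = transfer_step V n z ** transfer V (n - 1) z"
    using transfer_Suc[of V "n - 1" z] by simp
  then have "(transfer V n z *v vector [x1, x0]) $ 1
      = (transfer_step V n z *v (transfer V (n - 1) z *v vector [x1, x0])) $ 1"
    by (simp add: matrix_vector_mul_assoc)
  then show ?thesis
    unfolding transfer_solution
    by (simp add: matrix_vector_mult_nth_2[of "transfer_step _ _ _"] transfer_solution)
qed

lemma wronskian:
  "solution V z x1 x0 (n + 1) * solution V z y1 y0 n - solution V z x1 x0 n * solution V z y1 y0 (n + 1)
    = x1 * y0 - x0 * y1"
proof (induction n rule: int_induct[where k = 0])
  case base
  then show ?case by (simp add: solution_init)
next
  case (step1 i)
  have r: "solution V z u v (i + 1 + 1) = (z - complex_of_real (V (i + 1))) * solution V z u v (i + 1) - solution V z u v i" for u v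
    using solution_rec[of V z u v "i + 1"] by simp
  show ?case unfolding r step1(2)[symmetric] by (simp add: algebra_simps)
next
  case (step2 i)
  show ?case unfolding step2(2)[symmetric] solution_rec[of V z _ _ i] by (simp add: algebra_simps)
qed

section \<open>The operator norm of a transfer matrix against the values of solutions\<close>

lemma opnorm_entry: "cmod (M $ i $ j) \<le> opnorm M"
proof -
  have "cmod (M $ i $ j) = cmod ((M *v axis j 1) $ i)"
    using exhaust_2[of j] by (auto simp: matrix_vector_mult_nth_2 axis_def)
  also have "\<dots> \<le> norm (M *v axis j 1)" by (rule Finite_Cartesian_Product.norm_nth_le)
  also have "\<dots> \<le> opnorm M * norm (axis j (1::complex))"
    unfolding opnorm_def by (rule onorm) simp
  finally show ?thesis by (simp add: norm_axis_1)
qed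

lemma opnorm_le_entries:
  fixes M :: "complex^2^2"
  shows "opnorm M \<le> cmod (M $ 1 $ 1) + cmod (M $ 1 $ 2) + cmod (M $ 2 $ 1) + cmod (M $ 2 $ 2)"
  unfolding opnorm_def
proof (rule onorm_le)
  fix v :: "complex^2"
  have v: "cmod (v $ i) \<le> norm v" for i by (rule Finite_Cartesian_Product.norm_nth_le)
  have "norm (M *v v) \<le> (\<Sum>i\<in>UNIV. cmod ((M *v v) $ i))"
    unfolding norm_vec_def by (rule L2_set_le_sum) auto
  also have "\<dots> = cmod ((M *v v) $ 1) + cmod ((M *v v) $ 2)" by (simp add: UNIV_2)
  also have "\<dots> \<le> (cmod (M $ 1 $ 1) * norm v + cmod (M $ 1 $ 2) * norm v)
      + (cmod (M $ 2 $ 1) * norm v + cmod (M $ 2 $ 2) * norm v)"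
    unfolding matrix_vector_mult_nth_2
    by (intro add_mono norm_triangle_le) (auto simp: norm_mult intro!: add_mono mult_left_mono v)
  finally show "norm (M *v v) \<le> (cmod (M $ 1 $ 1) + cmod (M $ 1 $ 2) + cmod (M $ 2 $ 1) + cmod (M $ 2 $ 2)) * norm v"
    by (simp add: algebra_simps)
qed

text \<open>Determinant 1 makes the inverse the adjugate, which has the same entries up to sign and
  position. The norm of the matrix itself therefore bounds the way back to the initial data.\<close>

lemma solution_initial_le:
  "cmod x1 \<le> opnorm (transfer V n z) * (cmod (solution V z x1 x0 (n + 1)) + cmod (solution V z x1 x0 n))"
proof -
  define M where "M = transfer V n z"
  have det: "M $ 1 $ 1 * M $ 2 $ 2 - M $ 1 $ 2 * M $ 2 $ 1 = 1"
    using det_transfer[of V n z] by (simp add: det_2 M_def)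
  have s: "solution V z x1 x0 (n + 1) = M $ 1 $ 1 * x1 + M $ 1 $ 2 * x0"
      "solution V z x1 x0 n = M $ 2 $ 1 * x1 + M $ 2 $ 2 * x0"
    using transfer_solution[of V n z x1 x0] by (simp_all add: M_def matrix_vector_mult_nth_2 vector_2)
  have "M $ 2 $ 2 * solution V z x1 x0 (n + 1) - M $ 1 $ 2 * solution V z x1 x0 n
    = (M $ 1 $ 1 * M $ 2 $ 2 - M $ 1 $ 2 * M $ 2 $ 1) * x1"
    unfolding s by (simp add: algebra_simps)
  then have "x1 = M $ 2 $ 2 * solution V z x1 x0 (n + 1) - M $ 1 $ 2 * solution V z x1 x0 n"
    by (simp add: det)
  then have "cmod x1 \<le> cmod (M $ 2 $ 2) * cmod (solution V z x1 x0 (n + 1)) + cmod (M $ 1 $ 2) * cmod (solution V z x1 x0 n)"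
    by (metis norm_mult norm_triangle_ineq4)
  also have "\<dots> \<le> opnorm M * cmod (solution V z x1 x0 (n + 1)) + opnorm M * cmod (solution V z x1 x0 n)"
    by (intro add_mono mult_right_mono opnorm_entry) auto
  finally show ?thesis by (simp add: M_def algebra_simps)
qed

text \<open>Two solutions with nonzero Wronskian determine the transfer matrix by Cramer's rule.\<close>

lemma opnorm_transfer_le:
  assumes W: "w = x1 * y0 - x0 * y1" "w \<noteq> 0"
    and b: "cmod x1 \<le> B" "cmod x0 \<le> B" "cmod y1 \<le> B" "cmod y0 \<le> B"
  shows "opnorm (transfer V n z) \<le> 2 * B / cmod w *
    (cmod (solution V z x1 x0 (n + 1)) + cmod (solution V z x1 x0 n)
     + cmod (solution V z y1 y0 (n + 1)) + cmod (solution V z y1 y0 n))"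
proof -
  define M where "M = transfer V n z"
  define p q where "p i = (if i = (1::2) then solution V z x1 x0 (n + 1) else solution V z x1 x0 n)"
    and "q i = (if i = (1::2) then solution V z y1 y0 (n + 1) else solution V z y1 y0 n)" for i
  have p: "p i = M $ i $ 1 * x1 + M $ i $ 2 * x0" and q: "q i = M $ i $ 1 * y1 + M $ i $ 2 * y0" for i
    using exhaust_2[of i] transfer_solution[of V n z x1 x0] transfer_solution[of V n z y1 y0]
    by (auto simp: p_def q_def M_def vector_2 matrix_vector_mult_nth_2)
  have "M $ i $ 1 * w = y0 * p i - x0 * q i" "M $ i $ 2 * w = x1 * q i - y1 * p i" for i
    by (simp_all add: p q W(1) algebra_simps)
  then have e: "cmod (M $ i $ 1) * cmod w \<le> B * (cmod (p i) + cmod (q i))"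
     "cmod (M $ i $ 2) * cmod w \<le> B * (cmod (p i) + cmod (q i))" for i
  proof -
    assume a: "\<And>i. M $ i $ 1 * w = y0 * p i - x0 * q i" "\<And>i. M $ i $ 2 * w = x1 * q i - y1 * p i"
    have "cmod (M $ i $ 1) * cmod w = cmod (y0 * p i - x0 * q i)" by (simp flip: norm_mult a)
    also have "\<dots> \<le> cmod y0 * cmod (p i) + cmod x0 * cmod (q i)"
      by (metis norm_mult norm_triangle_ineq4)
    also have "\<dots> \<le> B * cmod (p i) + B * cmod (q i)" by (intro add_mono mult_right_mono b) auto
    finally show "cmod (M $ i $ 1) * cmod w \<le> B * (cmod (p i) + cmod (q i))" by (simp add: algebra_simps)
    have "cmod (M $ i $ 2) * cmod w = cmod (x1 * q i - y1 * p i)" by (simp flip: norm_mult a)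
    also have "\<dots> \<le> cmod x1 * cmod (q i) + cmod y1 * cmod (p i)"
      by (metis norm_mult norm_triangle_ineq4)
    also have "\<dots> \<le> B * cmod (q i) + B * cmod (p i)" by (intro add_mono mult_right_mono b) auto
    finally show "cmod (M $ i $ 2) * cmod w \<le> B * (cmod (p i) + cmod (q i))" by (simp add: algebra_simps)
  qed
  have "opnorm M * cmod w \<le> (cmod (M $ 1 $ 1) + cmod (M $ 1 $ 2) + cmod (M $ 2 $ 1) + cmod (M $ 2 $ 2)) * cmod w"
    by (intro mult_right_mono opnorm_le_entries) auto
  also have "\<dots> \<le> 2 * B * (cmod (p 1) + cmod (p 2) + cmod (q 1) + cmod (q 2))"
    using e[of 1] e[of 2] by (simp add: algebra_simps)
  finally show ?thesis using W(2) by (simp add: M_def p_def q_def field_simps)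
qed

section \<open>The Green function and the transfer matrices\<close>

text \<open>Meant for products of the two solutions, which are comparable to the Green function only
  outside a finite window around the pole.\<close>

lemma sq_summable_if_dominated:
  fixes f :: "int \<Rightarrow> complex" and \<psi> :: "int ell2"
  assumes "\<And>k. \<bar>k\<bar> > M \<Longrightarrow> cmod (f k) \<le> C * cmod (coord \<psi> k)"
  shows "(\<lambda>k. (cmod (f k))\<^sup>2) summable_on UNIV"
proof (rule summable_on_comparison_test)
  have "(\<lambda>k. if \<bar>k\<bar> \<le> M then (cmod (f k))\<^sup>2 else 0) summable_on {-M..M}"
    by (rule summable_on_finite) auto
  then have "(\<lambda>k. if \<bar>k\<bar> \<le> M then (cmod (f k))\<^sup>2 else 0) summable_on UNIV"
    by (rule summable_on_cong_neutral[THEN iffD1, rotated -1]) auto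
  then show "(\<lambda>k. C\<^sup>2 * (cmod (coord \<psi> k))\<^sup>2 + (if \<bar>k\<bar> \<le> M then (cmod (f k))\<^sup>2 else 0)) summable_on UNIV"
    by (intro summable_on_add summable_on_cmult_right coord_summable)
  show "(cmod (f k))\<^sup>2 \<le> C\<^sup>2 * (cmod (coord \<psi> k))\<^sup>2 + (if \<bar>k\<bar> \<le> M then (cmod (f k))\<^sup>2 else 0)" for k
    using power_mono[OF assms[of k], of 2] by (auto simp: power_mult_distrib)
qed auto

context schroedinger_op
begin

text \<open>
  The two solutions of the eigenvalue equation that agree with the Green function to the right and
  to the left of its pole 1.
\<close>

definition sol_right :: "complex \<Rightarrow> int \<Rightarrow> complex"
  where "sol_right z = solution V z (coord (green z) 1) (coord (green z) 0 - 1)"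

definition sol_left :: "complex \<Rightarrow> int \<Rightarrow> complex"
  where "sol_left z = solution V z (coord (green z) 1) (coord (green z) 0)"

lemma coord_green_rec:
  assumes "Im z \<noteq> 0" "n \<in> sites L"
  shows "coord (green z) (n + 1) + coord (green z) (n - 1) + V n * coord (green z) n - z * coord (green z) n
    = (if n = 1 then 1 else 0)"
  using arg_cong[OF green(2)[OF assms(1)], of "\<lambda>f. coord f n"] assms(2) by (simp add: coord_H coord_delta)

text \<open>The source term 1 in the equation at site 1 is compensated by lowering the value at site
  0 by 1. Further to the right the equation is homogeneous.\<close>

lemma sol_right_eq:
  assumes z: "Im z \<noteq> 0" and n: "n \<ge> 1"
  shows "sol_right z n = coord (green z) n"
proof -
  have s: "k \<ge> 1 \<Longrightarrow> k \<in> sites L" for k by (cases L) auto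
  have "sol_right z n = coord (green z) n \<and> sol_right z (n + 1) = coord (green z) (n + 1)"
    using n
  proof (induction n rule: int_ge_induct)
    case base
    have "coord (green z) 2 + coord (green z) 0 + V 1 * coord (green z) 1 - z * coord (green z) 1 = 1"
      using coord_green_rec[OF z one_site] by simp
    moreover have "sol_right z 2 = (z - V 1) * coord (green z) 1 - (coord (green z) 0 - 1)"
      using solution_rec[of V z "coord (green z) 1" "coord (green z) 0 - 1" 1]
      by (simp add: sol_right_def solution_init)
    ultimately have "sol_right z 2 = coord (green z) 2" by algebra
    then show ?case by (simp add: sol_right_def solution_init)
  next
    case (step i)
    have "coord (green z) (i + 2) + coord (green z) i + V (i + 1) * coord (green z) (i + 1) - z * coord (green z) (i + 1) = 0"
      using coord_green_rec[OF z s[of "i + 1"]] step(1) by (simp add: ac_simps)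
    moreover have "sol_right z (i + 2) = (z - V (i + 1)) * sol_right z (i + 1) - sol_right z i"
      using solution_rec[of V z _ _ "i + 1"] by (simp add: sol_right_def ac_simps)
    moreover have "sol_right z i = coord (green z) i" "sol_right z (i + 1) = coord (green z) (i + 1)"
      using step by auto
    ultimately have "sol_right z (i + 2) = coord (green z) (i + 2)" by algebra
    then show ?case using step by (simp add: ac_simps)
  qed
  then show ?thesis by simp
qed

lemma sol_left_eq:
  assumes z: "Im z \<noteq> 0" and n: "n \<le> 1" "n \<in> insert 0 (sites L)"
  shows "sol_left z n = coord (green z) n"
proof (cases L)
  case Half_line
  then have "n = 0 \<or> n = 1" using n by auto
  then show ?thesis by (auto simp: sol_left_def solution_init)
next
  case Whole_line
  have "sol_left z n = coord (green z) n \<and> sol_left z (n - 1) = coord (green z) (n - 1)"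
    using n(1)
  proof (induction n rule: int_le_induct)
    case base
    show ?case by (simp add: sol_left_def solution_init)
  next
    case (step i)
    have "coord (green z) i + coord (green z) (i - 2) + V (i - 1) * coord (green z) (i - 1) - z * coord (green z) (i - 1) = 0"
      using coord_green_rec[OF z, of "i - 1"] step(1) Whole_line by (simp add: algebra_simps)
    moreover have "sol_left z i = (z - V (i - 1)) * sol_left z (i - 1) - sol_left z (i - 2)"
      using solution_rec[of V z _ _ "i - 1"] by (simp add: sol_left_def algebra_simps)
    moreover have "sol_left z i = coord (green z) i" "sol_left z (i - 1) = coord (green z) (i - 1)"
      using step by auto
    ultimately have "sol_left z (i - 2) = coord (green z) (i - 2)" by algebra
    then show ?case using step by simp
  qed
  then show ?thesis by simp
qed

lemma sol_wronskian:
  "sol_right z (n + 1) * sol_left z n - sol_right z n * sol_left z (n + 1) = coord (green z) 1"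
  unfolding sol_right_def sol_left_def wronskian by (simp add: algebra_simps)

text \<open>Pair (H - z) \<psi> = delta_1 with \<open>\<i> *\<^sub>C green z\<close>. Since the
  coordinate at 1 is also the Wronskian of \<open>sol_right\<close> and \<open>sol_left\<close>,
  this keeps the Wronskian away from 0.\<close>

lemma Im_coord_green:
  assumes "Im z \<noteq> 0"
  shows "Im (coord (green z) 1) = Im z * (norm (green z))\<^sup>2"
proof -
  have "- Im z * (norm (green z))\<^sup>2 = inner (\<i> *\<^sub>C green z) (delta 1)"
    using inner_shifted_i[OF green(1)[OF assms], of z] green(2)[OF assms] by (simp add: inner_commute)
  also have "\<dots> = Re (cinner (\<i> *\<^sub>C green z) (delta 1))" by (simp add: cinner_eq)
  also have "\<dots> = - Im (coord (green z) 1)" by (simp add: cinner_delta)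
  finally show ?thesis by simp
qed

lemma norm_green_le:
  assumes "Im z > 0"
  shows "norm (green z) \<le> 1 / Im z"
  using norm_shifted_ge_Im[OF green(1), of z z] green(2)[of z] assms by (simp add: field_simps)

text \<open>The norm of (H - z) \<psi> is 1, while \<open>H\<close> is bounded and z ranges over a
  bounded set.\<close>

lemma norm_green_ge:
  obtains \<kappa> where "0 < \<kappa>" "\<And>z. Im z \<in> {0<..1} \<Longrightarrow> \<bar>Re z\<bar> \<le> K \<Longrightarrow> \<kappa> \<le> norm (green z)"
proof -
  obtain M where M: "0 \<le> M" "\<And>f. norm (H f) \<le> norm f * M" using H.nonneg_bounded by blast
  define \<kappa> where "\<kappa> = 1 / (M + K + 1)"
  have pos: "M + K + 1 > 0" using M K_ge by simp
  have "\<kappa> \<le> norm (green z)" if z: "Im z \<in> {0<..1}" "\<bar>Re z\<bar> \<le> K" for z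
  proof -
    have "1 = norm (H (green z) - z *\<^sub>C green z)" using green(2)[of z] z by simp
    also have "\<dots> \<le> norm (H (green z)) + norm (z *\<^sub>C green z)" by (rule norm_triangle_ineq4)
    also have "\<dots> \<le> norm (green z) * M + cmod z * norm (green z)" using M by simp
    also have "cmod z \<le> K + 1" using cmod_le[of z] z by simp
    then have "norm (green z) * M + cmod z * norm (green z) \<le> norm (green z) * M + (K + 1) * norm (green z)"
      by (intro add_left_mono mult_right_mono) auto
    finally show ?thesis using pos by (simp add: \<kappa>_def field_simps)
  qed
  then show ?thesis using that[of \<kappa>] pos by (simp add: \<kappa>_def)
qed

text \<open>
  The Green function with pole \<open>m\<close>, multiplied by the Wronskian, is the product of the
  two solutions.
\<close>

lemma green_product:
  assumes z: "Im z > 0" and m: "m \<in> sites L" and F: "finite F" "F \<subseteq> sites L"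
  shows "(\<Sum>k\<in>F. (cmod (if k \<le> m then sol_left z k * sol_right z m else sol_right z k * sol_left z m))\<^sup>2)
    \<le> 1 / Im z ^ 4"
proof -
  have z0: "Im z \<noteq> 0" using z by simp
  define a b where "a = sol_right z" and "b = sol_left z"
  define h where "h k = (if k \<in> sites L then (if k \<le> m then b k * a m else a k * b m) else 0)" for k
  have ss: "(\<lambda>k. (cmod (h k))\<^sup>2) summable_on UNIV"
  proof (rule sq_summable_if_dominated)
    fix k assume k: "\<bar>k\<bar> > \<bar>m\<bar> + 1"
    show "cmod (h k) \<le> (cmod (a m) + cmod (b m)) * cmod (coord (green z) k)"
    proof (cases "k \<in> sites L")
      case True
      show ?thesis
      proof (cases "k \<le> m")
        case le: True
        then have "k \<le> 1" using k by simp
        then have "b k = coord (green z) k" using sol_left_eq[OF z0, of k] True by (simp add: b_def)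
        then show ?thesis using True le by (auto simp: h_def norm_mult mult.commute[of _ "cmod (a m)"] intro!: mult_right_mono)
      next
        case False
        then have "a k = coord (green z) k" using sol_right_eq[OF z0, of k] k by (simp add: a_def)
        then show ?thesis using True False by (auto simp: h_def norm_mult mult.commute[of _ "cmod (b m)"] intro!: mult_right_mono)
      qed
    qed (simp add: h_def)
  qed
  define g where "g = Abs_ell2 h"
  have g: "coord g k = h k" for k unfolding g_def by (subst Abs_ell2_inverse) (use ss in auto)
  have gS: "g \<in> S" by (simp add: ell2_on_def g h_def)
  have ra: "a (k + 1) = (z - V k) * a k - a (k - 1)" for k
    unfolding a_def sol_right_def by (rule solution_rec)
  have rb: "b (k + 1) = (z - V k) * b k - b (k - 1)" for k
    unfolding b_def sol_left_def by (rule solution_rec)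
  \<comment> \<open>The recursion at a site k < m refers to k - 1, which on the half-line may be the
    site 0. There \<open>h\<close> vanishes by definition and the left solution by the Dirichlet
    condition, so the product formula persists.\<close>
  have hb: "h k = b k * a m" if "k \<le> m" "k \<in> sites L \<or> k + 1 \<in> sites L" for k
  proof (cases "k \<in> sites L")
    case False
    then have "L = Half_line" "k = 0" using that by (cases L; auto)+
    then have "coord (green z) k = 0" using S_coord[OF green(1)[OF z0] False] by simp
    moreover have "b 0 = coord (green z) 0" by (simp add: b_def sol_left_def solution_init)
    ultimately have "b k = 0" using \<open>k = 0\<close> by simp
    then show ?thesis using False by (simp add: h_def)
  qed (use that in \<open>simp add: h_def\<close>)
  have ha: "h k = a k * b m" if "k \<ge> m" for k
  proof -
    have "k \<in> sites L" using that m by (cases L) auto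
    then show ?thesis using that by (auto simp: h_def)
  qed
  have "H g - z *\<^sub>C g = coord (green z) 1 *\<^sub>C delta m"
  proof (rule ell2_eqI)
    fix k
    have "coord (H g - z *\<^sub>C g) k = (if k = m then coord (green z) 1 else 0)"
    proof (cases "k \<in> sites L")
      case True
      have H: "coord (H g - z *\<^sub>C g) k = h (k + 1) + h (k - 1) + V k * h k - z * h k"
        using True by (simp add: coord_H g)
      consider "k < m" | "k = m" | "k > m" by linarith
      then show ?thesis
      proof cases
        case 1
        then have "h (k + 1) = b (k + 1) * a m" "h (k - 1) = b (k - 1) * a m" "h k = b k * a m"
          using True by (auto intro!: hb) (cases L; simp)
        then have "coord (H g - z *\<^sub>C g) k = (b (k + 1) - ((z - V k) * b k - b (k - 1))) * a m"
          unfolding H by (simp only:) (simp add: algebra_simps)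
        then show ?thesis using 1 by (simp add: rb[of k])
      next
        \<comment> \<open>Only at the pole do the two branches meet, and the mismatch is exactly
          their Wronskian.\<close>
        case 2
        then have "h (k + 1) = a (k + 1) * b m" "h (k - 1) = b (k - 1) * a m" "h k = b k * a m"
          using True by (auto intro!: hb ha)
        then have "coord (H g - z *\<^sub>C g) k = a (m + 1) * b m - a m * b (m + 1)"
          unfolding H rb[of m] using 2 by (simp add: algebra_simps)
        then show ?thesis using 2 sol_wronskian[of z m] by (simp add: a_def b_def)
      next
        case 3
        then have "h (k + 1) = a (k + 1) * b m" "h (k - 1) = a (k - 1) * b m" "h k = a k * b m"
          by (auto intro!: ha)
        then have "coord (H g - z *\<^sub>C g) k = (a (k + 1) - ((z - V k) * a k - a (k - 1))) * b m"
          unfolding H by (simp only:) (simp add: algebra_simps)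
        then show ?thesis using 3 by (simp add: ra[of k])
      qed
    next
      case False
      then show ?thesis using m by (auto simp: coord_H g h_def)
    qed
    then show "coord (H g - z *\<^sub>C g) k = coord (coord (green z) 1 *\<^sub>C delta m) k"
      by (simp add: coord_delta)
  qed
  \<comment> \<open>One factor 1 / Im z comes from the resolvent with pole \<open>m\<close>, the
    other from the bound on the Wronskian.\<close>
  then have "Im z * norm g \<le> cmod (coord (green z) 1)"
    using norm_shifted_ge_Im[OF gS, of z] z by simp
  also have "\<dots> \<le> 1 / Im z" using cmod_coord_le norm_green_le[OF z] by (rule order_trans)
  finally have "norm g \<le> 1 / (Im z)\<^sup>2" using z by (simp add: field_simps power2_eq_square)
  then have "(norm g)\<^sup>2 \<le> (1 / (Im z)\<^sup>2)\<^sup>2" by (intro power_mono) auto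
  moreover have "(\<Sum>k\<in>F. (cmod (coord g k))\<^sup>2) \<le> (norm g)\<^sup>2" by (rule norm_ell2_finite_sum[OF F(1)])
  moreover have "(\<Sum>k\<in>F. (cmod (coord g k))\<^sup>2)
    = (\<Sum>k\<in>F. (cmod (if k \<le> m then sol_left z k * sol_right z m else sol_right z k * sol_left z m))\<^sup>2)"
    by (rule sum.cong) (use F(2) in \<open>auto simp: g h_def a_def b_def\<close>)
  ultimately show ?thesis by (simp add: power_divide flip: power_mult)
qed

text \<open>To the right of \<open>m\<close> the product of \<open>green_product\<close> splits into
  a tail of one solution and a single value of the other; at k = m both branches give the same
  product.\<close>

lemma sol_right_tail:
  assumes z: "Im z > 0" and m: "m \<in> sites L" and F: "finite F" "F \<subseteq> {m..}"
  shows "(\<Sum>k\<in>F. (cmod (sol_right z k))\<^sup>2) * (cmod (sol_left z m))\<^sup>2 \<le> 1 / Im z ^ 4"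
proof -
  have "F \<subseteq> sites L" using F(2) m by (cases L) auto
  from green_product[OF z m F(1) this]
  have "(\<Sum>k\<in>F. (cmod (if k \<le> m then sol_left z k * sol_right z m else sol_right z k * sol_left z m))\<^sup>2)
    \<le> 1 / Im z ^ 4" .
  also have "(\<Sum>k\<in>F. (cmod (if k \<le> m then sol_left z k * sol_right z m else sol_right z k * sol_left z m))\<^sup>2)
    = (\<Sum>k\<in>F. (cmod (sol_right z k))\<^sup>2 * (cmod (sol_left z m))\<^sup>2)"
    by (rule sum.cong) (use F(2) in \<open>force simp: norm_mult power_mult_distrib\<close>)+
  finally show ?thesis by (simp add: sum_distrib_right)
qed

lemma sol_left_tail:
  assumes z: "Im z > 0" and m: "m \<in> sites L" and F: "finite F" "F \<subseteq> sites L \<inter> {..m}"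
  shows "(\<Sum>k\<in>F. (cmod (sol_left z k))\<^sup>2) * (cmod (sol_right z m))\<^sup>2 \<le> 1 / Im z ^ 4"
proof -
  have "F \<subseteq> sites L" using F(2) by auto
  from green_product[OF z m F(1) this]
  have "(\<Sum>k\<in>F. (cmod (if k \<le> m then sol_left z k * sol_right z m else sol_right z k * sol_left z m))\<^sup>2)
    \<le> 1 / Im z ^ 4" .
  also have "(\<Sum>k\<in>F. (cmod (if k \<le> m then sol_left z k * sol_right z m else sol_right z k * sol_left z m))\<^sup>2)
    = (\<Sum>k\<in>F. (cmod (sol_left z k))\<^sup>2 * (cmod (sol_right z m))\<^sup>2)"
    by (rule sum.cong) (use F(2) in \<open>force simp: norm_mult power_mult_distrib\<close>)+
  finally show ?thesis by (simp add: sum_distrib_right)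
qed

end

section \<open>Upper and lower bounds of the Green function by the transfer matrix\<close>

context schroedinger_op
begin

text \<open>\<open>Q\<close> stands for a tail sum that is small against all four values entering
  Cramer's rule. Initial data of size 2/\<epsilon> and a Wronskian of size at least \<kappa>^2
  \<epsilon> give a factor 4 / (\<kappa>^2 \<epsilon>^2); after squaring, this and the hypotheses
  contribute \<epsilon>^-4 each, and 1280 = 16 * 4 * 20.\<close>

lemma opnorm_transfer_tail_bound:
  assumes z: "Im z \<in> {0<..1}" and k: "\<kappa> \<le> norm (green z)" "0 < \<kappa>" and Q: "0 \<le> Q"
    and Qa: "Q * (cmod (sol_right z n))\<^sup>2 \<le> 5 / Im z ^ 4" "Q * (cmod (sol_right z (n + 1)))\<^sup>2 \<le> 5 / Im z ^ 4"
    and Qb: "Q * (cmod (sol_left z n))\<^sup>2 \<le> 5 / Im z ^ 4" "Q * (cmod (sol_left z (n + 1)))\<^sup>2 \<le> 5 / Im z ^ 4"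
  shows "Q * (opnorm (transfer V n z))\<^sup>2 \<le> (1280 / \<kappa> ^ 4) / Im z ^ 8"
proof -
  define e where "e = 1 / Im z"
  have e: "e \<ge> 1" "Im z = 1 / e" using z by (auto simp: e_def field_simps)
  define w where "w = coord (green z) 1"
  have "\<kappa>\<^sup>2 / e \<le> cmod w"
  proof -
    have "\<kappa>\<^sup>2 / e \<le> Im z * (norm (green z))\<^sup>2"
      using k e z by (auto simp: e(2) intro!: divide_right_mono power_mono)
    also have "\<dots> = Im w" using Im_coord_green[of z] z by (simp add: w_def)
    also have "\<dots> \<le> cmod w" using abs_Im_le_cmod[of w] by simp
    finally show ?thesis .
  qed
  moreover have "\<kappa>\<^sup>2 / e > 0" using k e by simp
  ultimately have w: "\<kappa>\<^sup>2 / e \<le> cmod w" "0 < cmod w" by linarith+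
  have cg: "cmod (coord (green z) j) \<le> e" for j
    using order_trans[OF cmod_coord_le norm_green_le[of z]] z by (simp add: e_def)
  have cg2: "cmod (coord (green z) j) \<le> 2 * e" for j using cg[of j] e by simp
  have cg3: "cmod (coord (green z) 0 - 1) \<le> 2 * e"
    using norm_triangle_ineq4[of "coord (green z) 0" 1] cg[of 0] e by simp
  define s1 s2 s3 s4 where s: "s1 = cmod (sol_right z (n + 1))" "s2 = cmod (sol_right z n)"
    "s3 = cmod (sol_left z (n + 1))" "s4 = cmod (sol_left z n)"
  have "opnorm (transfer V n z) \<le> 2 * (2 * e) / cmod w * (s1 + s2 + s3 + s4)"
    unfolding s sol_right_def sol_left_def
    by (rule opnorm_transfer_le) (use cg2 cg3 w(2) in \<open>auto simp: w_def algebra_simps\<close>)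
  also have "\<dots> \<le> 2 * (2 * e) / (\<kappa>\<^sup>2 / e) * (s1 + s2 + s3 + s4)"
    using w e k by (intro mult_right_mono divide_left_mono) (auto simp: s)
  also have "\<dots> = 4 * e\<^sup>2 / \<kappa>\<^sup>2 * (s1 + s2 + s3 + s4)" by (simp add: power2_eq_square)
  finally have "opnorm (transfer V n z) \<le> 4 * e\<^sup>2 / \<kappa>\<^sup>2 * (s1 + s2 + s3 + s4)" .
  moreover have "0 \<le> opnorm (transfer V n z)"
    using opnorm_entry[of "transfer V n z" 1 1] norm_ge_zero order_trans by blast
  ultimately have "(opnorm (transfer V n z))\<^sup>2 \<le> (4 * e\<^sup>2 / \<kappa>\<^sup>2 * (s1 + s2 + s3 + s4))\<^sup>2"
    by (intro power_mono)
  also have "\<dots> = 16 * e ^ 4 / \<kappa> ^ 4 * (s1 + s2 + s3 + s4)\<^sup>2"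
    by (simp add: power_mult_distrib power_divide flip: power_mult)
  also have "\<dots> \<le> 16 * e ^ 4 / \<kappa> ^ 4 * (4 * (s1\<^sup>2 + s2\<^sup>2 + s3\<^sup>2 + s4\<^sup>2))"
  proof (rule mult_left_mono)
    have "0 \<le> (s1 - s2)\<^sup>2 + (s1 - s3)\<^sup>2 + (s1 - s4)\<^sup>2 + (s2 - s3)\<^sup>2 + (s2 - s4)\<^sup>2 + (s3 - s4)\<^sup>2" by simp
    then show "(s1 + s2 + s3 + s4)\<^sup>2 \<le> 4 * (s1\<^sup>2 + s2\<^sup>2 + s3\<^sup>2 + s4\<^sup>2)"
      by (simp add: power2_eq_square algebra_simps)
  qed auto
  finally have "Q * (opnorm (transfer V n z))\<^sup>2 \<le> Q * (16 * e ^ 4 / \<kappa> ^ 4 * (4 * (s1\<^sup>2 + s2\<^sup>2 + s3\<^sup>2 + s4\<^sup>2)))"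
    using Q by (intro mult_left_mono)
  also have "\<dots> = 64 * e ^ 4 / \<kappa> ^ 4 * (Q * s1\<^sup>2 + Q * s2\<^sup>2 + Q * s3\<^sup>2 + Q * s4\<^sup>2)"
  proof -
    have "Q * (A * (4 * (x + y + u + v))) = 4 * A * (Q * x + Q * y + Q * u + Q * v)" for A x y u v :: real
      by (simp add: algebra_simps)
    then have "Q * (16 * e ^ 4 / \<kappa> ^ 4 * (4 * (s1\<^sup>2 + s2\<^sup>2 + s3\<^sup>2 + s4\<^sup>2)))
        = 4 * (16 * e ^ 4 / \<kappa> ^ 4) * (Q * s1\<^sup>2 + Q * s2\<^sup>2 + Q * s3\<^sup>2 + Q * s4\<^sup>2)" .
    also have "4 * (16 * e ^ 4 / \<kappa> ^ 4) = 64 * e ^ 4 / \<kappa> ^ 4" by simp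
    finally show ?thesis .
  qed
  also have "\<dots> \<le> 64 * e ^ 4 / \<kappa> ^ 4 * (5 * e ^ 4 + 5 * e ^ 4 + 5 * e ^ 4 + 5 * e ^ 4)"
    using Qa Qb by (intro mult_left_mono add_mono) (auto simp: s e_def power_divide)
  also have "\<dots> = 1280 / \<kappa> ^ 4 * e ^ 8" by (simp flip: power_add)
  finally show ?thesis by (simp add: e_def power_divide)
qed

text \<open>Covers the solution that coincides with the Green function near the tail. The 5 brings
  the bound into the shape required by \<open>opnorm_transfer_tail_bound\<close>.\<close>

lemma sum_times_norm_le:
  assumes z: "Im z \<in> {0<..1}" and F: "finite F"
  shows "(\<Sum>k\<in>F. (cmod (coord (green z) k))\<^sup>2) * (cmod (coord (green z) j))\<^sup>2 \<le> 5 / Im z ^ 4"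
proof -
  have n: "(norm (green z))\<^sup>2 \<le> (1 / Im z)\<^sup>2"
    using norm_green_le[of z] z by (intro power_mono) auto
  have "(\<Sum>k\<in>F. (cmod (coord (green z) k))\<^sup>2) * (cmod (coord (green z) j))\<^sup>2
      \<le> (1 / Im z)\<^sup>2 * (1 / Im z)\<^sup>2"
    using order_trans[OF norm_ell2_finite_sum[OF F, of "green z"] n]
      order_trans[OF power_mono[OF cmod_coord_le[of "green z" j], of 2] n]
    by (intro mult_mono) (auto intro: sum_nonneg)
  also have "\<dots> = 1 / Im z ^ 4" by (simp add: power_divide flip: power_add)
  also have "\<dots> \<le> 5 / Im z ^ 4" using z by (intro divide_right_mono) auto
  finally show ?thesis .
qed

text \<open>Moving one of the two solutions by one site costs the Wronskian.\<close>

lemma wronskian_shift_bound: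
  assumes z: "Im z \<in> {0<..1}" and "cmod (x - y) \<le> 1 / Im z" "(cmod y)\<^sup>2 \<le> 1 / Im z ^ 4"
  shows "(cmod x)\<^sup>2 \<le> 4 / Im z ^ 4"
proof -
  define e where "e = 1 / Im z"
  have e: "1 \<le> e" using z by (auto simp: e_def field_simps)
  have "(cmod y)\<^sup>2 \<le> (e\<^sup>2)\<^sup>2" using assms(3) by (simp add: e_def power_divide flip: power_mult)
  then have "cmod y \<le> e\<^sup>2" by (rule power2_le_imp_le) simp
  moreover have "e \<le> e\<^sup>2" using e by (simp add: power2_eq_square)
  moreover have "cmod x \<le> cmod y + cmod (x - y)" by (metis add_diff_cancel_left' diff_add_cancel norm_triangle_sub)
  ultimately have "cmod x \<le> 2 * e\<^sup>2" using assms(2) by (simp add: e_def)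
  then have "(cmod x)\<^sup>2 \<le> (2 * e\<^sup>2)\<^sup>2" by (intro power_mono) auto
  then show ?thesis by (simp add: e_def power_divide power_mult_distrib flip: power_mult)
qed

text \<open>\<open>F\<close> lies beyond the nearer of the sites \<open>n\<close> and \<open>n + 1\<close>, inclusive, as seen from the pole 1.\<close>

definition admissible :: "int \<Rightarrow> int set \<Rightarrow> bool"
  where "admissible n F \<longleftrightarrow> finite F \<and> (1 \<le> n \<and> F \<subseteq> {n..} \<or> L = Whole_line \<and> n \<le> -1 \<and> F \<subseteq> {..n + 1})"

text \<open>Cramer's rule needs both solutions at n and at n + 1. One of them is the Green function
  there, where the resolvent bound is enough; for the other, \<open>green_product\<close> is applied
  with both n and n + 1 as pole.\<close>

lemma green_tail_upper:
  obtains C where "C > 0" "\<And>z n F. Im z \<in> {0<..1} \<Longrightarrow> \<bar>Re z\<bar> \<le> K \<Longrightarrow> admissible n F \<Longrightarrow>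
    (\<Sum>k\<in>F. (cmod (coord (green z) k))\<^sup>2) * (opnorm (transfer V n z))\<^sup>2 \<le> C / Im z ^ 8"
proof -
  obtain \<kappa> where \<kappa>: "0 < \<kappa>" "\<And>z. Im z \<in> {0<..1} \<Longrightarrow> \<bar>Re z\<bar> \<le> K \<Longrightarrow> \<kappa> \<le> norm (green z)"
    using norm_green_ge by blast
  have "(\<Sum>k\<in>F. (cmod (coord (green z) k))\<^sup>2) * (opnorm (transfer V n z))\<^sup>2 \<le> (1280 / \<kappa> ^ 4) / Im z ^ 8"
    if z: "Im z \<in> {0<..1}" and zK: "\<bar>Re z\<bar> \<le> K" and F: "admissible n F" for z n F
  proof -
    have z0: "Im z \<noteq> 0" and zp: "Im z > 0" using z by auto
    have fin: "finite F" using F by (simp add: admissible_def)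
    define Q where "Q = (\<Sum>k\<in>F. (cmod (coord (green z) k))\<^sup>2)"
    have Q0: "0 \<le> Q" by (simp add: Q_def sum_nonneg)
    have le5: "1 / Im z ^ 4 \<le> 5 / Im z ^ 4" using z by (intro divide_right_mono) auto
    have w: "cmod (coord (green z) 1) \<le> 1 / Im z"
      using order_trans[OF cmod_coord_le norm_green_le[OF zp]] .
    have diff: "cmod (sol_right z n * sol_left z (n + 1) - sol_right z (n + 1) * sol_left z n) \<le> 1 / Im z"
      using w sol_wronskian[of z n] by (metis norm_minus_commute)
    from F consider "1 \<le> n" "F \<subseteq> {n..}" | "L = Whole_line" "n \<le> -1" "F \<subseteq> {..n + 1}"
      by (auto simp: admissible_def)
    then show ?thesis
    proof cases
      case 1
      have n: "n \<in> sites L" "n + 1 \<in> sites L" using 1 by (cases L; simp)+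
      have eq: "sol_right z k = coord (green z) k" if "k \<ge> n" for k
        using that 1 by (intro sol_right_eq[OF z0]) auto
      have Q: "Q = (\<Sum>k\<in>F. (cmod (sol_right z k))\<^sup>2)"
        unfolding Q_def by (rule sum.cong) (use 1 eq in auto)
      have Qb: "Q * (cmod (sol_left z n))\<^sup>2 \<le> 1 / Im z ^ 4"
        unfolding Q by (rule sol_right_tail[OF zp n(1) fin 1(2)])
      \<comment> \<open>For the pole n + 1 the site n of the tail lies on the wrong side. Its term
        is the product of the right solution at n with the left one at n + 1, which the Wronskian
        relates to the product estimated here; hence 1 + 4 = 5 below.\<close>
      have "(cmod (sol_right z (n + 1) * sol_left z n))\<^sup>2 \<le> 1 / Im z ^ 4"
        using sol_right_tail[OF zp n(1), of "{n + 1}"] by (simp add: norm_mult power_mult_distrib)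
      from wronskian_shift_bound[OF z diff this]
      have one: "(cmod (sol_right z n))\<^sup>2 * (cmod (sol_left z (n + 1)))\<^sup>2 \<le> 4 / Im z ^ 4"
        by (simp add: norm_mult power_mult_distrib)
      have "Q \<le> (\<Sum>k\<in>F - {n}. (cmod (sol_right z k))\<^sup>2) + (cmod (sol_right z n))\<^sup>2"
        unfolding Q using fin by (cases "n \<in> F") (auto simp: sum.remove)
      then have "Q * (cmod (sol_left z (n + 1)))\<^sup>2
         \<le> ((\<Sum>k\<in>F - {n}. (cmod (sol_right z k))\<^sup>2) + (cmod (sol_right z n))\<^sup>2) * (cmod (sol_left z (n + 1)))\<^sup>2"
        by (rule mult_right_mono) simp
      also have "\<dots> \<le> 1 / Im z ^ 4 + 4 / Im z ^ 4"
        unfolding distrib_right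
        by (intro add_mono one sol_right_tail[OF zp n(2)]) (use fin 1(2) in force)+
      finally have Qb': "Q * (cmod (sol_left z (n + 1)))\<^sup>2 \<le> 5 / Im z ^ 4" by (simp flip: add_divide_distrib)
      show ?thesis
        unfolding Q_def[symmetric]
        by (rule opnorm_transfer_tail_bound[OF z \<kappa>(2)[OF z zK] \<kappa>(1) Q0])
          (use sum_times_norm_le[OF z fin] Qb Qb' le5 in \<open>auto simp: eq Q_def\<close>)
    next
      case 2
      have n: "n \<in> sites L" "n + 1 \<in> sites L" using 2 by auto
      have eq: "sol_left z k = coord (green z) k" if "k \<le> n + 1" for k
        using that 2 by (intro sol_left_eq[OF z0]) auto
      have Q: "Q = (\<Sum>k\<in>F. (cmod (sol_left z k))\<^sup>2)"
        unfolding Q_def by (rule sum.cong) (use 2 eq in auto)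
      have Qa: "Q * (cmod (sol_right z (n + 1)))\<^sup>2 \<le> 1 / Im z ^ 4"
        unfolding Q by (rule sol_left_tail[OF zp n(2) fin]) (use 2 in auto)
      \<comment> \<open>The mirror image: now n + 1 is the exceptional site, for the pole n.\<close>
      have "(cmod (sol_right z (n + 1) * sol_left z n))\<^sup>2 \<le> 1 / Im z ^ 4"
        using sol_left_tail[OF zp n(2), of "{n}"] n by (simp add: norm_mult power_mult_distrib mult.commute)
      from wronskian_shift_bound[OF z diff this]
      have one: "(cmod (sol_left z (n + 1)))\<^sup>2 * (cmod (sol_right z n))\<^sup>2 \<le> 4 / Im z ^ 4"
        by (simp add: norm_mult power_mult_distrib mult.commute)
      have "Q \<le> (\<Sum>k\<in>F - {n + 1}. (cmod (sol_left z k))\<^sup>2) + (cmod (sol_left z (n + 1)))\<^sup>2"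
        unfolding Q using fin by (cases "n + 1 \<in> F") (auto simp: sum.remove)
      then have "Q * (cmod (sol_right z n))\<^sup>2
         \<le> ((\<Sum>k\<in>F - {n + 1}. (cmod (sol_left z k))\<^sup>2) + (cmod (sol_left z (n + 1)))\<^sup>2) * (cmod (sol_right z n))\<^sup>2"
        by (rule mult_right_mono) simp
      also have "\<dots> \<le> 1 / Im z ^ 4 + 4 / Im z ^ 4"
        unfolding distrib_right
        by (intro add_mono one sol_left_tail[OF zp n(1)]) (use fin 2 in force)+
      finally have Qa': "Q * (cmod (sol_right z n))\<^sup>2 \<le> 5 / Im z ^ 4" by (simp flip: add_divide_distrib)
      show ?thesis
        unfolding Q_def[symmetric]
        by (rule opnorm_transfer_tail_bound[OF z \<kappa>(2)[OF z zK] \<kappa>(1) Q0])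
          (use sum_times_norm_le[OF z fin] Qa Qa' le5 in \<open>auto simp: eq Q_def\<close>)
    qed
  qed
  then show ?thesis using that[of "1280 / \<kappa> ^ 4"] \<kappa>(1) by simp
qed

text \<open>Both solutions have the value \<psi>(1) at site 1, and determinant 1 recovers it from
  two neighbouring values. \<open>admissible n {}\<close> merely records the range of n.\<close>

lemma green_pair_lower:
  obtains c where "c > 0" "\<And>z n. Im z \<in> {0<..1} \<Longrightarrow> \<bar>Re z\<bar> \<le> K \<Longrightarrow> admissible n {} \<Longrightarrow>
    c * (Im z)\<^sup>2 \<le> (opnorm (transfer V n z))\<^sup>2 * (\<Sum>k\<in>{n, n + 1}. (cmod (coord (green z) k))\<^sup>2)"
proof -
  obtain \<kappa> where \<kappa>: "0 < \<kappa>" "\<And>z. Im z \<in> {0<..1} \<Longrightarrow> \<bar>Re z\<bar> \<le> K \<Longrightarrow> \<kappa> \<le> norm (green z)"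
    using norm_green_ge by blast
  have "(\<kappa> ^ 4 / 2) * (Im z)\<^sup>2 \<le> (opnorm (transfer V n z))\<^sup>2 * (\<Sum>k\<in>{n, n + 1}. (cmod (coord (green z) k))\<^sup>2)"
    if z: "Im z \<in> {0<..1}" and zK: "\<bar>Re z\<bar> \<le> K" and F: "admissible n {}" for z n
  proof -
    have z0: "Im z \<noteq> 0" using z by auto
    define p q where "p = cmod (coord (green z) (n + 1))" and "q = cmod (coord (green z) n)"
    have "\<kappa>\<^sup>2 * Im z \<le> (norm (green z))\<^sup>2 * Im z"
      using z \<kappa>(1) \<kappa>(2)[OF z zK] by (intro mult_right_mono power_mono) auto
    also have "\<dots> = Im (coord (green z) 1)" using Im_coord_green[OF z0] by simp
    also have "\<dots> \<le> cmod (coord (green z) 1)" using abs_Im_le_cmod[of "coord (green z) 1"] by simp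
    also have "\<dots> \<le> opnorm (transfer V n z) * (p + q)"
    proof (cases "1 \<le> n")
      case True
      then show ?thesis
        using solution_initial_le[of "coord (green z) 1" V n z "coord (green z) 0 - 1"]
          sol_right_eq[OF z0, of n] sol_right_eq[OF z0, of "n + 1"]
        by (simp add: sol_right_def p_def q_def)
    next
      case False
      then have "L = Whole_line" "n \<le> -1" using F by (auto simp: admissible_def)
      then have "n \<le> 1" "n + 1 \<le> 1" "n \<in> sites L" "n + 1 \<in> sites L" by auto
      then show ?thesis
        using solution_initial_le[of "coord (green z) 1" V n z "coord (green z) 0"]
          sol_left_eq[OF z0, of n] sol_left_eq[OF z0, of "n + 1"]
        by (simp add: sol_left_def p_def q_def)
    qed
    finally have "(\<kappa>\<^sup>2 * Im z)\<^sup>2 \<le> (opnorm (transfer V n z) * (p + q))\<^sup>2"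
      using z by (intro power_mono) auto
    also have "\<dots> = (opnorm (transfer V n z))\<^sup>2 * (p + q)\<^sup>2" by (simp add: power_mult_distrib)
    also have "\<dots> \<le> (opnorm (transfer V n z))\<^sup>2 * (2 * (q\<^sup>2 + p\<^sup>2))"
      using zero_le_power2[of "p - q"] by (intro mult_left_mono) (auto simp: power2_eq_square algebra_simps)
    finally show ?thesis
      by (simp add: p_def q_def power_mult_distrib distrib_left distrib_right flip: power_mult)
  qed
  then show ?thesis using that[of "\<kappa> ^ 4 / 2"] \<kappa>(1) by simp
qed

end

section \<open>Outside probabilities\<close>

lemma integrable_indicator_Icc: "integrable lborel (indicator {a..b::real} :: real \<Rightarrow> real)"
  using emeasure_lborel_cbox_finite[of a b] by (intro integrable_real_indicator) auto

context schroedinger_op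
begin

lemma avg_prob_nonneg:
  assumes "T > 0"
  shows "0 \<le> avg_prob L V n T"
  unfolding avg_prob_def set_lebesgue_integral_def
  using assms by (intro mult_nonneg_nonneg Bochner_Integration.integral_nonneg) auto

lemma sum_avg_prob:
  assumes T: "T > 0" and F: "finite F" "F \<subseteq> sites L"
  shows "(\<Sum>n\<in>F. avg_prob L V n T)
      = 1 / (pi * T) * (LINT E|lborel. (\<Sum>n\<in>F. (cmod (coord (green (Complex E (1 / T))) n))\<^sup>2))"
    and "integrable lborel (\<lambda>E. \<Sum>n\<in>F. (cmod (coord (green (Complex E (1 / T))) n))\<^sup>2)"
proof -
  have i: "integrable lborel (\<lambda>E. (cmod (coord (green (Complex E (1 / T))) n))\<^sup>2)" if "n \<in> F" for n
    using that F T by (intro integrable_green) auto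
  then show "integrable lborel (\<lambda>E. \<Sum>n\<in>F. (cmod (coord (green (Complex E (1 / T))) n))\<^sup>2)"
    by (rule Bochner_Integration.integrable_sum)
  show "(\<Sum>n\<in>F. avg_prob L V n T)
      = 1 / (pi * T) * (LINT E|lborel. (\<Sum>n\<in>F. (cmod (coord (green (Complex E (1 / T))) n))\<^sup>2))"
    using F by (subst Bochner_Integration.integral_sum[OF i])
      (auto simp: avg_prob_eq[OF T] subset_iff sum_divide_distrib intro!: sum.cong)
qed

text \<open>The factor 4 stems from \<open>green_decay\<close>, 9 + 4 K^2 from
  \<open>inverse_square_le\<close>, and 1 / pi from \<open>avg_prob_eq\<close>, whose further factor
  1 / T is bounded by 1.\<close>

definition high_const :: real
  where "high_const = 4 * (9 + 4 * K\<^sup>2) / pi * (LINT E|lborel. inverse (1 + (E::real)\<^sup>2))"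

lemma high_const_nonneg: "0 \<le> high_const"
  unfolding high_const_def
  by (intro mult_nonneg_nonneg Bochner_Integration.integral_nonneg divide_nonneg_nonneg) auto

text \<open>
  Only the energies in \<open>[-K, K]\<close> matter: at the others, the Green function decays exponentially
  at a rate that does not depend on \<open>T\<close>.
\<close>

lemma sum_avg_prob_le:
  assumes T: "T \<ge> 1" and F: "finite F" "F \<subseteq> sites L" "\<And>n. n \<in> F \<Longrightarrow> M \<le> \<bar>real_of_int n - 1\<bar>" and M: "0 \<le> M"
    and h: "integrable lborel h" "\<And>E. 0 \<le> h E" "0 \<le> D"
    and low: "\<And>E. \<bar>E\<bar> \<le> K \<Longrightarrow> (\<Sum>n\<in>F. (cmod (coord (green (Complex E (1 / T))) n))\<^sup>2) \<le> D * h E"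
  shows "(\<Sum>n\<in>F. avg_prob L V n T) \<le> D * (1 / (pi * T) * (LINT E|lborel. h E)) + high_const * exp (- M / 4)"
proof -
  have Tp: "T > 0" using T by simp
  define q where "q = 4 * (9 + 4 * K\<^sup>2) * exp (- M / 4)"
  have q: "q \<ge> 0" by (simp add: q_def)
  have "(LINT E|lborel. (\<Sum>n\<in>F. (cmod (coord (green (Complex E (1 / T))) n))\<^sup>2))
     \<le> (LINT E|lborel. D * h E + q * inverse (1 + E\<^sup>2))"
  proof (rule integral_mono)
    show "integrable lborel (\<lambda>E. \<Sum>n\<in>F. (cmod (coord (green (Complex E (1 / T))) n))\<^sup>2)"
      by (rule sum_avg_prob(2)[OF Tp F(1,2)])
    show "integrable lborel (\<lambda>E. D * h E + q * inverse (1 + E\<^sup>2))"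
      using h(1) integrable_inverse_1_plus_square' by auto
    fix E :: real
    show "(\<Sum>n\<in>F. (cmod (coord (green (Complex E (1 / T))) n))\<^sup>2) \<le> D * h E + q * inverse (1 + E\<^sup>2)"
    proof (cases "\<bar>E\<bar> \<le> K")
      case True
      then show ?thesis using low[OF True] q by (simp add: add_increasing2)
    next
      case False
      define d where "d = \<bar>E\<bar> - (K - 1)"
      have d: "d \<ge> 1" using False by (simp add: d_def)
      have "(\<Sum>n\<in>F. (cmod (coord (green (Complex E (1 / T))) n))\<^sup>2) \<le> 4 / d\<^sup>2 * exp (- (min 1 d / 4) * M)"
      proof (rule green_decay)
        show "d * norm f \<le> norm (H f - Complex E (1 / T) *\<^sub>C f)" if "f \<in> S" for f
          using norm_shifted_ge_Re[OF that, of "Complex E (1 / T)"] by (simp add: d_def)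
      qed (use d F M Tp in auto)
      \<comment> \<open>Since d >= 1, the cap in \<open>green_decay\<close> makes the rate the same
        for all these energies.\<close>
      also have "\<dots> = 4 * exp (- M / 4) * (1 / (\<bar>E\<bar> - (K - 1)))\<^sup>2"
        using d by (simp add: d_def power_divide min_def)
      also have "\<dots> \<le> 4 * exp (- M / 4) * ((9 + 4 * K\<^sup>2) * inverse (1 + E\<^sup>2))"
        using False by (intro mult_left_mono inverse_square_le) auto
      also have "\<dots> = q * inverse (1 + E\<^sup>2)" by (simp add: q_def)
      finally show ?thesis using h(2,3) by (simp add: add_increasing)
    qed
  qed
  also have "\<dots> = D * (LINT E|lborel. h E) + q * (LINT E|lborel. inverse (1 + (E::real)\<^sup>2))"
    using h(1) integrable_inverse_1_plus_square' by (subst Bochner_Integration.integral_add) auto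
  finally have le: "(LINT E|lborel. (\<Sum>n\<in>F. (cmod (coord (green (Complex E (1 / T))) n))\<^sup>2))
     \<le> D * (LINT E|lborel. h E) + q * (LINT E|lborel. inverse (1 + (E::real)\<^sup>2))" .
  define J where "J = (LINT E|lborel. inverse (1 + (E::real)\<^sup>2))"
  have J: "0 \<le> J" unfolding J_def by (intro Bochner_Integration.integral_nonneg) auto
  have "(\<Sum>n\<in>F. avg_prob L V n T) \<le> 1 / (pi * T) * (D * (LINT E|lborel. h E) + q * J)"
    unfolding sum_avg_prob(1)[OF Tp F(1,2)] J_def by (intro mult_left_mono le) (use Tp in auto)
  also have "\<dots> = D * (1 / (pi * T) * (LINT E|lborel. h E)) + 1 / T * (q / pi * J)"
    by (simp add: distrib_left mult_ac)
  also have "1 / T * (q / pi * J) \<le> 1 * (q / pi * J)"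
    using T q J by (intro mult_right_mono) auto
  also have "1 * (q / pi * J) = high_const * exp (- M / 4)"
    by (simp add: q_def high_const_def J_def)
  finally show ?thesis by simp
qed

text \<open>An infinite sum without summability defaults to 0, so this is what makes
  \<open>outside_prob\<close> comparable with finite sums. In the energy window the crude bound T^2
  on the squared norm suffices.\<close>

lemma avg_prob_summable:
  assumes T: "T \<ge> 1"
  shows "(\<lambda>n. avg_prob L V n T) summable_on sites L"
proof -
  have "(\<Sum>n\<in>F. avg_prob L V n T) \<le> T\<^sup>2 * (1 / (pi * T) * (LINT E|lborel. indicator {-K..K} E)) + high_const * exp (- 0 / 4)"
    if "finite F" "F \<subseteq> sites L" for F
  proof (rule sum_avg_prob_le[OF T that])
    fix E :: real assume E: "\<bar>E\<bar> \<le> K"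
    let ?z = "Complex E (1 / T)"
    have "(\<Sum>n\<in>F. (cmod (coord (green ?z) n))\<^sup>2) \<le> (norm (green ?z))\<^sup>2"
      by (rule norm_ell2_finite_sum[OF that(1)])
    also have "\<dots> \<le> T\<^sup>2"
      using norm_green_le[of ?z] T by (intro power_mono) auto
    finally show "(\<Sum>n\<in>F. (cmod (coord (green ?z) n))\<^sup>2) \<le> T\<^sup>2 * indicator {-K..K} E"
      using E by (auto simp: indicator_def abs_le_iff)
  qed (auto simp: integrable_indicator_Icc)
  then show ?thesis
    using T avg_prob_nonneg by (intro nonneg_bdd_above_summable_on bdd_aboveI) auto
qed

lemma outside_prob_nonneg:
  assumes "T \<ge> 1"
  shows "0 \<le> outside_prob L V N T"
  unfolding outside_prob_def using assms avg_prob_nonneg by (intro infsum_nonneg) auto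

lemma sum_le_outside_prob:
  assumes T: "T \<ge> 1" and G: "finite G" "\<And>n. n \<in> G \<Longrightarrow> n \<in> sites L \<and> N < ereal \<bar>real_of_int n\<bar>"
  shows "(\<Sum>n\<in>G. avg_prob L V n T) \<le> outside_prob L V N T"
  unfolding outside_prob_def
proof (rule finite_sum_le_infsum)
  show "(\<lambda>n. avg_prob L V n T) summable_on {n \<in> sites L. N < ereal \<bar>real_of_int n\<bar>}"
    by (rule summable_on_subset_banach[OF avg_prob_summable[OF T]]) auto
qed (use G T avg_prob_nonneg in auto)

lemma outside_prob_le:
  assumes T: "T \<ge> 1"
    and F: "\<And>F. finite F \<Longrightarrow> F \<subseteq> {n \<in> sites L. N < ereal \<bar>real_of_int n\<bar>} \<Longrightarrow> (\<Sum>n\<in>F. avg_prob L V n T) \<le> B"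
  shows "outside_prob L V N T \<le> B"
  unfolding outside_prob_def
proof (rule infsum_le_finite_sums)
  show "(\<lambda>n. avg_prob L V n T) summable_on {n \<in> sites L. N < ereal \<bar>real_of_int n\<bar>}"
    by (rule summable_on_subset_banach[OF avg_prob_summable[OF T]]) auto
qed (use F in auto)

text \<open>Combes--Thomas inside the energy window with the lower bound 1/T coming from Im z: the
  decay length is of order T. The shift N - 1 is the distance from the pole 1.\<close>

lemma outside_prob_ballistic:
  assumes T: "T \<ge> 1" and N: "1 \<le> N"
  shows "outside_prob L V (ereal N) T
    \<le> 8 * K / pi * T * exp (- (N - 1) / (4 * T)) + high_const * exp (- (N - 1) / 4)"
proof (rule outside_prob_le[OF T])
  fix F assume F: "finite F" "F \<subseteq> {n \<in> sites L. ereal N < ereal \<bar>real_of_int n\<bar>}"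
  have d: "N - 1 \<le> \<bar>real_of_int n - 1\<bar>" if "n \<in> F" for n
    using F(2) that by force
  have Tp: "T > 0" using T by simp
  have "(\<Sum>n\<in>F. avg_prob L V n T) \<le> (4 * T\<^sup>2 * exp (- (N - 1) / (4 * T))) * (1 / (pi * T) * (LINT E|lborel. indicator {-K..K} E))
     + high_const * exp (- (N - 1) / 4)"
  proof (rule sum_avg_prob_le[OF T F(1) _ d])
    fix E :: real assume E: "\<bar>E\<bar> \<le> K"
    let ?z = "Complex E (1 / T)"
    have "(\<Sum>n\<in>F. (cmod (coord (green ?z) n))\<^sup>2) \<le> 4 / (1 / T)\<^sup>2 * exp (- (min 1 (1 / T) / 4) * (N - 1))"
    proof (rule green_decay)
      show "1 / T * norm f \<le> norm (H f - ?z *\<^sub>C f)" if "f \<in> S" for f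
        using norm_shifted_ge_Im[OF that, of ?z] Tp by simp
    qed (use Tp N F d in auto)
    also have "min 1 (1 / T) = 1 / T" using T by (simp add: min_def)
    also have "4 / (1 / T)\<^sup>2 * exp (- (1 / T / 4) * (N - 1)) = 4 * T\<^sup>2 * exp (- (N - 1) / (4 * T))"
      using Tp by (simp add: power_divide field_simps)
    finally show "(\<Sum>n\<in>F. (cmod (coord (green ?z) n))\<^sup>2) \<le> 4 * T\<^sup>2 * exp (- (N - 1) / (4 * T)) * indicator {-K..K} E"
      using E by (auto simp: indicator_def abs_le_iff)
  qed (use F N in \<open>auto simp: integrable_indicator_Icc\<close>)
  also have "(LINT E|lborel. indicator {-K..K} E) = 2 * K" using K_ge by simp
  also have "(4 * T\<^sup>2 * exp (- (N - 1) / (4 * T))) * (1 / (pi * T) * (2 * K)) = 8 * K / pi * T * exp (- (N - 1) / (4 * T))"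
    using Tp by (simp add: power2_eq_square field_simps)
  finally show "(\<Sum>n\<in>F. avg_prob L V n T) \<le> 8 * K / pi * T * exp (- (N - 1) / (4 * T)) + high_const * exp (- (N - 1) / 4)" .
qed

text \<open>With radius -1 the site 1 is counted, and it alone suffices: its Green function is at
  least \<kappa>^2 / T on a window of length 2 K, and the prefactor 1 / (pi T) adds the third
  power.\<close>

lemma outside_prob_all_lower:
  obtains c where "c > 0" "\<And>T. T \<ge> 1 \<Longrightarrow> c / T ^ 3 \<le> outside_prob L V (-1) T"
proof -
  obtain \<kappa> where \<kappa>: "0 < \<kappa>" "\<And>z. Im z \<in> {0<..1} \<Longrightarrow> \<bar>Re z\<bar> \<le> K \<Longrightarrow> \<kappa> \<le> norm (green z)"
    using norm_green_ge by blast
  have "(2 * K * \<kappa> ^ 4 / pi) / T ^ 3 \<le> outside_prob L V (-1) T" if T: "T \<ge> 1" for T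
  proof -
    have Tp: "T > 0" using T by simp
    have "(LINT E|lborel. \<kappa> ^ 4 / T\<^sup>2 * indicator {-K..K} E) \<le> (LINT E|lborel. (cmod (coord (green (Complex E (1 / T))) 1))\<^sup>2)"
    proof (rule integral_mono)
      show "integrable lborel (\<lambda>E. (cmod (coord (green (Complex E (1 / T))) 1))\<^sup>2)"
        using Tp one_site by (intro integrable_green) auto
      fix E :: real
      show "\<kappa> ^ 4 / T\<^sup>2 * indicator {-K..K} E \<le> (cmod (coord (green (Complex E (1 / T))) 1))\<^sup>2"
      proof (cases "\<bar>E\<bar> \<le> K")
        case True
        let ?z = "Complex E (1 / T)"
        have "\<kappa> \<le> norm (green ?z)" using \<kappa>(2)[of ?z] T True by simp
        then have "1 / T * \<kappa>\<^sup>2 \<le> 1 / T * (norm (green ?z))\<^sup>2"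
          using Tp \<kappa>(1) by (intro mult_left_mono power_mono) auto
        also have "\<dots> = Im (coord (green ?z) 1)" using Im_coord_green[of ?z] Tp by simp
        also have "\<dots> \<le> cmod (coord (green ?z) 1)" using abs_Im_le_cmod[of "coord (green ?z) 1"] by simp
        finally have "(1 / T * \<kappa>\<^sup>2)\<^sup>2 \<le> (cmod (coord (green ?z) 1))\<^sup>2"
          using Tp by (intro power_mono) auto
        then show ?thesis using True by (simp add: indicator_def abs_le_iff power_mult_distrib power_divide flip: power_mult)
      qed (auto simp: indicator_def)
      show "integrable lborel (\<lambda>E. \<kappa> ^ 4 / T\<^sup>2 * indicator {-K..K} E :: real)"
        by (rule integrable_mult_right) (rule integrable_indicator_Icc)
    qed
    then have le: "\<kappa> ^ 4 / T\<^sup>2 * (2 * K) \<le> (LINT E|lborel. (cmod (coord (green (Complex E (1 / T))) 1))\<^sup>2)"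
      using K_ge by simp
    have "(2 * K * \<kappa> ^ 4 / pi) / T ^ 3 = 1 / (pi * T) * (\<kappa> ^ 4 / T\<^sup>2 * (2 * K))"
      by (simp add: power2_eq_square power3_eq_cube mult_ac)
    also have "\<dots> \<le> 1 / (pi * T) * (LINT E|lborel. (cmod (coord (green (Complex E (1 / T))) 1))\<^sup>2)"
      using Tp by (intro mult_left_mono le) auto
    also have "\<dots> = avg_prob L V 1 T" using avg_prob_eq[OF Tp one_site] by simp
    also have "\<dots> \<le> outside_prob L V (-1) T"
      using sum_le_outside_prob[OF T, of "{1}" "-1"] one_site by (simp add: one_ereal_def)
    finally show ?thesis .
  qed
  then show ?thesis using that[of "2 * K * \<kappa> ^ 4 / pi"] \<kappa>(1) K_ge by simp
qed

end

text \<open>On each side, the whole tail of the first operator is compared, energy by energy, with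
  two neighbouring sites of the second, which themselves lie beyond N. The exponent collects 2 A
  from the squared hypothesis, 8 from \<open>green_tail_upper\<close> and 2 from
  \<open>green_pair_lower\<close>. The sites used are at most N + 2 in modulus, so N + 2 <= T keeps
  them within reach of the hypothesis.\<close>

lemma outside_prob_compare:
  assumes ops: "schroedinger_op L V1 K" "schroedinger_op L V2 K" and C: "C > 0"
    and cmp: "\<And>E \<epsilon> n. E \<in> {-K..K} \<Longrightarrow> \<epsilon> \<in> {0<..1} \<Longrightarrow> n \<in> insert 0 (sites L) \<Longrightarrow> \<bar>real_of_int n\<bar> \<le> 1 / \<epsilon> \<Longrightarrow>
      opnorm (transfer V2 n (Complex E \<epsilon>)) \<le> C * (\<epsilon> powr (- A) * opnorm (transfer V1 n (Complex E \<epsilon>)))"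
  obtains D where "D > 0" "\<And>T N. T \<ge> 1 \<Longrightarrow> 0 \<le> N \<Longrightarrow> N + 2 \<le> T \<Longrightarrow>
    outside_prob L V1 (ereal N) T \<le> D * T powr (2 * A + 10) * outside_prob L V2 (ereal N) T + D * exp (- N / 4)"
proof -
  interpret o1: schroedinger_op L V1 K by fact
  interpret o2: schroedinger_op L V2 K by fact
  obtain C1 where C1: "C1 > 0" "\<And>z n F. Im z \<in> {0<..1} \<Longrightarrow> \<bar>Re z\<bar> \<le> K \<Longrightarrow> o1.admissible n F \<Longrightarrow>
      (\<Sum>k\<in>F. (cmod (coord (o1.green z) k))\<^sup>2) * (opnorm (transfer V1 n z))\<^sup>2 \<le> C1 / Im z ^ 8"
    using o1.green_tail_upper by blast
  obtain c where c: "c > 0" "\<And>z n. Im z \<in> {0<..1} \<Longrightarrow> \<bar>Re z\<bar> \<le> K \<Longrightarrow> o2.admissible n {} \<Longrightarrow>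
      c * (Im z)\<^sup>2 \<le> (opnorm (transfer V2 n z))\<^sup>2 * (\<Sum>k\<in>{n, n + 1}. (cmod (coord (o2.green z) k))\<^sup>2)"
    using o2.green_pair_lower by blast
  define D0 where "D0 = C\<^sup>2 * C1 / c"
  have D0: "D0 > 0" using C C1(1) c(1) by (simp add: D0_def)
  have pair: "(\<Sum>k\<in>F. (cmod (coord (o1.green (Complex E (1 / T))) k))\<^sup>2)
      \<le> D0 * T powr (2 * A + 10) * (\<Sum>k\<in>{n, n + 1}. (cmod (coord (o2.green (Complex E (1 / T))) k))\<^sup>2)"
    if T: "T \<ge> 1" and E: "\<bar>E\<bar> \<le> K" and F: "o1.admissible n F" and n: "\<bar>real_of_int n\<bar> \<le> T" for T E n F
  proof -
    define z where "z = Complex E (1 / T)"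
    define X where "X = (\<Sum>k\<in>F. (cmod (coord (o1.green z) k))\<^sup>2)"
    define Y where "Y = (\<Sum>k\<in>{n, n + 1}. (cmod (coord (o2.green z) k))\<^sup>2)"
    define p1 p2 where "p1 = opnorm (transfer V1 n z)" and "p2 = opnorm (transfer V2 n z)"
    have z: "Im z \<in> {0<..1}" "\<bar>Re z\<bar> \<le> K" using T E by (auto simp: z_def)
    have XY: "0 \<le> X" "0 \<le> Y" by (auto simp: X_def Y_def intro!: sum_nonneg)
    have adm: "o2.admissible n {}" using F by (auto simp: o1.admissible_def o2.admissible_def)
    have "1 \<le> n \<or> L = Whole_line" using F by (auto simp: o1.admissible_def)
    then have n_site: "n \<in> insert 0 (sites L)" by (cases L) auto
    have p2: "0 \<le> p2" unfolding p2_def using opnorm_entry[of "transfer V2 n z" 1 1] by (meson norm_ge_zero order_trans)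
    have "p2 \<le> C * ((1 / T) powr (- A) * p1)"
      unfolding p1_def p2_def z_def using T E n n_site by (intro cmp) auto
    also have "(1 / T) powr (- A) = T powr A" using T by (simp add: powr_minus_divide powr_divide)
    finally have p21: "p2\<^sup>2 \<le> (C * (T powr A * p1))\<^sup>2" using p2 by (intro power_mono)
    have "X * (c / T\<^sup>2) \<le> X * (p2\<^sup>2 * Y)"
      using c(2)[OF z adm] XY by (intro mult_left_mono) (auto simp: p2_def Y_def z_def power_divide)
    also have "\<dots> \<le> X * ((C * (T powr A * p1))\<^sup>2 * Y)"
      using XY by (intro mult_left_mono mult_right_mono p21)
    also have "\<dots> = C\<^sup>2 * (T powr A)\<^sup>2 * Y * (X * p1\<^sup>2)"
      by (simp add: power_mult_distrib mult_ac)
    also have "\<dots> \<le> C\<^sup>2 * (T powr A)\<^sup>2 * Y * (C1 / (1 / T) ^ 8)"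
      using C1(2)[OF z F] XY by (intro mult_left_mono) (auto simp: X_def p1_def z_def)
    finally have "X * (c / T\<^sup>2) \<le> C\<^sup>2 * (T powr A)\<^sup>2 * Y * (C1 * T ^ 8)" by (simp add: power_divide)
    then have "X * (c / T\<^sup>2) * (T\<^sup>2 / c) \<le> C\<^sup>2 * (T powr A)\<^sup>2 * Y * (C1 * T ^ 8) * (T\<^sup>2 / c)"
      using c(1) by (intro mult_right_mono) auto
    also have "X * (c / T\<^sup>2) * (T\<^sup>2 / c) = X" using c(1) T by simp
    also have "C\<^sup>2 * (T powr A)\<^sup>2 * Y * (C1 * T ^ 8) * (T\<^sup>2 / c) = D0 * ((T powr A)\<^sup>2 * (T ^ 8 * T\<^sup>2)) * Y"
      by (simp add: D0_def)
    also have "(T powr A)\<^sup>2 * (T ^ 8 * T\<^sup>2) = T powr (2 * A + 10)"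
    proof -
      have "(T powr A)\<^sup>2 = T powr (2 * A)" using T by (simp add: power2_eq_square flip: powr_add)
      moreover have "T ^ 8 * T\<^sup>2 = T powr 10" using T powr_realpow[of T 10] by (simp flip: power_add)
      ultimately show ?thesis by (simp add: powr_add)
    qed
    finally show ?thesis by (simp add: X_def Y_def z_def)
  qed
  \<comment> \<open>The factor exp (1 / 4) pays for replacing m - 1 by N in the exponential, as m -
    1 > N - 1.\<close>
  define D where "D = 1 + D0 + o1.high_const * exp (1 / 4)"
  have D: "D > 0" "D0 \<le> D" "o1.high_const * exp (1 / 4) \<le> D"
    using D0 o1.high_const_nonneg by (auto simp: D_def add_pos_nonneg)
  have "outside_prob L V1 (ereal N) T \<le> D * T powr (2 * A + 10) * outside_prob L V2 (ereal N) T + D * exp (- N / 4)"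
    if T: "T \<ge> 1" and N: "0 \<le> N" "N + 2 \<le> T" for T N
  proof (rule o1.outside_prob_le[OF T])
    fix F assume F: "finite F" "F \<subseteq> {n \<in> sites L. ereal N < ereal \<bar>real_of_int n\<bar>}"
    \<comment> \<open>The least integer beyond N, so that \<open>m\<close> and all sites of
      \<open>G\<close> are counted in the outside probability.\<close>
    define m where "m = \<lfloor>N\<rfloor> + 1"
    have m: "1 \<le> m" "real_of_int m \<le> N + 1" "N < real_of_int m"
      using N by (auto simp: m_def)
    have Fm: "m \<le> \<bar>n\<bar>" if "n \<in> F" for n
    proof -
      have "N < real_of_int \<bar>n\<bar>" using F(2) that by auto
      then have "\<lfloor>N\<rfloor> < \<bar>n\<bar>" by (subst floor_less_iff)
      then show ?thesis by (simp add: m_def)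
    qed
    define G where "G = {m, m + 1} \<union> (if L = Whole_line then {- m - 1, - m} else {})"
    have G: "finite G" "G \<subseteq> sites L" using m(1) by (cases L; auto simp: G_def)+
    have Tp: "T > 0" using T by simp
    have "(\<Sum>n\<in>F. avg_prob L V1 n T) \<le> (D0 * T powr (2 * A + 10)) *
        (1 / (pi * T) * (LINT E|lborel. (\<Sum>n\<in>G. (cmod (coord (o2.green (Complex E (1 / T))) n))\<^sup>2)))
        + o1.high_const * exp (- (real_of_int m - 1) / 4)"
    proof (rule o1.sum_avg_prob_le[OF T F(1)])
      show "F \<subseteq> sites L" using F(2) by auto
      show "real_of_int m - 1 \<le> \<bar>real_of_int n - 1\<bar>" if "n \<in> F" for n
      proof -
        have "m - 1 \<le> \<bar>n - 1\<bar>" using Fm[OF that] by simp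
        then show ?thesis by linarith
      qed
      show "integrable lborel (\<lambda>E. \<Sum>n\<in>G. (cmod (coord (o2.green (Complex E (1 / T))) n))\<^sup>2)"
        by (rule o2.sum_avg_prob(2)[OF Tp G])
      fix E :: real assume E: "\<bar>E\<bar> \<le> K"
      define f where "f k = (cmod (coord (o1.green (Complex E (1 / T))) k))\<^sup>2" for k
      define g where "g k = (cmod (coord (o2.green (Complex E (1 / T))) k))\<^sup>2" for k
      define F1 F2 where "F1 = F \<inter> {m..}" and "F2 = F \<inter> {..- m}"
      have "sum f F = sum f (F1 \<union> F2)"
        using Fm by (intro sum.cong) (force simp: F1_def F2_def)+
      also have "\<dots> = sum f F1 + sum f F2"
        using F(1) m(1) by (intro sum.union_disjoint) (auto simp: F1_def F2_def)
      also have "sum f F1 \<le> D0 * T powr (2 * A + 10) * sum g {m, m + 1}"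
        unfolding f_def g_def
        by (rule pair[OF T E]) (use m N F in \<open>auto simp: F1_def o1.admissible_def\<close>)
      also have "sum f F2 \<le> D0 * T powr (2 * A + 10) * sum g (if L = Whole_line then {- m - 1, - m} else {})"
      proof (cases L)
        case Whole_line
        \<comment> \<open>On the left, admissible tails reach up to n + 1; the tail ending at - m
          thus belongs to n = - m - 1.\<close>
        have "o1.admissible (- m - 1) F2"
          unfolding o1.admissible_def using m F(1) Whole_line by (auto simp: F2_def)
        moreover have "\<bar>real_of_int (- m - 1)\<bar> \<le> T" using m N by auto
        ultimately have "sum f F2 \<le> D0 * T powr (2 * A + 10) * sum g {- m - 1, - m - 1 + 1}"
          unfolding f_def g_def by (rule pair[OF T E])
        then show ?thesis using Whole_line by simp
      next
        case Half_line
        then have "F2 = {}" using F(2) m(1) by (auto simp: F2_def)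
        then show ?thesis using Half_line by simp
      qed
      finally have "sum f F \<le> D0 * T powr (2 * A + 10) * (sum g {m, m + 1} + sum g (if L = Whole_line then {- m - 1, - m} else {}))"
        by (simp add: algebra_simps)
      also have "sum g {m, m + 1} + sum g (if L = Whole_line then {- m - 1, - m} else {}) = sum g G"
        unfolding G_def using m(1) by (intro sum.union_disjoint[symmetric]) auto
      finally show "(\<Sum>n\<in>F. (cmod (coord (o1.green (Complex E (1 / T))) n))\<^sup>2)
          \<le> D0 * T powr (2 * A + 10) * (\<Sum>n\<in>G. (cmod (coord (o2.green (Complex E (1 / T))) n))\<^sup>2)"
        by (simp add: f_def g_def)
    qed (use m D0 in \<open>auto intro!: sum_nonneg\<close>)
    also have "1 / (pi * T) * (LINT E|lborel. (\<Sum>n\<in>G. (cmod (coord (o2.green (Complex E (1 / T))) n))\<^sup>2)) = (\<Sum>n\<in>G. avg_prob L V2 n T)"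
      by (rule o2.sum_avg_prob(1)[OF Tp G, symmetric])
    also have "(D0 * T powr (2 * A + 10)) * (\<Sum>n\<in>G. avg_prob L V2 n T) \<le> (D * T powr (2 * A + 10)) * outside_prob L V2 (ereal N) T"
    proof (intro mult_mono mult_right_mono D(2))
      show "(\<Sum>n\<in>G. avg_prob L V2 n T) \<le> outside_prob L V2 (ereal N) T"
        by (rule o2.sum_le_outside_prob[OF T G(1)]) (use G(2) m in \<open>auto simp: G_def split: if_splits\<close>)
      show "0 \<le> (\<Sum>n\<in>G. avg_prob L V2 n T)" using o2.avg_prob_nonneg[OF Tp] by (simp add: sum_nonneg)
    qed (use D in auto)
    also have "o1.high_const * exp (- (real_of_int m - 1) / 4) \<le> o1.high_const * (exp (1 / 4) * exp (- N / 4))"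
      using m by (intro mult_left_mono o1.high_const_nonneg) (auto simp flip: exp_add simp: field_simps)
    also have "\<dots> \<le> D * exp (- N / 4)" using D(3) by (simp flip: mult.assoc)
    finally show "(\<Sum>n\<in>F. avg_prob L V1 n T) \<le> D * T powr (2 * A + 10) * outside_prob L V2 (ereal N) T + D * exp (- N / 4)"
      by simp
  qed
  then show ?thesis using that D(1) by blast
qed

section \<open>Transport exponents\<close>

text \<open>For p = 0 both sides fail, the quotient being -\<infinity>; this is where the convention
  in \<open>elog\<close> matters.\<close>

lemma elog_ratio_ge_iff:
  assumes "T > 1" "0 \<le> p"
  shows "ereal (- real k) \<le> elog p / ereal (ln T) \<longleftrightarrow> T powr (- real k) \<le> p"
proof (cases "p = 0")
  case True
  have "elog p / ereal (ln T) = - \<infinity>" using assms True by (simp add: elog_def divide_ereal_def)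
  moreover have "T powr (- real k) > 0" using assms by simp
  ultimately show ?thesis using True by simp
next
  case False
  then have p: "p > 0" using assms by simp
  have l: "ln T > 0" using assms by simp
  have "ereal (- real k) \<le> elog p / ereal (ln T) \<longleftrightarrow> - real k \<le> ln p / ln T"
    using False l by (simp add: elog_def)
  also have "\<dots> \<longleftrightarrow> - real k * ln T \<le> ln p" using l by (simp add: pos_le_divide_eq)
  also have "\<dots> \<longleftrightarrow> ln (T powr (- real k)) \<le> ln p" using assms by (simp add: ln_powr)
  also have "\<dots> \<longleftrightarrow> T powr (- real k) \<le> p" using assms p by (subst ln_le_cancel_iff) auto
  finally show ?thesis .
qed

text \<open>Every real lower bound lies above some - k, so natural thresholds are enough.\<close>

lemma Liminf_greater_MInfty_iff:
  "Liminf F f > (- \<infinity> :: ereal) \<longleftrightarrow> (\<exists>k. eventually (\<lambda>x. ereal (- real k) \<le> f x) F)"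
proof
  assume "Liminf F f > - \<infinity>"
  then obtain r where "ereal r < Liminf F f" using ereal_dense2 by blast
  moreover obtain k where "- r \<le> real k" using real_arch_simple by blast
  ultimately have "ereal (- real k) < Liminf F f"
    by (smt (verit, best) ereal_less_eq(3) order_le_less_trans)
  then show "\<exists>k. eventually (\<lambda>x. ereal (- real k) \<le> f x) F"
    by (auto dest!: less_LiminfD elim!: eventually_mono intro!: exI[of _ k])
next
  assume "\<exists>k. eventually (\<lambda>x. ereal (- real k) \<le> f x) F"
  then obtain k where "eventually (\<lambda>x. ereal (- real k) \<le> f x) F" ..
  then have "ereal (- real k) \<le> Liminf F f" by (rule Liminf_bounded)
  then show "Liminf F f > - \<infinity>" by (metis MInfty_neq_ereal(1) ereal_infty_less(2) ereal_infty_less_eq(2))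
qed

lemma Limsup_greater_MInfty_iff:
  "Limsup F f > (- \<infinity> :: ereal) \<longleftrightarrow> (\<exists>k. frequently (\<lambda>x. ereal (- real k) \<le> f x) F)"
proof
  assume "Limsup F f > - \<infinity>"
  then obtain r where "ereal r < Limsup F f" using ereal_dense2 by blast
  moreover obtain k where "- r \<le> real k" using real_arch_simple by blast
  ultimately have *: "ereal (- real k) < Limsup F f"
    by (smt (verit, best) ereal_less_eq(3) order_le_less_trans)
  have "frequently (\<lambda>x. ereal (- real k) \<le> f x) F"
  proof (rule ccontr)
    assume "\<not> ?thesis"
    then have "eventually (\<lambda>x. f x \<le> ereal (- real k)) F"
      by (auto simp: not_frequently elim!: eventually_mono)
    then have "Limsup F f \<le> ereal (- real k)" by (rule Limsup_bounded)
    then show False using * by simp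
  qed
  then show "\<exists>k. frequently (\<lambda>x. ereal (- real k) \<le> f x) F" ..
next
  assume "\<exists>k. frequently (\<lambda>x. ereal (- real k) \<le> f x) F"
  then obtain k where k: "frequently (\<lambda>x. ereal (- real k) \<le> f x) F" ..
  have "ereal (- real k) \<le> Limsup F f"
  proof (rule ccontr)
    assume "\<not> ?thesis"
    then have "eventually (\<lambda>x. f x < ereal (- real k)) F" by (intro Limsup_lessD) simp
    then have "eventually (\<lambda>x. \<not> ereal (- real k) \<le> f x) F" by (rule eventually_mono) (simp add: not_le)
    then show False using k by (simp add: frequently_def)
  qed
  then show "Limsup F f > - \<infinity>" by (metis MInfty_neq_ereal(1) ereal_infty_less(2) ereal_infty_less_eq(2))
qed

lemma uminus_less_PInfty_iff: "- x < (\<infinity>::ereal) \<longleftrightarrow> - \<infinity> < x"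
  by (cases x) auto

text \<open>Finiteness of \<open>S_minus\<close> means that this holds for some \<open>k\<close> at
  all large T, finiteness of \<open>S_plus\<close> that it holds for some \<open>k\<close> at
  arbitrarily large T. One implication between such statements therefore serves both
  exponents.\<close>

definition poly_spread :: "line \<Rightarrow> (int \<Rightarrow> real) \<Rightarrow> ereal \<Rightarrow> nat \<Rightarrow> real \<Rightarrow> bool"
  where "poly_spread L V \<alpha> k T \<longleftrightarrow> T powr (- real k) \<le> outside_prob L V (cutoff \<alpha> T) T"

context schroedinger_op
begin

lemma eventually_elog_ratio:
  "\<forall>\<^sub>F T in at_top. ereal (- real k) \<le> elog (outside_prob L V (cutoff \<alpha> T) T) / ereal (ln T) \<longleftrightarrow> poly_spread L V \<alpha> k T"
  using eventually_gt_at_top[of 1]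
  by eventually_elim (auto simp: poly_spread_def elog_ratio_ge_iff outside_prob_nonneg)

lemma S_minus_finite_iff:
  "S_minus L V \<alpha> < \<infinity> \<longleftrightarrow> (\<exists>k. eventually (poly_spread L V \<alpha> k) at_top)"
proof -
  have "S_minus L V \<alpha> < \<infinity> \<longleftrightarrow> Liminf at_top (\<lambda>T. elog (outside_prob L V (cutoff \<alpha> T) T) / ereal (ln T)) > - \<infinity>"
    unfolding S_minus_def by (rule uminus_less_PInfty_iff)
  then show ?thesis
    unfolding Liminf_greater_MInfty_iff
    using eventually_subst[OF eventually_elog_ratio] by auto
qed

lemma S_plus_finite_iff:
  "S_plus L V \<alpha> < \<infinity> \<longleftrightarrow> (\<exists>k. frequently (poly_spread L V \<alpha> k) at_top)"
proof -
  have "S_plus L V \<alpha> < \<infinity> \<longleftrightarrow> Limsup at_top (\<lambda>T. elog (outside_prob L V (cutoff \<alpha> T) T) / ereal (ln T)) > - \<infinity>"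
    unfolding S_plus_def by (rule uminus_less_PInfty_iff)
  moreover have "frequently (\<lambda>T. ereal (- real k) \<le> elog (outside_prob L V (cutoff \<alpha> T) T) / ereal (ln T)) at_top
      \<longleftrightarrow> frequently (poly_spread L V \<alpha> k) at_top" for k
    unfolding frequently_def
    by (rule arg_cong[where f = Not], rule eventually_subst)
      (use eventually_elog_ratio[of k \<alpha>] in \<open>auto elim!: eventually_mono\<close>)
  ultimately show ?thesis
    unfolding Limsup_greater_MInfty_iff by simp
qed

text \<open>Treated separately because the radius T^0 - 2 = -1 is negative, while
  \<open>outside_prob_compare\<close> requires N >= 0.\<close>

lemma poly_spread_0: "\<exists>k. eventually (poly_spread L V 0 k) at_top"
proof -
  obtain c where c: "c > 0" "\<And>T. T \<ge> 1 \<Longrightarrow> c / T ^ 3 \<le> outside_prob L V (-1) T"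
    using outside_prob_all_lower by blast
  have "eventually (\<lambda>T. T powr (- real 4) \<le> c / T ^ 3) at_top"
    using c(1) by real_asymp
  then have "eventually (poly_spread L V 0 4) at_top"
    using eventually_ge_at_top[of 1]
  proof eventually_elim
    case (elim T)
    have "cutoff 0 T = -1" using elim by (simp add: cutoff_def one_ereal_def)
    then show ?case using elim c(2)[of T] by (simp add: poly_spread_def)
  qed
  then show ?thesis ..
qed

text \<open>At radius T^\<alpha> the ballistic bound is of the order exp (- T^(\<alpha> - 1) / 4) up
  to a power of T, smaller than any power. For \<alpha> = \<infinity> no site is left.\<close>

lemma not_poly_spread_above_1:
  assumes \<alpha>: "\<alpha> > 1"
  shows "eventually (\<lambda>T. \<not> poly_spread L V \<alpha> k T) at_top"
proof (cases \<alpha>)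
  case PInf
  have "\<not> poly_spread L V \<alpha> k T" if "T \<ge> 1" for T
  proof -
    have "outside_prob L V (cutoff \<alpha> T) T = 0" using PInf by (simp add: cutoff_def outside_prob_def)
    then show ?thesis using that by (simp add: poly_spread_def not_le)
  qed
  with eventually_ge_at_top[of 1] show ?thesis by (rule eventually_mono)
next
  case (real a)
  then have a: "a > 1" using \<alpha> by simp
  \<comment> \<open>Enlarged to be strictly positive, which fixes its sign in the asymptotic
    comparison.\<close>
  define C where "C = high_const + 1"
  have C: "C > 0" "high_const \<le> C" using high_const_nonneg by (auto simp: C_def)
  have pos: "8 * K / pi > 0" using K_ge by simp
  have "eventually (\<lambda>T. 8 * K / pi * T * exp (- (T powr a - 3) / (4 * T)) + C * exp (- (T powr a - 3) / 4)
      < T powr (- real k)) at_top"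
    using a pos C(1) by real_asymp
  moreover have "eventually (\<lambda>T. T powr a \<ge> 3) at_top"
    using a by real_asymp
  ultimately show ?thesis
    using eventually_ge_at_top[of 1]
  proof eventually_elim
    case (elim T)
    have "outside_prob L V (cutoff \<alpha> T) T = outside_prob L V (ereal (T powr a - 2)) T"
      using real by (simp add: cutoff_def)
    also have "\<dots> \<le> 8 * K / pi * T * exp (- (T powr a - 2 - 1) / (4 * T)) + high_const * exp (- (T powr a - 2 - 1) / 4)"
      using elim by (intro outside_prob_ballistic) auto
    also have "\<dots> \<le> 8 * K / pi * T * exp (- (T powr a - 3) / (4 * T)) + C * exp (- (T powr a - 3) / 4)"
      using C(2) by simp
    also have "\<dots> < T powr (- real k)" using elim by simp
    finally show ?case by (simp add: poly_spread_def)
  qed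
qed (use \<alpha> in auto)

end

text \<open>For \<alpha> = 0 the conclusion always holds and for \<alpha> > 1 the premise eventually
  fails. In between, \<alpha> > 0 makes the radius nonnegative for large T, and \<alpha> <= 1 keeps
  it within T - 2.\<close>

lemma poly_spread_transfer:
  assumes ops: "schroedinger_op L V1 K" "schroedinger_op L V2 K" and C: "C > 0"
    and cmp: "\<And>E \<epsilon> n. E \<in> {-K..K} \<Longrightarrow> \<epsilon> \<in> {0<..1} \<Longrightarrow> n \<in> insert 0 (sites L) \<Longrightarrow> \<bar>real_of_int n\<bar> \<le> 1 / \<epsilon> \<Longrightarrow>
      opnorm (transfer V2 n (Complex E \<epsilon>)) \<le> C * (\<epsilon> powr (- A) * opnorm (transfer V1 n (Complex E \<epsilon>)))"
    and \<alpha>: "0 \<le> \<alpha>"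
  shows "\<exists>k'. eventually (\<lambda>T. poly_spread L V1 \<alpha> k T \<longrightarrow> poly_spread L V2 \<alpha> k' T) at_top"
proof -
  interpret o1: schroedinger_op L V1 K by fact
  interpret o2: schroedinger_op L V2 K by fact
  consider "\<alpha> = 0" | "\<alpha> > 1" | "0 < \<alpha>" "\<alpha> \<le> 1" using \<alpha> by fastforce
  then show ?thesis
  proof cases
    case 1
    then show ?thesis using o2.poly_spread_0 by (auto elim!: eventually_mono)
  next
    case 2
    then show ?thesis using o1.not_poly_spread_above_1[of \<alpha> k] by (auto elim!: eventually_mono)
  next
    case 3
    then obtain a where a: "\<alpha> = ereal a" "0 < a" "a \<le> 1" by (cases \<alpha>) auto
    obtain D where D: "D > 0" "\<And>T N. T \<ge> 1 \<Longrightarrow> 0 \<le> N \<Longrightarrow> N + 2 \<le> T \<Longrightarrow>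
        outside_prob L V1 (ereal N) T \<le> D * T powr (2 * A + 10) * outside_prob L V2 (ereal N) T + D * exp (- N / 4)"
      using outside_prob_compare[OF ops C cmp] by blast
    define B where "B = 2 * A + 10"
    \<comment> \<open>Besides the loss T^B, one further power of T absorbs the constant 2 D.\<close>
    define k' where "k' = k + nat \<lceil>B\<rceil> + 1"
    have k': "real k' \<ge> real k + B + 1" unfolding k'_def by linarith
    \<comment> \<open>Since a > 0, the exponential term falls below half of the lower bound, so the
      other half must come from the second operator.\<close>
    have "eventually (\<lambda>T. D * exp (- (T powr a - 2) / 4) \<le> T powr (- real k) / 2) at_top"
      using a D(1) by real_asymp
    moreover have "eventually (\<lambda>T. T powr a \<ge> 2) at_top" using a by real_asymp
    moreover have "eventually (\<lambda>T. T \<ge> max 1 (2 * D)) at_top" by (rule eventually_ge_at_top)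
    ultimately have "eventually (\<lambda>T. poly_spread L V1 \<alpha> k T \<longrightarrow> poly_spread L V2 \<alpha> k' T) at_top"
    proof eventually_elim
      case (elim T)
      show ?case
      proof
        assume sp: "poly_spread L V1 \<alpha> k T"
        have T: "T \<ge> 1" "T \<ge> 2 * D" using elim by auto
        define N where "N = T powr a - 2"
        have cut: "cutoff \<alpha> T = ereal N" by (simp add: cutoff_def a(1) N_def)
        have "T powr a \<le> T powr 1" using T a by (intro powr_mono) auto
        then have N: "0 \<le> N" "N + 2 \<le> T" using elim T by (auto simp: N_def)
        define P where "P = outside_prob L V2 (ereal N) T"
        have "T powr (- real k) \<le> D * T powr B * P + D * exp (- N / 4)"
          using sp D(2)[OF T(1) N] by (simp add: poly_spread_def cut B_def P_def)
        also have "D * exp (- N / 4) \<le> T powr (- real k) / 2" using elim by (simp add: N_def)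
        finally have "T powr (- real k) \<le> 2 * D * (T powr B * P)" by simp
        also have "\<dots> \<le> T * (T powr B * P)"
          using T o2.outside_prob_nonneg[of T "ereal N"] by (intro mult_right_mono) (auto simp: P_def)
        finally have "T powr (- real k) \<le> T powr (B + 1) * P" using T by (simp add: powr_add mult_ac)
        then have "T powr (- (B + 1)) * T powr (- real k) \<le> T powr (- (B + 1)) * (T powr (B + 1) * P)"
          by (intro mult_left_mono) auto
        also have "\<dots> = P" using T by (simp flip: mult.assoc powr_add)
        also have "T powr (- (B + 1)) * T powr (- real k) = T powr (- (real k + B + 1))"
          by (simp flip: powr_add add: algebra_simps)
        finally have "T powr (- (real k + B + 1)) \<le> P" .
        moreover have "T powr (- real k') \<le> T powr (- (real k + B + 1))"
          using T k' by (intro powr_mono) auto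
        ultimately show "poly_spread L V2 \<alpha> k' T" by (simp add: poly_spread_def cut P_def)
      qed
    qed
    then show ?thesis ..
  qed
qed

lemma transport_finite_transfer:
  assumes ops: "schroedinger_op L V1 K" "schroedinger_op L V2 K" and C: "C > 0"
    and cmp: "\<And>E \<epsilon> n. E \<in> {-K..K} \<Longrightarrow> \<epsilon> \<in> {0<..1} \<Longrightarrow> n \<in> insert 0 (sites L) \<Longrightarrow> \<bar>real_of_int n\<bar> \<le> 1 / \<epsilon> \<Longrightarrow>
      opnorm (transfer V2 n (Complex E \<epsilon>)) \<le> C * (\<epsilon> powr (- A) * opnorm (transfer V1 n (Complex E \<epsilon>)))"
    and \<alpha>: "0 \<le> \<alpha>"
  shows "S_minus L V1 \<alpha> < \<infinity> \<Longrightarrow> S_minus L V2 \<alpha> < \<infinity>"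
    and "S_plus L V1 \<alpha> < \<infinity> \<Longrightarrow> S_plus L V2 \<alpha> < \<infinity>"
proof -
  interpret o1: schroedinger_op L V1 K by fact
  interpret o2: schroedinger_op L V2 K by fact
  note transfer = poly_spread_transfer[OF ops C cmp \<alpha>]
  show "S_minus L V2 \<alpha> < \<infinity>" if fin: "S_minus L V1 \<alpha> < \<infinity>"
  proof -
    from fin obtain k where k: "eventually (poly_spread L V1 \<alpha> k) at_top"
      unfolding o1.S_minus_finite_iff ..
    obtain k' where "eventually (\<lambda>T. poly_spread L V1 \<alpha> k T \<longrightarrow> poly_spread L V2 \<alpha> k' T) at_top"
      using transfer by blast
    from this k have "eventually (poly_spread L V2 \<alpha> k') at_top" by (rule eventually_mp)
    then show ?thesis unfolding o2.S_minus_finite_iff ..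
  qed
  show "S_plus L V2 \<alpha> < \<infinity>" if fin: "S_plus L V1 \<alpha> < \<infinity>"
  proof -
    from fin obtain k where k: "frequently (poly_spread L V1 \<alpha> k) at_top"
      unfolding o1.S_plus_finite_iff ..
    obtain k' where "eventually (\<lambda>T. poly_spread L V1 \<alpha> k T \<longrightarrow> poly_spread L V2 \<alpha> k' T) at_top"
      using transfer by blast
    from k this have "frequently (poly_spread L V2 \<alpha> k') at_top" by (rule frequently_rev_mp)
    then show ?thesis unfolding o2.S_plus_finite_iff ..
  qed
qed

theorem theorem2:
  fixes L :: line and V1 V2 :: "int \<Rightarrow> real" and K :: real
  assumes "bounded (V1 ` sites L)" and "bounded (V2 ` sites L)"
    and "K \<ge> 4"
    and "spectrum_on (ell2_on (sites L)) (schroedinger L V1) \<subseteq> complex_of_real ` {-K + 1..K - 1}"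
    and "spectrum_on (ell2_on (sites L)) (schroedinger L V2) \<subseteq> complex_of_real ` {-K + 1..K - 1}"
    and "\<exists>A>0. \<exists>C1>0. \<exists>C2>0. \<forall>E\<in>{-K..K}. \<forall>\<epsilon>\<in>{0<..1}. \<forall>n\<in>insert 0 (sites L).
      \<bar>real_of_int n\<bar> \<le> 1 / \<epsilon> \<longrightarrow>
        \<epsilon> powr A * opnorm (transfer V1 n (Complex E \<epsilon>)) \<le> C1 * opnorm (transfer V2 n (Complex E \<epsilon>)) \<and>
        opnorm (transfer V2 n (Complex E \<epsilon>)) \<le> C2 * (\<epsilon> powr (- A) * opnorm (transfer V1 n (Complex E \<epsilon>)))"
  shows "alpha_u_plus L V1 = alpha_u_plus L V2 \<and> alpha_u_minus L V1 = alpha_u_minus L V2"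
proof -
  have ops: "schroedinger_op L V1 K" "schroedinger_op L V2 K"
    by (rule schroedinger_op.intro[OF assms(1,3,4)], rule schroedinger_op.intro[OF assms(2,3,5)])
  obtain A C1 C2 where C: "C1 > 0" "C2 > 0" and cmp: "\<And>E \<epsilon> n. E \<in> {-K..K} \<Longrightarrow> \<epsilon> \<in> {0<..1} \<Longrightarrow>
      n \<in> insert 0 (sites L) \<Longrightarrow> \<bar>real_of_int n\<bar> \<le> 1 / \<epsilon> \<Longrightarrow>
        \<epsilon> powr A * opnorm (transfer V1 n (Complex E \<epsilon>)) \<le> C1 * opnorm (transfer V2 n (Complex E \<epsilon>)) \<and>
        opnorm (transfer V2 n (Complex E \<epsilon>)) \<le> C2 * (\<epsilon> powr (- A) * opnorm (transfer V1 n (Complex E \<epsilon>)))"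
    using assms(6) by metis
  have cmp12: "opnorm (transfer V2 n (Complex E \<epsilon>)) \<le> C2 * (\<epsilon> powr (- A) * opnorm (transfer V1 n (Complex E \<epsilon>)))"
    if "E \<in> {-K..K}" "\<epsilon> \<in> {0<..1}" "n \<in> insert 0 (sites L)" "\<bar>real_of_int n\<bar> \<le> 1 / \<epsilon>" for E \<epsilon> n
    using cmp[OF that] by blast
  have cmp21: "opnorm (transfer V1 n (Complex E \<epsilon>)) \<le> C1 * (\<epsilon> powr (- A) * opnorm (transfer V2 n (Complex E \<epsilon>)))"
    if "E \<in> {-K..K}" "\<epsilon> \<in> {0<..1}" "n \<in> insert 0 (sites L)" "\<bar>real_of_int n\<bar> \<le> 1 / \<epsilon>" for E \<epsilon> n
  proof -
    \<comment> \<open>Multiplying the lower comparison by \<epsilon>^(-A) gives it the form of the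
      upper one with the operators exchanged.\<close>
    have "\<epsilon> powr (- A) * (\<epsilon> powr A * opnorm (transfer V1 n (Complex E \<epsilon>)))
        \<le> \<epsilon> powr (- A) * (C1 * opnorm (transfer V2 n (Complex E \<epsilon>)))"
      using cmp[OF that] by (intro mult_left_mono) auto
    moreover have "\<epsilon> powr A * \<epsilon> powr (- A) = 1" using that(2) by (simp flip: powr_add)
    ultimately show ?thesis by (simp add: mult.left_commute flip: mult.assoc)
  qed
  note t12 = transport_finite_transfer[OF ops C(2) cmp12]
  note t21 = transport_finite_transfer[OF ops(2,1) C(1) cmp21]
  have "S_minus L V1 \<alpha> < \<infinity> \<longleftrightarrow> S_minus L V2 \<alpha> < \<infinity>" "S_plus L V1 \<alpha> < \<infinity> \<longleftrightarrow> S_plus L V2 \<alpha> < \<infinity>"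
    if "0 \<le> \<alpha>" for \<alpha>
    using t12[of \<alpha>] t21[of \<alpha>] that by blast+
  then have "{\<alpha>. 0 \<le> \<alpha> \<and> S_minus L V1 \<alpha> < \<infinity>} = {\<alpha>. 0 \<le> \<alpha> \<and> S_minus L V2 \<alpha> < \<infinity>}"
    "{\<alpha>. 0 \<le> \<alpha> \<and> S_plus L V1 \<alpha> < \<infinity>} = {\<alpha>. 0 \<le> \<alpha> \<and> S_plus L V2 \<alpha> < \<infinity>}"
    by blast+
  then show ?thesis unfolding alpha_u_plus_def alpha_u_minus_def by simp
qed

end
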